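(* Let $d\ge 1$ and let $k$ be a complete NP kernel on $B_d$. Assume that there is a set $\mathcal{P}\subseteq \mathcal{H}(k)\cap C(\overline{B_d})$ which is dense in $\mathcal{H}(k)$ and such that for all $p\in\mathcal{P}$ and all $z\in\partial B_d$, $$\lim_{\lambda\to z,\ \lambda\in B_d}\frac{\|p k_\lambda\|}{\|k_\lambda\|}=|p(z)|.$$ Let $\mathcal{M}\subseteq\mathcal{H}(k)$ be a nonzero multiplier invariant subspace, and let $\{\varphi_n\}_{n\ge1}\subseteq M(k)\cap\mathcal{M}$ be any (finite or infinite) sequence such that $$P_{\mathcal{M}}=\sum_{n\ge 1}M_{\varphi_n}M_{\varphi_n}^*\quad\text{(convergence in the strong operator topology)},$$ where $P_{\mathcal M}$ is the orthogonal projection of $\mathcal{H}(k)$ onto $\mathcal{M}$. Then $\{\varphi_n\}$ is an inner sequence, i.e. $$\sum_{n\ge1}|\varphi_n(z)|^2=1\quad\text{for } \sigma\text{-a.e. } z\in\partial B_d .$$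
   Context: $B_d=\{\lambda\in\mathbb{C}^d:|\lambda|<1\}$, and $\sigma$ is the rotationally invariant probability measure on $\partial B_d$. $\mathcal{H}(k)$ is the Hilbert space of analytic functions on $B_d$ with reproducing kernel $k$: $k_\lambda\in\mathcal{H}(k)$ and $f(\lambda)=\langle f,k_\lambda\rangle$ for all $f\in\mathcal{H}(k)$, $\lambda\in B_d$. $k$ is a complete Nevanlinna-Pick kernel (complete NP kernel) if $k_0(z)=1$ for all $z\in B_d$ and there is a (finite or infinite) sequence of analytic functions $\{b_n\}_{n\ge1}$ on $B_d$ with $1-\frac{1}{k_\lambda(z)}=\sum_{n\ge1}b_n(z)\overline{b_n(\lambda)}$ for all $\lambda,z\in B_d$. $M(k)$ is the set of multipliers of $\mathcal{H}(k)$, i.e. analytic functions $\varphi$ on $B_d$ with $\varphi f\in\mathcal{H}(k)$ for every $f\in\mathcal{H}(k)$; $M_\varphi f=\varphi f$ is then a bounded operator on $\mathcal{H}(k)$. (For a complete NP kernel each $k_\lambda$ is in $M(k)$, so $pk_\lambda\in\mathcal{H}(k)$.) A (closed) subspace $\mathcal{M}$ is multiplier invariant if $\varphi\mathcal{M}\subseteq\mathcal{M}$ for every $\varphi\in M(k)$. Each $\varphi_n$ as in the claim lies in the unit ball of $H^\infty(B_d)$, and $\varphi_n(z)$ for $z\in\partial B_d$ denotes its nontangential limit, which exists for $\sigma$-a.e. $z$. *)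

theory Defs
  imports "HOL-Probability.Probability" "HOL-Library.Function_Algebras"
begin

(* B_d is ball (0 :: complex^'d) 1 with d = CARD('d) >= 1; the norm of complex^'d is the
   Euclidean norm of C^d.  A function on B_d is represented by a total function; elements of
   the Hilbert space vanish off the ball, so that equality in HOL is equality on B_d.
   Sums, differences and products of functions are the pointwise ones of Function_Algebras. *)

definition on_ball :: "(complex^'d \<Rightarrow> complex) \<Rightarrow> complex^'d \<Rightarrow> complex" where
  "on_ball f = (\<lambda>z. if z \<in> ball 0 1 then f z else 0)"

(* Frechet differentiable with complex-linear derivative; *s is complex scalar multiplication. *)
definition analytic_on_ball :: "(complex^'d \<Rightarrow> complex) \<Rightarrow> bool" where
  "analytic_on_ball f \<longleftrightarrow>
     (\<forall>z\<in>ball 0 1. \<exists>D. (f has_derivative D) (at z) \<and> (\<forall>c v. D (c *s v) = c * D v))"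

definition hnorm :: "('f \<Rightarrow> 'f \<Rightarrow> complex) \<Rightarrow> 'f \<Rightarrow> real" where
  "hnorm ip f = sqrt (Re (ip f f))"

(* The Hilbert space H(k) with inner product ip (linear in the first argument) and
   reproducing kernel k; k l z stands for k_l(z). *)
locale rkhs =
  fixes H :: "(complex^'d \<Rightarrow> complex) set"
    and ip :: "(complex^'d \<Rightarrow> complex) \<Rightarrow> (complex^'d \<Rightarrow> complex) \<Rightarrow> complex"
    and k :: "complex^'d \<Rightarrow> complex^'d \<Rightarrow> complex"
  assumes analytic: "f \<in> H \<Longrightarrow> analytic_on_ball f"
    and off_ball: "f \<in> H \<Longrightarrow> z \<notin> ball 0 1 \<Longrightarrow> f z = 0"
    and zero_mem: "0 \<in> H"
    and add_mem: "f \<in> H \<Longrightarrow> g \<in> H \<Longrightarrow> f + g \<in> H"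
    and scale_mem: "f \<in> H \<Longrightarrow> (\<lambda>z. c * f z) \<in> H"
    and ip_add: "f \<in> H \<Longrightarrow> g \<in> H \<Longrightarrow> h \<in> H \<Longrightarrow> ip (f + g) h = ip f h + ip g h"
    and ip_scale: "f \<in> H \<Longrightarrow> h \<in> H \<Longrightarrow> ip (\<lambda>z. c * f z) h = c * ip f h"
    and ip_cnj: "f \<in> H \<Longrightarrow> h \<in> H \<Longrightarrow> ip h f = cnj (ip f h)"
    and ip_pos: "f \<in> H \<Longrightarrow> f \<noteq> 0 \<Longrightarrow> 0 < Re (ip f f)"
    and complete: "(\<And>n. F n \<in> H) \<Longrightarrow>
      \<forall>e>0. \<exists>N::nat. \<forall>m\<ge>N. \<forall>n\<ge>N. hnorm ip (F m - F n) < e \<Longrightarrow>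
      \<exists>f\<in>H. (\<lambda>n. hnorm ip (F n - f)) \<longlonglongrightarrow> 0"
    and kernel_mem: "l \<in> ball 0 1 \<Longrightarrow> k l \<in> H"
    and reproducing: "f \<in> H \<Longrightarrow> l \<in> ball 0 1 \<Longrightarrow> f l = ip f (k l)"

(* Index sets of finite and infinite sequences; indices start at 0. *)
definition seq_index :: "nat set \<Rightarrow> bool" where
  "seq_index I \<longleftrightarrow> I = UNIV \<or> (\<exists>N. I = {..<N})"

(* k l z \<noteq> 0 is implicit in the expression 1/k_l(z); in HOL, 1/0 = 0. *)
definition complete_NP_kernel :: "(complex^'d \<Rightarrow> complex^'d \<Rightarrow> complex) \<Rightarrow> bool" where
  "complete_NP_kernel k \<longleftrightarrow>
     (\<forall>z\<in>ball 0 1. k 0 z = 1) \<and>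
     (\<forall>l\<in>ball 0 1. \<forall>z\<in>ball 0 1. k l z \<noteq> 0) \<and>
     (\<exists>I b. seq_index I \<and> (\<forall>n\<in>I. analytic_on_ball (b n)) \<and>
        (\<forall>l\<in>ball 0 1. \<forall>z\<in>ball 0 1.
           (\<lambda>n. if n \<in> I then b n z * cnj (b n l) else 0) sums (1 - 1 / k l z)))"

(* Values of a multiplier off the ball are irrelevant, since elements of H vanish there. *)
definition multipliers :: "(complex^'d \<Rightarrow> complex) set \<Rightarrow> (complex^'d \<Rightarrow> complex) set" where
  "multipliers H = {\<phi>. analytic_on_ball \<phi> \<and> (\<forall>f\<in>H. \<phi> * f \<in> H)}"

definition mult_op :: "(complex^'d \<Rightarrow> complex) \<Rightarrow> (complex^'d \<Rightarrow> complex) \<Rightarrow> complex^'d \<Rightarrow> complex" where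
  "mult_op \<phi> f = \<phi> * f"

definition hilbert_adjoint ::
  "'f set \<Rightarrow> ('f \<Rightarrow> 'f \<Rightarrow> complex) \<Rightarrow> ('f \<Rightarrow> 'f) \<Rightarrow> 'f \<Rightarrow> 'f" where
  "hilbert_adjoint H ip T g = (THE h. h \<in> H \<and> (\<forall>f\<in>H. ip (T f) g = ip f h))"

definition hilbert_proj ::
  "('f::minus \<Rightarrow> 'f \<Rightarrow> complex) \<Rightarrow> 'f set \<Rightarrow> 'f \<Rightarrow> 'f" where
  "hilbert_proj ip M f = (THE g. g \<in> M \<and> (\<forall>h\<in>M. ip (f - g) h = 0))"

definition closed_lin_subspace ::
  "(complex^'d \<Rightarrow> complex) set \<Rightarrow>
   ((complex^'d \<Rightarrow> complex) \<Rightarrow> (complex^'d \<Rightarrow> complex) \<Rightarrow> complex) \<Rightarrow>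
   (complex^'d \<Rightarrow> complex) set \<Rightarrow> bool" where
  "closed_lin_subspace H ip M \<longleftrightarrow>
     M \<subseteq> H \<and> 0 \<in> M \<and> (\<forall>f\<in>M. \<forall>g\<in>M. f + g \<in> M) \<and> (\<forall>c. \<forall>f\<in>M. (\<lambda>z. c * f z) \<in> M) \<and>
     (\<forall>F. \<forall>f\<in>H. (\<forall>n::nat. F n \<in> M) \<and> (\<lambda>n. hnorm ip (F n - f)) \<longlonglongrightarrow> 0 \<longrightarrow> f \<in> M)"

definition multiplier_invariant_subspace ::
  "(complex^'d \<Rightarrow> complex) set \<Rightarrow>
   ((complex^'d \<Rightarrow> complex) \<Rightarrow> (complex^'d \<Rightarrow> complex) \<Rightarrow> complex) \<Rightarrow>
   (complex^'d \<Rightarrow> complex) set \<Rightarrow> bool" where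
  "multiplier_invariant_subspace H ip M \<longleftrightarrow>
     closed_lin_subspace H ip M \<and> (\<forall>\<phi>\<in>multipliers H. \<forall>f\<in>M. mult_op \<phi> f \<in> M)"

(* Rotations are the linear isometries of C^d = R^2d; sphere 0 1 is the boundary of B_d. *)
definition rotation_invariant_prob :: "(complex^'d) measure \<Rightarrow> bool" where
  "rotation_invariant_prob \<sigma> \<longleftrightarrow>
     prob_space \<sigma> \<and> sets \<sigma> = sets (restrict_space borel (sphere 0 1)) \<and>
     (\<forall>U. orthogonal_transformation U \<longrightarrow> distr \<sigma> \<sigma> U = \<sigma>)"

definition has_nt_limit :: "(complex^'d \<Rightarrow> complex) \<Rightarrow> complex^'d \<Rightarrow> complex \<Rightarrow> bool" where
  "has_nt_limit f z w \<longleftrightarrow>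
     (\<forall>a>1. (f \<longlongrightarrow> w) (at z within {l \<in> ball 0 1. dist l z < a * (1 - norm l)}))"

(* The existence of the boundary values w n at almost every point is part of the claim. *)
definition inner_sequence ::
  "(complex^'d) measure \<Rightarrow> nat set \<Rightarrow> (nat \<Rightarrow> complex^'d \<Rightarrow> complex) \<Rightarrow> bool" where
  "inner_sequence \<sigma> I \<phi> \<longleftrightarrow>
     (AE z in \<sigma>. \<exists>w. (\<forall>n\<in>I. has_nt_limit (\<phi> n) z (w n)) \<and>
        (\<lambda>n. if n \<in> I then (cmod (w n))\<^sup>2 else 0) sums 1)"

end

theory Submission
  imports Defs "HOL-Complex_Analysis.Complex_Analysis"
begin

text \<open>For a complete NP kernel, \<open>\<parallel>k\<^sub>\<lambda> f\<parallel>\<^sup>2 / \<parallel>k\<^sub>\<lambda>\<parallel>\<^sup>2 \<le> Re V\<^sub>f(\<lambda>)\<close> with the analytic function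
  \<open>V\<^sub>f(\<lambda>) = 2 \<langle>f, k\<^sub>\<lambda> f\<rangle> - \<parallel>f\<parallel>\<^sup>2\<close>, whose real part is nonnegative with value \<open>\<parallel>f\<parallel>\<^sup>2\<close> at the origin.
  Averaging over the rotations \<open>z \<mapsto> e\<^sup>i\<^sup>t z\<close> reduces the weak type estimate for the radial maximal
  function of \<open>Re V\<^sub>f\<close> to the Hardy-Littlewood estimate on the circle, and Harnack's inequality replaces
  radial by nontangential maximal functions. Approximating \<open>f\<close> by elements of \<open>P\<close> one obtains for almost
  every \<open>z\<close> a number \<open>f(z)\<close> with \<open>\<parallel>(f - f(z)) k\<^sub>\<lambda>\<parallel> / \<parallel>k\<^sub>\<lambda>\<parallel> \<rightarrow> 0\<close> nontangentially.

  If \<open>\<phi>\<close> is a nonzero member of the sequence, then \<open>\<phi>(z) \<noteq> 0\<close> almost everywhere and \<open>\<phi> k\<^sub>\<lambda> / \<phi>(z) \<in> M\<close>, so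
  \<open>1 - \<Sum>|\<phi>\<^sub>n(\<lambda>)|\<^sup>2 = dist(k\<^sub>\<lambda>, M)\<^sup>2 / \<parallel>k\<^sub>\<lambda>\<parallel>\<^sup>2 \<le> \<parallel>k\<^sub>\<lambda> - \<phi> k\<^sub>\<lambda> / \<phi>(z)\<parallel>\<^sup>2 / \<parallel>k\<^sub>\<lambda>\<parallel>\<^sup>2 \<rightarrow> 0\<close>.
  The limit is exchanged with the sum because the means of \<open>|\<phi>\<^sub>n|\<^sup>2\<close> over the spheres of radius \<open>r\<close>
  increase with \<open>r\<close>.\<close>

section \<open>Reproducing kernel Hilbert spaces\<close>

text \<open>The limit hypothesis speaks only about \<open>P\<close>, whereas the members of the
  sequence need not be continuous up to the boundary. The maximal estimate carries the limit from
  \<open>P\<close> to all of \<open>H\<close>, because its right-hand side is the squared norm in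
  \<open>H\<close>, in which \<open>P\<close> is dense. The majorant comes from the Nevanlinna-Pick
  property: with K = \<open>kap l\<close>, multiplication by \<open>k l\<close> - K has norm at most
  sqrt(K^2 - K), and in the expansion of the square of |(\<open>k l\<close> - K) f| the terms K^2
  |f|^2 cancel, leaving a cross term whose quotient by K is the real part of an analytic function of
  \<open>l\<close>. About the measure only its rotation invariance is ever used: every estimate on
  the sphere is an average of one-variable estimates over circles. The nonvanishing of boundary
  values is the delicate point. On a slice where the function vanishes identically nothing can be
  said, so such slices must be shown to be negligible. The circles through the origin never leave
  their slice; rotations about other axes are therefore brought in, which show that at one fixed
  radius the function is nonzero in almost every direction.\<close>

definition smult_fun :: "complex \<Rightarrow> ('a \<Rightarrow> complex) \<Rightarrow> 'a \<Rightarrow> complex" (infixr "\<odot>" 75)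
  where "c \<odot> f = (\<lambda>z. c * f z)"

lemma smult_fun_apply [simp]: "(c \<odot> f) z = c * f z"
  by (simp add: smult_fun_def)

lemma diff_eq_add_smult: "f - g = f + (-1) \<odot> g"
  by (auto simp: fun_eq_iff)

lemma sum_fun_apply: "(\<Sum>i\<in>A. f i) z = (\<Sum>i\<in>A. f i z)" for f :: "'i \<Rightarrow> 'a \<Rightarrow> complex"
  by (induction A rule: infinite_finite_induct) auto

context rkhs
begin

abbreviation nrm :: "(complex^'d \<Rightarrow> complex) \<Rightarrow> real" where "nrm \<equiv> hnorm ip"

lemma smult_mem: "f \<in> H \<Longrightarrow> c \<odot> f \<in> H"
  unfolding smult_fun_def by (rule scale_mem)

lemma diff_mem: "f \<in> H \<Longrightarrow> g \<in> H \<Longrightarrow> f - g \<in> H"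
  unfolding diff_eq_add_smult by (intro add_mem smult_mem)

lemma sum_mem: "(\<And>i. i \<in> A \<Longrightarrow> f i \<in> H) \<Longrightarrow> (\<Sum>i\<in>A. f i) \<in> H"
  by (induction A rule: infinite_finite_induct) (auto intro: zero_mem add_mem)

lemma ip_smult: "f \<in> H \<Longrightarrow> h \<in> H \<Longrightarrow> ip (c \<odot> f) h = c * ip f h"
  unfolding smult_fun_def by (rule ip_scale)

lemma ip_add_right: "f \<in> H \<Longrightarrow> g \<in> H \<Longrightarrow> h \<in> H \<Longrightarrow> ip h (f + g) = ip h f + ip h g"
  by (metis add_mem complex_cnj_add ip_add ip_cnj)

lemma ip_smult_right: "f \<in> H \<Longrightarrow> h \<in> H \<Longrightarrow> ip h (c \<odot> f) = cnj c * ip h f"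
  by (metis complex_cnj_mult ip_cnj ip_smult smult_mem)

lemma ip_diff: "f \<in> H \<Longrightarrow> g \<in> H \<Longrightarrow> h \<in> H \<Longrightarrow> ip (f - g) h = ip f h - ip g h"
  by (simp add: diff_eq_add_smult ip_add ip_smult smult_mem)

lemma ip_diff_right: "f \<in> H \<Longrightarrow> g \<in> H \<Longrightarrow> h \<in> H \<Longrightarrow> ip h (f - g) = ip h f - ip h g"
  by (simp add: diff_eq_add_smult ip_add_right ip_smult_right smult_mem)

lemma ip_zero_left: "h \<in> H \<Longrightarrow> ip 0 h = 0"
  using ip_diff[of 0 0 h] zero_mem by simp

lemma ip_zero_right: "h \<in> H \<Longrightarrow> ip h 0 = 0"
  using ip_diff_right[of 0 0 h] zero_mem by simp

lemma ip_sum: "(\<And>i. i \<in> A \<Longrightarrow> f i \<in> H) \<Longrightarrow> h \<in> H \<Longrightarrow> ip (\<Sum>i\<in>A. f i) h = (\<Sum>i\<in>A. ip (f i) h)"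
  by (induction A rule: infinite_finite_induct) (auto simp: ip_zero_left ip_add sum_mem)

lemma ip_sum_right: "(\<And>i. i \<in> A \<Longrightarrow> f i \<in> H) \<Longrightarrow> h \<in> H \<Longrightarrow> ip h (\<Sum>i\<in>A. f i) = (\<Sum>i\<in>A. ip h (f i))"
  by (induction A rule: infinite_finite_induct) (auto simp: ip_zero_right ip_add_right sum_mem)

lemma ip_self_nonneg: "f \<in> H \<Longrightarrow> 0 \<le> Re (ip f f)"
  using ip_pos[of f] by (cases "f = 0") (auto simp: ip_zero_left zero_mem)

lemma nrm_nonneg: "f \<in> H \<Longrightarrow> 0 \<le> nrm f"
  by (simp add: hnorm_def ip_self_nonneg)

lemma nrm_sq: "f \<in> H \<Longrightarrow> (nrm f)\<^sup>2 = Re (ip f f)"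
  by (simp add: hnorm_def ip_self_nonneg)

lemma ip_self: "f \<in> H \<Longrightarrow> ip f f = of_real ((nrm f)\<^sup>2)"
  using ip_cnj[of f f] by (simp add: nrm_sq complex_eq_iff)

lemma nrm_zero: "nrm 0 = 0"
  by (simp add: hnorm_def ip_zero_left zero_mem)

lemma nrm_eq_0: "f \<in> H \<Longrightarrow> nrm f = 0 \<longleftrightarrow> f = 0"
  using ip_pos[of f] nrm_sq[of f] nrm_zero by (cases "f = 0") auto

lemma nrm_smult: "f \<in> H \<Longrightarrow> nrm (c \<odot> f) = cmod c * nrm f"
proof -
  assume f: "f \<in> H"
  have "ip (c \<odot> f) (c \<odot> f) = (c * cnj c) * ip f f"
    using f by (simp add: ip_smult ip_smult_right smult_mem)
  also have "\<dots> = of_real ((cmod c * nrm f)\<^sup>2)"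
    using ip_self[OF f] by (simp add: power_mult_distrib complex_norm_square[symmetric])
  finally show ?thesis
    using nrm_nonneg[OF f] by (simp add: hnorm_def)
qed

lemma nrm_add_sq:
  "f \<in> H \<Longrightarrow> g \<in> H \<Longrightarrow> (nrm (f + g))\<^sup>2 = (nrm f)\<^sup>2 + 2 * Re (ip f g) + (nrm g)\<^sup>2"
  using ip_cnj[of f g] by (simp add: nrm_sq add_mem ip_add ip_add_right)

lemma nrm_diff_sq:
  "f \<in> H \<Longrightarrow> g \<in> H \<Longrightarrow> (nrm (f - g))\<^sup>2 = (nrm f)\<^sup>2 - 2 * Re (ip f g) + (nrm g)\<^sup>2"
  using ip_cnj[of f g] by (simp add: nrm_sq diff_mem ip_diff ip_diff_right)

lemma cauchy_schwarz:
  assumes f: "f \<in> H" and g: "g \<in> H"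
  shows "cmod (ip f g) \<le> nrm f * nrm g"
proof (cases "g = 0")
  case True
  then show ?thesis using f by (simp add: ip_zero_right nrm_zero)
next
  case False
  define n where "n = (nrm g)\<^sup>2"
  have n: "n > 0" using False g by (simp add: n_def nrm_eq_0)
  define c where "c = ip f g / of_real n"
  have "0 \<le> (nrm (f - c \<odot> g))\<^sup>2" by simp
  also have "\<dots> = (nrm f)\<^sup>2 - 2 * Re (cnj c * ip f g) + (cmod c)\<^sup>2 * n"
    using f g by (simp add: nrm_diff_sq smult_mem ip_smult_right nrm_smult power_mult_distrib n_def)
  also have "cnj c * ip f g = of_real ((cmod (ip f g))\<^sup>2 / n)"
    by (simp add: c_def of_real_divide complex_norm_square mult.commute del: of_real_power)
  also have "(cmod c)\<^sup>2 * n = (cmod (ip f g))\<^sup>2 / n"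
    using n by (simp add: c_def norm_divide power_divide power2_eq_square)
  finally have "(cmod (ip f g))\<^sup>2 \<le> (nrm f)\<^sup>2 * n"
    using n by (simp add: field_simps)
  then have "(cmod (ip f g))\<^sup>2 \<le> (nrm f * nrm g)\<^sup>2"
    by (simp add: n_def power_mult_distrib)
  moreover have "0 \<le> nrm f * nrm g" using f g by (simp add: nrm_nonneg)
  ultimately show ?thesis by (rule power2_le_imp_le)
qed

lemma nrm_triangle:
  assumes f: "f \<in> H" and g: "g \<in> H"
  shows "nrm (f + g) \<le> nrm f + nrm g"
proof -
  have "Re (ip f g) \<le> nrm f * nrm g"
    using cauchy_schwarz[OF f g] complex_Re_le_cmod order_trans by blast
  then have "(nrm (f + g))\<^sup>2 \<le> (nrm f + nrm g)\<^sup>2"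
    unfolding nrm_add_sq[OF f g] power2_sum by simp
  moreover have "0 \<le> nrm f + nrm g" using f g by (simp add: nrm_nonneg)
  ultimately show ?thesis by (rule power2_le_imp_le)
qed

lemma nrm_minus_commute: "f \<in> H \<Longrightarrow> g \<in> H \<Longrightarrow> nrm (f - g) = nrm (g - f)"
proof -
  assume "f \<in> H" "g \<in> H"
  moreover have "f - g = (-1) \<odot> (g - f)" by (auto simp: fun_eq_iff)
  ultimately show ?thesis using nrm_smult[of "g - f" "-1"] by (simp add: diff_mem)
qed

lemma nrm_triangle_sub:
  assumes "f \<in> H" "g \<in> H"
  shows "nrm f \<le> nrm (f - g) + nrm g"
  using nrm_triangle[of "f - g" g] assms by (simp add: diff_mem)

lemma ip_tendsto:
  assumes F: "\<And>n. F n \<in> H" and f: "f \<in> H" and h: "h \<in> H"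
    and lim: "(\<lambda>n. nrm (F n - f)) \<longlonglongrightarrow> 0"
  shows "(\<lambda>n. ip (F n) h) \<longlonglongrightarrow> ip f h"
proof -
  have "(\<lambda>n. ip (F n) h - ip f h) \<longlonglongrightarrow> 0"
  proof (rule Lim_null_comparison)
    show "\<forall>\<^sub>F n in sequentially. norm (ip (F n) h - ip f h) \<le> nrm (F n - f) * nrm h"
      using cauchy_schwarz[OF diff_mem[OF F f] h] F f h by (simp add: ip_diff)
    show "(\<lambda>n. nrm (F n - f) * nrm h) \<longlonglongrightarrow> 0"
      using tendsto_mult_left_zero[OF lim] .
  qed
  then show ?thesis using Lim_null by blast
qed

lemma eval_tendsto:
  assumes F: "\<And>n. F n \<in> H" and f: "f \<in> H" and lim: "(\<lambda>n. nrm (F n - f)) \<longlonglongrightarrow> 0"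
  shows "(\<lambda>n. F n z) \<longlonglongrightarrow> f z"
proof (cases "z \<in> ball 0 1")
  case True
  show ?thesis
    using ip_tendsto[OF F f kernel_mem[OF True] lim] F f True by (simp add: reproducing[symmetric])
next
  case False
  then have "F n z = 0" "f z = 0" for n using F f off_ball by blast+
  then show ?thesis by simp
qed

lemma nrm_tendsto:
  assumes F: "\<And>n. F n \<in> H" and f: "f \<in> H" and lim: "(\<lambda>n. nrm (F n - f)) \<longlonglongrightarrow> 0"
  shows "(\<lambda>n. nrm (F n)) \<longlonglongrightarrow> nrm f"
proof -
  have "(\<lambda>n. nrm (F n) - nrm f) \<longlonglongrightarrow> 0"
  proof (rule Lim_null_comparison[OF _ lim], intro always_eventually allI)
    fix n
    show "norm (nrm (F n) - nrm f) \<le> nrm (F n - f)"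
      using nrm_triangle_sub[OF F f, of n] nrm_triangle_sub[OF f F, of n]
        nrm_minus_commute[OF f F, of n] by simp
  qed
  then show ?thesis using Lim_null by blast
qed

lemma ip_ext:
  assumes "f \<in> H" "g \<in> H" "\<And>h. h \<in> H \<Longrightarrow> ip h f = ip h g"
  shows "f = g"
proof -
  have "ip (f - g) (f - g) = 0"
    using assms by (simp add: ip_diff_right diff_mem)
  then have "nrm (f - g) = 0" by (simp add: hnorm_def)
  then show ?thesis using nrm_eq_0 assms diff_mem by (metis eq_iff_diff_eq_0)
qed

text \<open>The functional is given by its graph, so that it can be prescribed on a spanning family
  without checking beforehand that the prescription is well defined. The representing vector is
  the limit of a sequence minimizing \<open>\<parallel>x\<parallel>\<^sup>2 - 2 Re t\<close> over the graph.\<close>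

lemma riesz_linear_relation:
  assumes ne: "(0, 0) \<in> S" and SH: "\<And>x t. (x, t) \<in> S \<Longrightarrow> x \<in> H"
    and add: "\<And>x t y u. (x, t) \<in> S \<Longrightarrow> (y, u) \<in> S \<Longrightarrow> (x + y, t + u) \<in> S"
    and scale: "\<And>x t c. (x, t) \<in> S \<Longrightarrow> (c \<odot> x, c * t) \<in> S"
    and bound: "\<And>x t. (x, t) \<in> S \<Longrightarrow> cmod t \<le> C * nrm x"
  obtains h X where "h \<in> H" "\<And>n. X n \<in> fst ` S" "(\<lambda>n. nrm (X n - h)) \<longlonglongrightarrow> 0"
    "\<And>x t. (x, t) \<in> S \<Longrightarrow> ip x h = t"
proof -
  define J where "J = (\<lambda>(x, t). (nrm x)\<^sup>2 - 2 * Re t)"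
  have lower: "- C\<^sup>2 \<le> J p" if "p \<in> S" for p
  proof -
    obtain x t where p: "p = (x, t)" by (cases p)
    have "Re t \<le> C * nrm x" using bound[of x t] that p complex_Re_le_cmod order_trans by blast
    moreover have "0 \<le> (nrm x - C)\<^sup>2" by simp
    ultimately show ?thesis by (simp add: J_def p power2_diff mult.commute)
  qed
  define m where "m = Inf (J ` S)"
  have bdd: "bdd_below (J ` S)" using lower by (auto intro!: bdd_belowI2)
  have m_le: "m \<le> J p" if "p \<in> S" for p
    unfolding m_def using that bdd by (simp add: cInf_lower)
  have "\<exists>p\<in>S. J p < m + 1 / real (Suc n)" for n
    using cInf_lessD[of "J ` S" "m + 1 / real (Suc n)"] ne by (fastforce simp: m_def)
  then obtain p where p: "\<And>n. p n \<in> S" "\<And>n. J (p n) < m + 1 / real (Suc n)" by metis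
  define X where "X n = fst (p n)" for n
  define T where "T n = snd (p n)" for n
  have pS: "(X n, T n) \<in> S" for n using p by (simp add: X_def T_def)
  have XH: "X n \<in> H" for n using pS SH by blast
  have JX: "(nrm (X n))\<^sup>2 - 2 * Re (T n) < m + 1 / real (Suc n)" for n
    using p(2)[of n] by (simp add: J_def X_def T_def split_beta)
  \<comment> \<open>Midpoints of graph points stay in \<open>S\<close>, so \<open>J\<close> is at
    least \<open>m\<close> there, and the parallelogram law makes a minimizing sequence
    Cauchy.\<close>
  have cauchy_est: "(nrm (X i - X j))\<^sup>2 \<le> 2 / real (Suc i) + 2 / real (Suc j)" for i j
  proof -
    have "((1/2) \<odot> (X i + X j), (1/2) * (T i + T j)) \<in> S"
      by (intro scale add pS)
    from m_le[OF this] have "m \<le> (nrm (X i + X j))\<^sup>2 / 4 - Re (T i) - Re (T j)"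
      using XH by (simp add: J_def nrm_smult add_mem power_mult_distrib power_divide add_divide_distrib)
    moreover have "(nrm (X i + X j))\<^sup>2 + (nrm (X i - X j))\<^sup>2 = 2 * (nrm (X i))\<^sup>2 + 2 * (nrm (X j))\<^sup>2"
      using XH by (simp add: nrm_add_sq nrm_diff_sq)
    ultimately show ?thesis using JX[of i] JX[of j] by simp
  qed
  have "\<exists>h\<in>H. (\<lambda>n. nrm (X n - h)) \<longlonglongrightarrow> 0"
  proof (rule complete[OF XH], intro allI impI)
    fix e :: real assume e: "e > 0"
    obtain N where N: "real N > 4 / e\<^sup>2" using reals_Archimedean2 by blast
    show "\<exists>N. \<forall>m\<ge>N. \<forall>n\<ge>N. nrm (X m - X n) < e"
    proof (intro exI allI impI)
      fix i j assume ij: "i \<ge> N" "j \<ge> N"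
      have *: "2 / real (Suc i) < e\<^sup>2 / 2" if "i \<ge> N" for i
      proof -
        have "real (Suc i) > 4 / e\<^sup>2" using that N by simp
        then show ?thesis using e by (simp add: field_simps)
      qed
      have "(nrm (X i - X j))\<^sup>2 < e\<^sup>2"
        using cauchy_est[of i j] *[OF ij(1)] *[OF ij(2)] by linarith
      then show "nrm (X i - X j) < e" using e by (simp add: power_less_imp_less_base)
    qed
  qed
  then obtain h where h: "h \<in> H" and lim: "(\<lambda>n. nrm (X n - h)) \<longlonglongrightarrow> 0" by blast
  have re: "Re (ip x h) = Re t" if xt: "(x, t) \<in> S" for x t
  proof -
    have xH: "x \<in> H" using SH xt by blast
    define D where "D = Re (ip h x) - Re t"
    \<comment> \<open>First variation: moving from \<open>X n\<close> by \<open>s\<close> times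
      \<open>x\<close> cannot push \<open>J\<close> below \<open>m\<close>. In the limit this is a
      quadratic in \<open>s\<close> that vanishes at 0 and is never negative, so its linear
      coefficient is 0.\<close>
    have quad: "0 \<le> s\<^sup>2 * (nrm x)\<^sup>2 + 2 * s * D" for s :: real
    proof -
      have ineq: "0 \<le> s\<^sup>2 * (nrm x)\<^sup>2 + 2 * s * (Re (ip (X n) x) - Re t) + 1 / real (Suc n)" for n
      proof -
        have "(X n + of_real s \<odot> x, T n + of_real s * t) \<in> S"
          by (intro add scale pS xt)
        from m_le[OF this] show ?thesis
          using JX[of n] XH[of n] xH
          by (simp add: J_def nrm_add_sq smult_mem ip_smult_right nrm_smult power_mult_distrib
              algebra_simps)
      qed
      have "(\<lambda>n. s\<^sup>2 * (nrm x)\<^sup>2 + 2 * s * (Re (ip (X n) x) - Re t) + 1 / real (Suc n))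
          \<longlonglongrightarrow> s\<^sup>2 * (nrm x)\<^sup>2 + 2 * s * (Re (ip h x) - Re t) + 0"
        by (intro tendsto_intros ip_tendsto[OF XH h xH lim] LIMSEQ_Suc[OF lim_inverse_n'])
      then show ?thesis unfolding D_def
        using ineq by (intro LIMSEQ_le_const[where X = "\<lambda>n. s\<^sup>2 * (nrm x)\<^sup>2
          + 2 * s * (Re (ip (X n) x) - Re t) + 1 / real (Suc n)"]) auto
    qed
    have "D = 0"
    proof (rule ccontr)
      assume D: "D \<noteq> 0"
      \<comment> \<open>The added 1 keeps the divisor positive when \<open>x\<close> is 0.\<close>
      define a where "a = (nrm x)\<^sup>2 + 1"
      have a: "a > 0" by (simp add: a_def add_nonneg_pos)
      have "0 \<le> (- D / a)\<^sup>2 * a + 2 * (- D / a) * D"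
        using quad[of "- D / a"] by (simp add: a_def algebra_simps)
          (smt (verit) zero_le_power2)
      also have "\<dots> = - D\<^sup>2 / a"
        using a by (simp add: power2_eq_square)
      finally show False using D a by (simp add: field_simps)
    qed
    then show ?thesis using ip_cnj[OF xH h] by (simp add: D_def)
  qed
  have "ip x h = t" if xt: "(x, t) \<in> S" for x t
  proof (rule complex_eqI)
    show "Re (ip x h) = Re t" by (rule re[OF xt])
    have xH: "x \<in> H" using SH xt by blast
    \<comment> \<open>The imaginary part is the real part for the graph point multiplied by the
      imaginary unit.\<close>
    show "Im (ip x h) = Im t"
      using re[OF scale[OF xt, of "\<i>"]] by (simp add: ip_smult[OF xH h])
  qed
  moreover have "X n \<in> fst ` S" for n using pS by force
  ultimately show ?thesis using that h lim by blast
qed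

section \<open>Closed subspaces and orthogonal projections\<close>

lemma closed_lin_subspaceD:
  assumes "closed_lin_subspace H ip M"
  shows "M \<subseteq> H" "0 \<in> M" "\<And>f g. f \<in> M \<Longrightarrow> g \<in> M \<Longrightarrow> f + g \<in> M" "\<And>f c. f \<in> M \<Longrightarrow> c \<odot> f \<in> M"
    "\<And>F f. f \<in> H \<Longrightarrow> (\<And>n::nat. F n \<in> M) \<Longrightarrow> (\<lambda>n. nrm (F n - f)) \<longlonglongrightarrow> 0 \<Longrightarrow> f \<in> M"
  using assms unfolding closed_lin_subspace_def smult_fun_def by blast+

text \<open>The Riesz lemma is applied to the functional \<open>ip x f\<close> on \<open>M\<close>.
  Its approximating sequence lies in \<open>M\<close>, so closedness places the representing vector
  in \<open>M\<close>. Since \<open>hilbert_proj\<close> is a definite description, uniqueness has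
  to be shown as well.\<close>

lemma hilbert_proj:
  assumes M: "closed_lin_subspace H ip M" and f: "f \<in> H"
  shows "hilbert_proj ip M f \<in> M" "\<And>h. h \<in> M \<Longrightarrow> ip (f - hilbert_proj ip M f) h = 0"
proof -
  note MD = closed_lin_subspaceD[OF M]
  let ?S = "(\<lambda>x. (x, ip x f)) ` M"
  obtain g X where g: "g \<in> H" and X: "\<And>n. X n \<in> fst ` ?S" and lim: "(\<lambda>n. nrm (X n - g)) \<longlonglongrightarrow> 0"
    and rep: "\<And>x t. (x, t) \<in> ?S \<Longrightarrow> ip x g = t"
  proof (rule riesz_linear_relation[of ?S "nrm f"])
    show "(0, 0) \<in> ?S" using MD(2) f by (auto simp: image_iff ip_zero_left)
    show "x \<in> H" if "(x, t) \<in> ?S" for x t using that MD(1) by auto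
    show "(x + y, t + u) \<in> ?S" if "(x, t) \<in> ?S" "(y, u) \<in> ?S" for x t y u
      using that MD(1,3) f ip_add by (auto simp: image_iff subset_iff)
    show "(c \<odot> x, c * t) \<in> ?S" if "(x, t) \<in> ?S" for x t c
      using that MD(1,4) f ip_smult by (auto simp: image_iff subset_iff)
    show "cmod t \<le> nrm f * nrm x" if "(x, t) \<in> ?S" for x t
      using that MD(1) f cauchy_schwarz[of x f] by (auto simp: mult.commute)
  qed blast
  have XM: "X n \<in> M" for n using X[of n] by auto
  have gM: "g \<in> M" using MD(5)[OF g XM lim] .
  have orth: "ip (f - g) h = 0" if "h \<in> M" for h
  proof -
    have hH: "h \<in> H" using that MD(1) by blast
    have "ip h g = ip h f" using rep that by auto
    then have "ip h (f - g) = 0" using f g hH by (simp add: ip_diff_right)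
    then show ?thesis using ip_cnj[OF hH diff_mem[OF f g]] by simp
  qed
  have "g \<in> M \<and> (\<forall>h\<in>M. ip (f - g) h = 0)" using gM orth by blast
  moreover have "g' = g" if g': "g' \<in> M \<and> (\<forall>h\<in>M. ip (f - g') h = 0)" for g'
  proof -
    have g'H: "g' \<in> H" using g' MD(1) by blast
    have d: "g - g' \<in> M"
      unfolding diff_eq_add_smult using gM g' MD(3,4) by blast
    have dH: "g - g' \<in> H" using d MD(1) by blast
    have "g - g' = (f - g') - (f - g)" by simp
    then have "ip (g - g') (g - g') = 0"
      using ip_diff[OF diff_mem[OF f g'H] diff_mem[OF f g] dH] orth[OF d] g' d by simp
    then have "nrm (g - g') = 0" by (simp add: hnorm_def)
    then show ?thesis using nrm_eq_0[OF dH] by simp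
  qed
  ultimately have "hilbert_proj ip M f \<in> M \<and> (\<forall>h\<in>M. ip (f - hilbert_proj ip M f) h = 0)"
    unfolding hilbert_proj_def by (rule theI)
  then show "hilbert_proj ip M f \<in> M" "\<And>h. h \<in> M \<Longrightarrow> ip (f - hilbert_proj ip M f) h = 0" by auto
qed

text \<open>A vector orthogonal to all kernels vanishes at every point. This serves as an induction
  principle: a property stable under linear combinations and norm limits need only be checked on
  kernels.\<close>

lemma closed_subspace_UNIV_if_kernels:
  assumes M: "closed_lin_subspace H ip M" and ker: "\<And>l. l \<in> ball 0 1 \<Longrightarrow> k l \<in> M"
  shows "M = H"
proof
  show "M \<subseteq> H" using closed_lin_subspaceD(1)[OF M] .
  show "H \<subseteq> M"
  proof
    fix f assume f: "f \<in> H"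
    let ?g = "hilbert_proj ip M f"
    have g: "?g \<in> M" "?g \<in> H" using hilbert_proj(1)[OF M f] closed_lin_subspaceD(1)[OF M] by auto
    have "(f - ?g) z = 0" for z
    proof (cases "z \<in> ball 0 1")
      case True
      then show ?thesis
        using hilbert_proj(2)[OF M f ker] reproducing[OF diff_mem[OF f g(2)]] by metis
    qed (use off_ball[OF diff_mem[OF f g(2)]] in blast)
    then have "f = ?g" by (simp add: fun_eq_iff)
    then show "f \<in> M" using g(1) by simp
  qed
qed

end

section \<open>Complete Nevanlinna-Pick kernels\<close>

text \<open>Weaker than \<^const>\<open>analytic_on_ball\<close>, but closed under locally uniform limits by one-variable theory.\<close>

definition ball_regular :: "(complex^'d \<Rightarrow> complex) \<Rightarrow> bool" where
  "ball_regular G \<longleftrightarrow> continuous_on (ball 0 1) G \<and>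
     (\<forall>x v. (\<lambda>\<zeta>. G (x + \<zeta> *s v)) holomorphic_on {\<zeta>. x + \<zeta> *s v \<in> ball 0 1})"

lemma norm_vector_scalar_mult [simp]: "norm (c *s v) = cmod c * norm v" for v :: "complex^'d"
proof -
  have "norm (c *s v) = L2_set (\<lambda>i. cmod c * cmod (v $ i)) UNIV"
    by (simp add: norm_vec_def norm_mult)
  also have "\<dots> = cmod c * norm v"
    by (simp add: L2_set_right_distrib norm_vec_def)
  finally show ?thesis .
qed

lemma has_derivative_vector_scalar_mult:
  "((\<lambda>\<zeta>. x + \<zeta> *s v) has_derivative (\<lambda>h. h *s v)) F" for v :: "complex^'d"
proof -
  have "bounded_linear (\<lambda>h. h *s v)"
    by (rule bounded_linear_intro[where K = "norm v"])
      (auto simp: vector_sadd_rdistrib vec_eq_iff)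
  then show ?thesis
    by (auto intro!: derivative_eq_intros bounded_linear_imp_has_derivative)
qed

lemma continuous_on_vector_scalar_mult [continuous_intros]:
  assumes "continuous_on S f" "continuous_on S g"
  shows "continuous_on S (\<lambda>x. f x *s (g x :: complex^'d))"
  unfolding vector_scalar_mult_def
  by (intro continuous_on_vec_lambda continuous_on_mult assms continuous_on_component)

lemma open_line_ball: "open {\<zeta>. x + \<zeta> *s v \<in> ball (0::complex^'d) r}"
proof -
  have "continuous_on UNIV (\<lambda>\<zeta>. x + \<zeta> *s v)" by (intro continuous_intros)
  from open_vimage[OF open_ball this, of 0 r] show ?thesis by (simp add: vimage_def)
qed

lemma ball_regular_analytic:
  fixes f :: "complex^'d \<Rightarrow> complex"
  assumes "analytic_on_ball f"
  shows "ball_regular f"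
  unfolding ball_regular_def
proof (intro conjI allI)
  show "continuous_on (ball 0 1) f"
    using assms unfolding analytic_on_ball_def
    by (meson continuous_at_imp_continuous_on has_derivative_continuous)
  fix x v :: "complex^'d"
  show "(\<lambda>\<zeta>. f (x + \<zeta> *s v)) holomorphic_on {\<zeta>. x + \<zeta> *s v \<in> ball 0 1}"
    unfolding holomorphic_on_open[OF open_line_ball]
  proof
    fix \<zeta> assume "\<zeta> \<in> {\<zeta>. x + \<zeta> *s v \<in> ball 0 1}"
    then have "\<exists>D. (f has_derivative D) (at (x + \<zeta> *s v)) \<and> (\<forall>c v. D (c *s v) = c * D v)"
      using assms unfolding analytic_on_ball_def by blast
    then obtain D where D: "(f has_derivative D) (at (x + \<zeta> *s v))" "\<And>c v. D (c *s v) = c * D v"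
      by blast
    have "((\<lambda>\<zeta>. f (x + \<zeta> *s v)) has_derivative (\<lambda>h. D (h *s v))) (at \<zeta>)"
      by (rule has_derivative_compose[OF has_derivative_vector_scalar_mult D(1)])
    then have "((\<lambda>\<zeta>. f (x + \<zeta> *s v)) has_field_derivative D v) (at \<zeta>)"
      unfolding has_field_derivative_def by (simp add: D(2) mult.commute[of _ "D v"])
    then show "\<exists>f'. ((\<lambda>\<zeta>. f (x + \<zeta> *s v)) has_field_derivative f') (at \<zeta>)" ..
  qed
qed

lemma ball_regular_intros:
  "ball_regular (\<lambda>_. c)"
  "ball_regular F \<Longrightarrow> ball_regular G \<Longrightarrow> ball_regular (\<lambda>z. F z + G z)"
  "ball_regular F \<Longrightarrow> ball_regular (\<lambda>z. c * F z)"
  unfolding ball_regular_def by (auto intro!: continuous_intros holomorphic_intros)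

lemma ball_regular_cong:
  assumes "ball_regular F" "\<And>z. z \<in> ball 0 1 \<Longrightarrow> F z = G z"
  shows "ball_regular G"
  unfolding ball_regular_def
proof (intro conjI allI)
  show "continuous_on (ball 0 1) G"
    by (rule continuous_on_eq[of _ F]) (use assms in \<open>auto simp: ball_regular_def\<close>)
  show "(\<lambda>\<zeta>. G (x + \<zeta> *s v)) holomorphic_on {\<zeta>. x + \<zeta> *s v \<in> ball 0 1}" for x v
    using assms(1)[unfolded ball_regular_def, THEN conjunct2, rule_format, of x v]
    by (rule holomorphic_transform) (use assms(2) in auto)
qed

lemma ball_regular_limit:
  fixes G :: "complex^'d \<Rightarrow> complex"
  assumes F: "\<And>n. ball_regular (F n)"
    and lim: "\<And>\<rho>. \<rho> < 1 \<Longrightarrow> uniform_limit (cball 0 \<rho>) F G sequentially"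
  shows "ball_regular G"
  unfolding ball_regular_def
proof (intro conjI allI)
  have F': "\<And>n. continuous_on (ball 0 1) (F n)"
    "\<And>n x v. (\<lambda>\<zeta>. F n (x + \<zeta> *s v)) holomorphic_on {\<zeta>. x + \<zeta> *s v \<in> ball 0 1}"
    using F by (auto simp: ball_regular_def)
  show "continuous_on (ball 0 1) G"
  proof (rule continuous_at_imp_continuous_on, rule ballI)
    fix x :: "complex^'d" assume x: "x \<in> ball 0 1"
    define \<rho> where "\<rho> = (1 + norm x) / 2"
    have \<rho>: "norm x < \<rho>" "\<rho> < 1" using x by (auto simp: \<rho>_def)
    have "continuous_on (cball 0 \<rho>) (F n)" for n
      using F'(1) by (rule continuous_on_subset) (use \<rho> in auto)
    then have "continuous_on (cball 0 \<rho>) G"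
      using uniform_limit_theorem[OF _ lim[OF \<rho>(2)]] by simp
    then show "isCont G x"
      by (rule continuous_on_interior) (use \<rho> in \<open>simp add: interior_cball\<close>)
  qed
  fix x v :: "complex^'d"
  let ?S = "{\<zeta>. x + \<zeta> *s v \<in> ball 0 1}"
  show "(\<lambda>\<zeta>. G (x + \<zeta> *s v)) holomorphic_on ?S"
  proof (rule holomorphic_uniform_sequence[OF open_line_ball F'(2)])
    fix \<zeta> assume \<zeta>: "\<zeta> \<in> ?S"
    define \<rho> where "\<rho> = (1 + norm (x + \<zeta> *s v)) / 2"
    have \<rho>: "norm (x + \<zeta> *s v) < \<rho>" "\<rho> < 1" using \<zeta> by (auto simp: \<rho>_def)
    have "\<zeta> \<in> {\<zeta>. x + \<zeta> *s v \<in> ball 0 \<rho>}" using \<rho> by simp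
    then obtain d where d: "d > 0" "cball \<zeta> d \<subseteq> {\<zeta>. x + \<zeta> *s v \<in> ball 0 \<rho>}"
      using open_line_ball open_contains_cball by blast
    have "uniform_limit (cball \<zeta> d) (\<lambda>n \<zeta>. F n (x + \<zeta> *s v)) (\<lambda>\<zeta>. G (x + \<zeta> *s v)) sequentially"
      by (rule uniform_limit_compose'[OF lim[OF \<rho>(2)]]) (use d in auto)
    then show "\<exists>d>0. cball \<zeta> d \<subseteq> ?S \<and>
        uniform_limit (cball \<zeta> d) (\<lambda>n \<zeta>. F n (x + \<zeta> *s v)) (\<lambda>\<zeta>. G (x + \<zeta> *s v)) sequentially"
      using d \<rho>(2) by (intro exI[of _ d]) auto
  qed
qed

section \<open>Multipliers tested on finite combinations of kernels\<close>

context rkhs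
begin

lemma kernel_comb_mem: "A \<subseteq> ball 0 1 \<Longrightarrow> (\<Sum>w\<in>A. c w \<odot> k w) \<in> H"
  by (intro sum_mem smult_mem kernel_mem) auto

text \<open>The adjoint of multiplication by \<open>\<psi>\<close> must send \<open>k w\<close> to
  \<open>cnj (\<psi> w)\<close> times \<open>k w\<close>. The hypothesis bounds this map by
  \<open>C\<close> on combinations of kernels; composed with the inner product against
  \<open>f\<close> it becomes a bounded functional, and its Riesz vector is the product of
  \<open>\<psi>\<close> and \<open>f\<close>.\<close>

lemma multiplier_criterion:
  assumes crit: "\<And>A c. finite A \<Longrightarrow> A \<subseteq> ball 0 1 \<Longrightarrow>
      nrm (\<Sum>w\<in>A. (c w * cnj (\<psi> w)) \<odot> k w) \<le> C * nrm (\<Sum>w\<in>A. c w \<odot> k w)"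
    and C: "0 \<le> C" and f: "f \<in> H"
  shows "on_ball (\<psi> * f) \<in> H" "nrm (on_ball (\<psi> * f)) \<le> C * nrm f"
proof -
  define lin where "lin A c = (\<Sum>w\<in>A. c w \<odot> k w)" for A c
  \<comment> \<open>Kernels may be linearly dependent, so one vector can arise from several pairs
    \<open>A\<close>, \<open>c\<close>. Recording the graph postpones single-valuedness to the Riesz
    lemma.\<close>
  define S where "S = {(lin A c, ip (lin A (\<lambda>w. c w * cnj (\<psi> w))) f) | A c. finite A \<and> A \<subseteq> ball 0 1}"
  have lin_mem: "lin A c \<in> H" if "A \<subseteq> ball 0 1" for A c
    using kernel_comb_mem[OF that] by (simp add: lin_def)
  have lin_ext: "lin A c = lin B (\<lambda>w. if w \<in> A then c w else 0)" if "finite B" "A \<subseteq> B" for A B c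
    unfolding lin_def using that by (intro sum.mono_neutral_cong_left) (auto simp: fun_eq_iff)
  have lin_add: "lin A (\<lambda>w. c w + d w) = lin A c + lin A d" for A c d
    by (simp add: lin_def fun_eq_iff sum_fun_apply sum.distrib algebra_simps)
  have lin_scale: "lin A (\<lambda>w. a * c w) = a \<odot> lin A c" for A c a
    by (simp add: lin_def fun_eq_iff sum_fun_apply sum_distrib_left mult.assoc)
  have bound: "cmod t \<le> (C * nrm f) * nrm x" if xt: "(x, t) \<in> S" for x t
  proof -
    obtain A c where A: "finite A" "A \<subseteq> ball 0 1" and x: "x = lin A c"
      and t: "t = ip (lin A (\<lambda>w. c w * cnj (\<psi> w))) f"
      using xt by (auto simp: S_def)
    have "cmod t \<le> nrm (lin A (\<lambda>w. c w * cnj (\<psi> w))) * nrm f"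
      unfolding t by (rule cauchy_schwarz[OF lin_mem[OF A(2)] f])
    also have "\<dots> \<le> (C * nrm x) * nrm f"
      unfolding x lin_def by (rule mult_right_mono[OF crit[OF A] nrm_nonneg[OF f]])
    finally show ?thesis by (simp add: mult_ac)
  qed
  obtain h X where h: "h \<in> H" and X: "\<And>n. X n \<in> fst ` S" and lim: "(\<lambda>n. nrm (X n - h)) \<longlonglongrightarrow> 0"
    and rep: "\<And>x t. (x, t) \<in> S \<Longrightarrow> ip x h = t"
  proof (rule riesz_linear_relation[of S "C * nrm f"])
    show "(0, 0) \<in> S"
      unfolding S_def by (auto simp: lin_def ip_zero_left f intro!: exI[of _ "{}"])
    show "x \<in> H" if "(x, t) \<in> S" for x t using that lin_mem by (auto simp: S_def)
    show "(x + y, t + u) \<in> S" if xt: "(x, t) \<in> S" and yu: "(y, u) \<in> S" for x t y u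
    proof -
      obtain A c where A: "finite A" "A \<subseteq> ball 0 1" and x: "x = lin A c"
        and t: "t = ip (lin A (\<lambda>w. c w * cnj (\<psi> w))) f"
        using xt by (auto simp: S_def)
      obtain B d where B: "finite B" "B \<subseteq> ball 0 1" and y: "y = lin B d"
        and u: "u = ip (lin B (\<lambda>w. d w * cnj (\<psi> w))) f"
        using yu by (auto simp: S_def)
      let ?c = "\<lambda>w. if w \<in> A then c w else 0" and ?d = "\<lambda>w. if w \<in> B then d w else 0"
      have xy: "x + y = lin (A \<union> B) (\<lambda>w. ?c w + ?d w)"
        unfolding lin_add x y using A(1) B(1) by (simp add: lin_ext[of "A \<union> B" A] lin_ext[of "A \<union> B" B])
      have *: "lin A (\<lambda>w. c w * cnj (\<psi> w)) = lin (A \<union> B) (\<lambda>w. ?c w * cnj (\<psi> w))"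
        "lin B (\<lambda>w. d w * cnj (\<psi> w)) = lin (A \<union> B) (\<lambda>w. ?d w * cnj (\<psi> w))"
        using A(1) B(1) by (simp_all add: lin_ext[of "A \<union> B" A] lin_ext[of "A \<union> B" B])
          (auto simp: lin_def intro!: sum.cong)
      have "t + u = ip (lin (A \<union> B) (\<lambda>w. (?c w + ?d w) * cnj (\<psi> w))) f"
        unfolding t u * distrib_right lin_add using A(2) B(2) by (intro ip_add[symmetric] lin_mem f) auto
      then show ?thesis unfolding S_def xy using A B by blast
    qed
    show "(a \<odot> x, a * t) \<in> S" if xt: "(x, t) \<in> S" for x t a
    proof -
      obtain A c where A: "finite A" "A \<subseteq> ball 0 1" and x: "x = lin A c"
        and t: "t = ip (lin A (\<lambda>w. c w * cnj (\<psi> w))) f"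
        using xt by (auto simp: S_def)
      have "a * t = ip (lin A (\<lambda>w. (a * c w) * cnj (\<psi> w))) f"
        unfolding t mult.assoc lin_scale using ip_smult[OF lin_mem[OF A(2)] f] by simp
      then show ?thesis unfolding S_def x lin_scale[symmetric] using A by blast
    qed
  qed (use bound in auto)
  have hz: "h = on_ball (\<psi> * f)"
  proof
    fix z show "h z = on_ball (\<psi> * f) z"
    proof (cases "z \<in> ball 0 1")
      case True
      have "(lin {z} (\<lambda>_. 1), ip (lin {z} (\<lambda>w. 1 * cnj (\<psi> w))) f) \<in> S"
        unfolding S_def using True by blast
      from rep[OF this] have "ip (k z) h = cnj (\<psi> z) * ip (k z) f"
        using kernel_mem[OF True] f
        by (simp add: lin_def ip_smult smult_fun_def[of 1] ip_scale)
      then have "cnj (h z) = cnj (\<psi> z * f z)"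
        using ip_cnj[OF h kernel_mem[OF True]] ip_cnj[OF f kernel_mem[OF True]]
          reproducing[OF h True] reproducing[OF f True] by simp
      then have "h z = \<psi> z * f z" by (simp only: complex_cnj_cancel_iff)
      then show ?thesis using True by (simp add: on_ball_def)
    qed (use off_ball[OF h] in \<open>auto simp: on_ball_def\<close>)
  qed
  show "on_ball (\<psi> * f) \<in> H" using h hz by simp
  have XH: "X n \<in> H" for n using X[of n] lin_mem by (auto simp: S_def)
  \<comment> \<open>The Riesz lemma also supplies combinations of kernels that converge to
    \<open>h\<close>. The bound is tested on them, and the limit gives an inequality from which one
    factor \<open>nrm h\<close> cancels.\<close>
  have "(nrm h)\<^sup>2 \<le> (C * nrm f) * nrm h"
  proof (rule LIMSEQ_le)
    show "(\<lambda>n. cmod (ip (X n) h)) \<longlonglongrightarrow> (nrm h)\<^sup>2"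
      using tendsto_norm[OF ip_tendsto[OF XH h h lim]] by (simp add: ip_self[OF h] norm_power nrm_nonneg[OF h])
    show "(\<lambda>n. (C * nrm f) * nrm (X n)) \<longlonglongrightarrow> (C * nrm f) * nrm h"
      by (intro tendsto_intros nrm_tendsto[OF XH h lim])
    have "cmod (ip (X n) h) \<le> (C * nrm f) * nrm (X n)" for n
    proof -
      obtain t where "(X n, t) \<in> S" using X[of n] by force
      with rep[OF this] bound[OF this] show ?thesis by simp
    qed
    then show "\<exists>N. \<forall>n\<ge>N. cmod (ip (X n) h) \<le> (C * nrm f) * nrm (X n)" by blast
  qed
  moreover have "0 \<le> C * nrm f" using C nrm_nonneg[OF f] by simp
  ultimately have "nrm h \<le> C * nrm f"
    using nrm_nonneg[OF h] by (cases "nrm h = 0") (auto simp: power2_eq_square)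
  then show "nrm (on_ball (\<psi> * f)) \<le> C * nrm f" unfolding hz[symmetric] by auto
qed

lemma kernel_cnj:
  assumes "l \<in> ball 0 1" "z \<in> ball 0 1"
  shows "k z l = cnj (k l z)"
  using ip_cnj[OF kernel_mem[OF assms(1)] kernel_mem[OF assms(2)]]
    reproducing[OF kernel_mem[OF assms(1)] assms(2)] reproducing[OF kernel_mem[OF assms(2)] assms(1)]
  by simp

lemma ip_kernel_left:
  assumes "l \<in> ball 0 1" "f \<in> H"
  shows "ip (k l) f = cnj (f l)"
  using ip_cnj[OF assms(2) kernel_mem[OF assms(1)]] reproducing[OF assms(2,1)] by simp

lemma kernel_diag: "l \<in> ball 0 1 \<Longrightarrow> k l l = of_real ((nrm (k l))\<^sup>2)"
  using reproducing[OF kernel_mem, of l l] ip_self[OF kernel_mem, of l] by simp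

lemma nrm_kernel_comb:
  assumes A: "finite A" "A \<subseteq> ball 0 1"
  shows "of_real ((nrm (\<Sum>w\<in>A. c w \<odot> k w))\<^sup>2) = (\<Sum>w\<in>A. \<Sum>v\<in>A. c w * cnj (c v) * k w v)"
proof -
  have kH: "c w \<odot> k w \<in> H" if "w \<in> A" for w using that A by (intro smult_mem kernel_mem) auto
  have "of_real ((nrm (\<Sum>w\<in>A. c w \<odot> k w))\<^sup>2)
      = (\<Sum>w\<in>A. \<Sum>v\<in>A. ip (c w \<odot> k w) (c v \<odot> k v))"
    by (subst ip_self[symmetric], simp_all add: ip_sum ip_sum_right kH sum_mem) (rule sum.swap)
  also have "\<dots> = (\<Sum>w\<in>A. \<Sum>v\<in>A. c w * cnj (c v) * k w v)"
  proof (intro sum.cong refl)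
    fix w v assume "w \<in> A" "v \<in> A"
    then have "w \<in> ball 0 1" "v \<in> ball 0 1" using A by auto
    then show "ip (c w \<odot> k w) (c v \<odot> k v) = c w * cnj (c v) * k w v"
      by (simp add: ip_smult ip_smult_right kernel_mem smult_mem reproducing[symmetric])
  qed
  finally show ?thesis .
qed

lemma kernel_psd:
  assumes A: "finite A" "A \<subseteq> ball 0 1"
  shows "0 \<le> Re (\<Sum>w\<in>A. \<Sum>v\<in>A. c w * cnj (c v) * k w v)"
  unfolding nrm_kernel_comb[OF A, symmetric] by simp

end

section \<open>Positivity and growth from the Nevanlinna-Pick property\<close>

lemma Re_of_real_mult: "Re (of_real r * z) = r * Re z"
  by simp

text \<open>Polarized form of the identity behind the Cauchy-Schwarz inequality; the factor 2
  appears because each pair of indices is counted twice. It displays the defect as a sum of rank one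
  terms, a function of \<open>x\<close> times the conjugate of the same function of
  \<open>y\<close>.\<close>

lemma lagrange_identity:
  fixes x y a :: "nat \<Rightarrow> complex"
  shows "2 * ((\<Sum>n<N. a n * cnj (a n)) * (\<Sum>n<N. x n * cnj (y n))
      - (\<Sum>n<N. x n * cnj (a n)) * cnj (\<Sum>n<N. y n * cnj (a n)))
    = (\<Sum>m<N. \<Sum>n<N. (x m * a n - x n * a m) * cnj (y m * a n - y n * a m))"
proof -
  have "(\<Sum>m<N. \<Sum>n<N. (x m * a n - x n * a m) * cnj (y m * a n - y n * a m))
    = (\<Sum>m<N. \<Sum>n<N. (x m * cnj (y m)) * (a n * cnj (a n)))
    + (\<Sum>m<N. \<Sum>n<N. (a m * cnj (a m)) * (x n * cnj (y n)))
    - (\<Sum>m<N. \<Sum>n<N. (x m * cnj (a m)) * (cnj (y n) * a n))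
    - (\<Sum>m<N. \<Sum>n<N. (cnj (y m) * a m) * (x n * cnj (a n)))"
    unfolding sum.distrib[symmetric] sum_subtractf[symmetric]
    by (intro sum.cong refl) (simp add: algebra_simps)
  then show ?thesis
    unfolding sum_product[symmetric] by (simp add: cnj_sum algebra_simps)
qed

locale np_rkhs = rkhs H ip k for H :: "(complex^'d \<Rightarrow> complex) set" and ip k +
  assumes np: "complete_NP_kernel k"
begin

lemma kernel_0: "z \<in> ball 0 1 \<Longrightarrow> k 0 z = 1"
  and kernel_nz: "l \<in> ball 0 1 \<Longrightarrow> z \<in> ball 0 1 \<Longrightarrow> k l z \<noteq> 0"
  using np by (auto simp: complete_NP_kernel_def)

text \<open>Padding with zeros lets finite and infinite sequences be treated alike.\<close>

lemma np_series:
  obtains b :: "nat \<Rightarrow> complex^'d \<Rightarrow> complex" where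
    "\<And>l z. l \<in> ball 0 1 \<Longrightarrow> z \<in> ball 0 1 \<Longrightarrow> (\<lambda>n. b n z * cnj (b n l)) sums (1 - 1 / k l z)"
proof -
  obtain I b where b: "\<And>l z. l \<in> ball 0 1 \<Longrightarrow> z \<in> ball 0 1 \<Longrightarrow>
      (\<lambda>n. if n \<in> I then b n z * cnj (b n l) else 0) sums (1 - 1 / k l z)"
    using np unfolding complete_NP_kernel_def by blast
  show thesis
  proof (rule that[of "\<lambda>n z. if n \<in> I then b n z else 0"])
    fix l z :: "complex^'d" assume "l \<in> ball 0 1" "z \<in> ball 0 1"
    from b[OF this] show "(\<lambda>n. (if n \<in> I then b n z else 0) * cnj (if n \<in> I then b n l else 0))
        sums (1 - 1 / k l z)"
      by (rule back_subst[where P = "\<lambda>f. f sums _"]) auto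
  qed
qed

definition kap :: "complex^'d \<Rightarrow> real" where "kap l = (nrm (k l))\<^sup>2"

lemma kap_diag: "l \<in> ball 0 1 \<Longrightarrow> k l l = of_real (kap l)"
  using kernel_diag by (simp add: kap_def)

lemma kap_pos: "l \<in> ball 0 1 \<Longrightarrow> 0 < kap l"
  using kernel_nz[of l l] kap_diag[of l] by (simp add: kap_def)

text \<open>With B(z) the vector of all b_n(z), the bracket is |B(l)|^2 <B(v),B(w)> - <B(v),B(l)>
  <B(l),B(w)>. For partial sums the Lagrange identity writes it as a sum of rank one terms; each is
  absorbed into the coefficients \<open>d\<close>, after which positivity is that of
  \<open>k\<close> itself.\<close>

lemma np_defect_psd:
  assumes A: "finite A" "A \<subseteq> ball 0 1" and l: "l \<in> ball 0 1"
  shows "0 \<le> Re (\<Sum>w\<in>A. \<Sum>v\<in>A. d w * cnj (d v) * k w v *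
      ((1 - 1 / k l l) * (1 - 1 / k w v) - (1 - 1 / k l v) * cnj (1 - 1 / k l w)))"
proof -
  obtain b :: "nat \<Rightarrow> complex^'d \<Rightarrow> complex" where
    b: "\<And>l z. l \<in> ball 0 1 \<Longrightarrow> z \<in> ball 0 1 \<Longrightarrow> (\<lambda>n. b n z * cnj (b n l)) sums (1 - 1 / k l z)"
    by (rule np_series) blast
  define L where "L N w v = (\<Sum>n<N. b n l * cnj (b n l)) * (\<Sum>n<N. b n v * cnj (b n w))
      - (\<Sum>n<N. b n v * cnj (b n l)) * cnj (\<Sum>n<N. b n w * cnj (b n l))" for N w v
  have "(\<lambda>N. \<Sum>w\<in>A. \<Sum>v\<in>A. d w * cnj (d v) * k w v * L N w v) \<longlonglongrightarrow>
     (\<Sum>w\<in>A. \<Sum>v\<in>A. d w * cnj (d v) * k w v *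
      ((1 - 1 / k l l) * (1 - 1 / k w v) - (1 - 1 / k l v) * cnj (1 - 1 / k l w)))"
    unfolding L_def using b l A
    by (intro tendsto_intros tendsto_sum) (auto simp: sums_def subset_iff)
  then have lim: "(\<lambda>N. Re (\<Sum>w\<in>A. \<Sum>v\<in>A. d w * cnj (d v) * k w v * L N w v)) \<longlonglongrightarrow>
     Re (\<Sum>w\<in>A. \<Sum>v\<in>A. d w * cnj (d v) * k w v *
      ((1 - 1 / k l l) * (1 - 1 / k w v) - (1 - 1 / k l v) * cnj (1 - 1 / k l w)))"
    by (rule tendsto_Re)
  have pos: "0 \<le> Re (\<Sum>w\<in>A. \<Sum>v\<in>A. d w * cnj (d v) * k w v * L N w v)" for N
  proof -
    define D where "D m n z = b m z * b n l - b n z * b m l" for m n z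
    have "2 * (\<Sum>w\<in>A. \<Sum>v\<in>A. d w * cnj (d v) * k w v * L N w v)
      = (\<Sum>w\<in>A. \<Sum>v\<in>A. d w * cnj (d v) * k w v * (2 * L N w v))"
      by (simp add: sum_distrib_left mult_ac)
    also have "\<dots> = (\<Sum>w\<in>A. \<Sum>v\<in>A. \<Sum>m<N. \<Sum>n<N.
        d w * cnj (d v) * k w v * (D m n v * cnj (D m n w)))"
      unfolding L_def lagrange_identity D_def by (simp only: sum_distrib_left)
    also have "\<dots> = (\<Sum>w\<in>A. \<Sum>m<N. \<Sum>n<N. \<Sum>v\<in>A.
        d w * cnj (d v) * k w v * (D m n v * cnj (D m n w)))"
      by (intro sum.cong refl) (simp add: sum.swap[of _ "{..<N}" A])
    also have "\<dots> = (\<Sum>m<N. \<Sum>n<N. \<Sum>w\<in>A. \<Sum>v\<in>A.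
        (d w * cnj (D m n w)) * cnj (d v * cnj (D m n v)) * k w v)"
      by (simp add: sum.swap[of _ "{..<N}" A] mult_ac)
    finally have "Re (2 * (\<Sum>w\<in>A. \<Sum>v\<in>A. d w * cnj (d v) * k w v * L N w v))
      = (\<Sum>m<N. \<Sum>n<N. Re (\<Sum>w\<in>A. \<Sum>v\<in>A.
        (d w * cnj (D m n w)) * cnj (d v * cnj (D m n v)) * k w v))"
      by (simp only: Re_sum)
    also have "0 \<le> \<dots>"
      by (intro sum_nonneg kernel_psd A)
    finally show ?thesis by simp
  qed
  show ?thesis
    by (rule LIMSEQ_le_const[OF lim]) (use pos in auto)
qed

text \<open>With B(z) the vector of all b_n(z), this is 2 |<B(z),B(l)>| <= |B(l)|^2 + |B(z)|^2. As
  the right-hand side is below 2, the function 1 - 1/\<open>k l\<close> maps the ball into the unit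
  disc, as the Schwarz lemma requires.\<close>

lemma np_estimate:
  assumes l: "l \<in> ball 0 1" and z: "z \<in> ball 0 1"
  shows "2 * cmod (1 - 1 / k l z) \<le> (1 - 1 / kap l) + (1 - 1 / kap z)"
proof -
  obtain b :: "nat \<Rightarrow> complex^'d \<Rightarrow> complex" where
    b: "\<And>l z. l \<in> ball 0 1 \<Longrightarrow> z \<in> ball 0 1 \<Longrightarrow> (\<lambda>n. b n z * cnj (b n l)) sums (1 - 1 / k l z)"
    by (rule np_series) blast
  have diag: "(\<lambda>n. (cmod (b n z))\<^sup>2) sums (1 - 1 / kap z)" if "z \<in> ball 0 1" for z
  proof -
    have "(\<lambda>n. of_real ((cmod (b n z))\<^sup>2)) sums (of_real (1 - 1 / kap z) :: complex)"
      using b[OF that that] kap_diag[OF that] by (simp add: complex_norm_square del: of_real_power)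
    then show ?thesis by (simp only: sums_of_real_iff)
  qed
  have lim1: "(\<lambda>N. 2 * cmod (\<Sum>n<N. b n z * cnj (b n l))) \<longlonglongrightarrow> 2 * cmod (1 - 1 / k l z)"
    using b[OF l z] unfolding sums_def by (intro tendsto_intros)
  have lim2: "(\<lambda>N. \<Sum>n<N. (cmod (b n l))\<^sup>2 + (cmod (b n z))\<^sup>2) \<longlonglongrightarrow> (1 - 1 / kap l) + (1 - 1 / kap z)"
    using sums_add[OF diag[OF l] diag[OF z]] by (simp only: sums_def)
  have "2 * cmod (\<Sum>n<N. b n z * cnj (b n l)) \<le> (\<Sum>n<N. (cmod (b n l))\<^sup>2 + (cmod (b n z))\<^sup>2)" for N
  proof -
    have "cmod (\<Sum>n<N. b n z * cnj (b n l)) \<le> (\<Sum>n<N. cmod (b n z) * cmod (b n l))"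
      by (rule order_trans[OF norm_sum]) (simp add: norm_mult)
    also have "2 * \<dots> \<le> (\<Sum>n<N. (cmod (b n l))\<^sup>2 + (cmod (b n z))\<^sup>2)"
      unfolding sum_distrib_left
    proof (rule sum_mono)
      fix n show "2 * (cmod (b n z) * cmod (b n l)) \<le> (cmod (b n l))\<^sup>2 + (cmod (b n z))\<^sup>2"
        using zero_le_power2[of "cmod (b n l) - cmod (b n z)"] unfolding power2_diff by (simp add: mult_ac)
    qed
    finally show ?thesis by simp
  qed
  then show ?thesis by (intro LIMSEQ_le[OF lim1 lim2]) auto
qed

text \<open>On the complex line through \<open>l\<close>, the function 1 - 1/\<open>k l\<close> is a
  self-map of the disc fixing 0, and by the Schwarz lemma its value at \<open>l\<close> is at most
  \<open>norm l\<close> in modulus.\<close>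

lemma kap_le:
  assumes l: "l \<in> ball 0 1"
  shows "kap l \<le> 1 / (1 - norm l)" "1 \<le> kap l"
proof -
  have "0 \<le> 2 * cmod (1 - 1 / k l l)" by simp
  also have "\<dots> \<le> 2 * (1 - 1 / kap l)" using np_estimate[OF l l] by simp
  finally have "0 \<le> 1 - 1 / kap l" by simp
  then show "1 \<le> kap l" using kap_pos[OF l] by (simp add: field_simps)
  show "kap l \<le> 1 / (1 - norm l)"
  proof (cases "l = 0")
    case True
    then show ?thesis using kap_diag[OF l] kernel_0[OF l] by (simp del: of_real_eq_1_iff) simp
  next
    case False
    define e where "e = of_real (1 / norm l) *s l"
    have e: "norm e = 1" using False by (simp add: e_def norm_divide)
    have le: "of_real (norm l) *s e = l"
      using False by (simp add: e_def vec_eq_iff)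
    define g where "g \<zeta> = 1 - 1 / k l (\<zeta> *s e)" for \<zeta>
    have inb: "\<zeta> *s e \<in> ball 0 1" if "\<zeta> \<in> ball 0 1" for \<zeta> using that e by simp
    have "(\<lambda>\<zeta>. k l (0 + \<zeta> *s e)) holomorphic_on {\<zeta>. 0 + \<zeta> *s e \<in> ball 0 1}"
      using ball_regular_analytic[OF analytic[OF kernel_mem[OF l]]] unfolding ball_regular_def by blast
    moreover have "{\<zeta>. 0 + \<zeta> *s e \<in> ball 0 1} = ball 0 1" by (auto simp: e)
    ultimately have "(\<lambda>\<zeta>. k l (\<zeta> *s e)) holomorphic_on ball 0 1" by simp
    then have hol: "g holomorphic_on ball 0 1"
      unfolding g_def using kernel_nz[OF l inb] by (intro holomorphic_intros) auto
    have "norm (g (of_real (norm l))) \<le> norm (of_real (norm l) :: complex)"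
    proof (rule Schwarz_Lemma(1)[OF hol])
      show "g 0 = 0" using kernel_cnj[OF _ l, of 0] kernel_0[OF l] by (simp add: g_def)
      show "norm (g \<zeta>) < 1" if "norm \<zeta> < 1" for \<zeta>
      proof -
        have z: "\<zeta> *s e \<in> ball 0 1" using that e by simp
        have "1 / kap l > 0" "1 / kap (\<zeta> *s e) > 0" using kap_pos l z by auto
        then show ?thesis using np_estimate[OF l z] unfolding g_def by linarith
      qed
      show "norm (of_real (norm l) :: complex) < 1" using l by simp
    qed
    then have "1 - 1 / kap l \<le> norm l"
      using kap_diag[OF l] \<open>1 \<le> kap l\<close> by (simp add: g_def le) (metis Re_complex_of_real abs_norm_cancel complex_Re_le_cmod minus_complex.sel(1) of_real_1 of_real_divide order_trans)
    moreover have "norm l < 1" using l by simp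
    ultimately show ?thesis using kap_pos[OF l] by (simp add: field_simps)
  qed
qed

text \<open>Write \<open>\<kappa> = k\<^sub>l(l)\<close>, \<open>u = 1 - 1/k\<^sub>l\<close>, \<open>s = u(l)\<close> and \<open>\<psi> = k\<^sub>l - \<kappa>\<close>. Then
  \<open>\<kappa>\<^sup>2 - \<kappa> - \<psi>(z) \<psi>(w)* = \<kappa> k\<^sub>l(z) k\<^sub>l(w)* (s - u(z) u(w)*)\<close>, where \<open>*\<close> is conjugation, so the bound follows from
  the positivity of \<open>(s - u(z) u(w)*) k\<^sub>w(z)\<close>.\<close>

lemma np_kernel_criterion:
  assumes A: "finite A" "A \<subseteq> ball 0 1" and l: "l \<in> ball 0 1"
  shows "nrm (\<Sum>w\<in>A. (c w * cnj (k l w - of_real (kap l))) \<odot> k w)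
    \<le> sqrt ((kap l)\<^sup>2 - kap l) * nrm (\<Sum>w\<in>A. c w \<odot> k w)"
proof -
  define K where "K = kap l"
  have K: "K \<ge> 1" using kap_le(2)[OF l] by (simp add: K_def)
  let ?\<psi> = "\<lambda>w. k l w - of_real K"
  define d where "d w = c w * cnj (k l w)" for w
  define T where "T = (\<Sum>w\<in>A. \<Sum>v\<in>A. d w * cnj (d v) * k w v *
      ((1 - 1 / k l l) * (1 - 1 / k w v) - (1 - 1 / k l v) * cnj (1 - 1 / k l w)))"
  have "of_real ((K\<^sup>2 - K) * (nrm (\<Sum>w\<in>A. c w \<odot> k w))\<^sup>2)
      - of_real ((nrm (\<Sum>w\<in>A. (c w * cnj (?\<psi> w)) \<odot> k w))\<^sup>2)
    = (\<Sum>w\<in>A. \<Sum>v\<in>A. of_real (K\<^sup>2 - K) * (c w * cnj (c v) * k w v)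
        - (c w * cnj (?\<psi> w)) * cnj (c v * cnj (?\<psi> v)) * k w v)"
    by (simp only: of_real_mult nrm_kernel_comb[OF A] sum_distrib_left sum_subtractf)
  also have "\<dots> = (\<Sum>w\<in>A. \<Sum>v\<in>A. of_real (K - 1) * (d w * cnj (d v)) + of_real K * (d w * cnj (d v) * k w v *
      ((1 - 1 / k l l) * (1 - 1 / k w v) - (1 - 1 / k l v) * cnj (1 - 1 / k l w))))"
  proof (intro sum.cong refl)
    fix w v assume "w \<in> A" "v \<in> A"
    then have wv: "w \<in> ball 0 1" "v \<in> ball 0 1" using A by auto
    have nz: "k l w \<noteq> 0" "cnj (k l w) \<noteq> 0" "k l v \<noteq> 0" "k w v \<noteq> 0" "k l l = of_real K" "of_real K \<noteq> (0::complex)"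
      using kernel_nz l wv kap_diag K by (auto simp: K_def)
    have "of_real (K - 1) * (d w * cnj (d v)) + of_real K * (d w * cnj (d v) * k w v *
      ((1 - 1 / k l l) * (1 - 1 / k w v) - (1 - 1 / k l v) * cnj (1 - 1 / k l w)))
     = c w * cnj (c v) * (of_real (K - 1) * cnj (k l w) * k l v + (of_real K - 1) * cnj (k l w) * k l v * (k w v - 1)
        - of_real K * k w v * (k l v - 1) * (cnj (k l w) - 1))"
      using nz by (simp add: d_def field_simps)
    also have "\<dots> = of_real (K\<^sup>2 - K) * (c w * cnj (c v) * k w v)
        - (c w * cnj (?\<psi> w)) * cnj (c v * cnj (?\<psi> v)) * k w v"
      by (simp add: algebra_simps power2_eq_square)
    finally show "of_real (K\<^sup>2 - K) * (c w * cnj (c v) * k w v)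
        - (c w * cnj (?\<psi> w)) * cnj (c v * cnj (?\<psi> v)) * k w v =
      of_real (K - 1) * (d w * cnj (d v)) + of_real K * (d w * cnj (d v) * k w v *
      ((1 - 1 / k l l) * (1 - 1 / k w v) - (1 - 1 / k l v) * cnj (1 - 1 / k l w)))" by simp
  qed
  also have "\<dots> = of_real (K - 1) * (\<Sum>w\<in>A. \<Sum>v\<in>A. d w * cnj (d v)) + of_real K * T"
    by (simp only: T_def sum.distrib sum_distrib_left)
  also have "(\<Sum>w\<in>A. \<Sum>v\<in>A. d w * cnj (d v)) = sum d A * cnj (sum d A)"
    by (simp only: sum_product cnj_sum)
  also have "sum d A * cnj (sum d A) = of_real ((cmod (sum d A))\<^sup>2)"
    by (rule complex_norm_square[symmetric])
  finally have "Re (of_real ((K\<^sup>2 - K) * (nrm (\<Sum>w\<in>A. c w \<odot> k w))\<^sup>2)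
      - of_real ((nrm (\<Sum>w\<in>A. (c w * cnj (?\<psi> w)) \<odot> k w))\<^sup>2))
    = Re (of_real (K - 1) * of_real ((cmod (sum d A))\<^sup>2) + of_real K * T)"
    by (rule arg_cong)
  then have "(K\<^sup>2 - K) * (nrm (\<Sum>w\<in>A. c w \<odot> k w))\<^sup>2
      - (nrm (\<Sum>w\<in>A. (c w * cnj (?\<psi> w)) \<odot> k w))\<^sup>2
    = (K - 1) * (cmod (sum d A))\<^sup>2 + K * Re T"
    by (simp only: minus_complex.sel(1) plus_complex.sel(1) of_real_mult[symmetric]
        Re_complex_of_real Re_of_real_mult)
  moreover have "0 \<le> Re T" unfolding T_def by (rule np_defect_psd[OF A l])
  ultimately have "(nrm (\<Sum>w\<in>A. (c w * cnj (?\<psi> w)) \<odot> k w))\<^sup>2 \<le> (K\<^sup>2 - K) * (nrm (\<Sum>w\<in>A. c w \<odot> k w))\<^sup>2"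
    using K by (smt (verit) mult_nonneg_nonneg zero_le_power2)
  then have "sqrt ((nrm (\<Sum>w\<in>A. (c w * cnj (?\<psi> w)) \<odot> k w))\<^sup>2) \<le> sqrt ((K\<^sup>2 - K) * (nrm (\<Sum>w\<in>A. c w \<odot> k w))\<^sup>2)"
    by (rule real_sqrt_le_mono)
  then show ?thesis
    by (simp add: real_sqrt_mult nrm_nonneg kernel_comb_mem[OF A(2)] K_def)
qed

text \<open>\<open>np_kernel_criterion\<close> and \<open>multiplier_criterion\<close> bound
  multiplication by \<open>k l\<close> minus the constant \<open>kap l\<close>. The second claim is
  this bound squared and expanded. Subtracting the constant is what leaves a term linear in
  \<open>k l * f\<close>, hence harmonic in \<open>l\<close> once \<open>kap l\<close> is divided
  out.\<close>

lemma kernel_times: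
  assumes l: "l \<in> ball 0 1" and f: "f \<in> H"
  shows kernel_times_mem: "k l * f \<in> H"
    and kernel_times_sarason: "(nrm (k l * f))\<^sup>2 \<le> kap l * (2 * Re (ip f (k l * f)) - (nrm f)\<^sup>2)"
proof -
  define K where "K = kap l"
  have K: "K \<ge> 1" using kap_le(2)[OF l] by (simp add: K_def)
  have K2: "0 \<le> K\<^sup>2 - K" using K by (simp add: power2_eq_square)
  let ?g = "on_ball ((\<lambda>z. k l z - of_real K) * f)"
  have g: "?g \<in> H" "nrm ?g \<le> sqrt (K\<^sup>2 - K) * nrm f"
    using multiplier_criterion[of "\<lambda>z. k l z - of_real K", OF np_kernel_criterion[OF _ _ l, folded K_def] _ f] K2
    by auto
  have eq: "k l * f = ?g + of_real K \<odot> f"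
    using off_ball[OF f] by (auto simp: fun_eq_iff on_ball_def algebra_simps)
  show m: "k l * f \<in> H" unfolding eq by (intro add_mem smult_mem g f)
  have g_eq: "?g = k l * f - of_real K \<odot> f" using eq by simp
  have "(nrm ?g)\<^sup>2 \<le> (sqrt (K\<^sup>2 - K) * nrm f)\<^sup>2"
    using g by (intro power_mono nrm_nonneg)
  then have "(nrm (k l * f - of_real K \<odot> f))\<^sup>2 \<le> (K\<^sup>2 - K) * (nrm f)\<^sup>2"
    using K2 by (simp add: g_eq power_mult_distrib)
  moreover have "(nrm (k l * f - of_real K \<odot> f))\<^sup>2
      = (nrm (k l * f))\<^sup>2 - 2 * K * Re (ip f (k l * f)) + K\<^sup>2 * (nrm f)\<^sup>2"
    using m f K ip_cnj[OF m f]
    by (simp add: nrm_diff_sq smult_mem ip_smult_right nrm_smult power_mult_distrib)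
  ultimately show "(nrm (k l * f))\<^sup>2 \<le> kap l * (2 * Re (ip f (k l * f)) - (nrm f)\<^sup>2)"
    by (simp add: K_def algebra_simps)
qed

text \<open>A crude bound, uniform for \<open>l\<close> in smaller balls; it makes norm convergence
  in \<open>H\<close> imply locally uniform convergence in
  \<open>ip_kernel_times_regular\<close>.\<close>

lemma kernel_times_bound:
  assumes l: "l \<in> ball 0 1" and f: "f \<in> H"
  shows "nrm (k l * f) \<le> 2 * nrm f / (1 - norm l)"
proof -
  note m = kernel_times_mem[OF l f]
  have K: "0 < kap l" "kap l \<le> 1 / (1 - norm l)" using kap_pos[OF l] kap_le[OF l] by auto
  have "Re (ip f (k l * f)) \<le> nrm f * nrm (k l * f)"
    using cauchy_schwarz[OF f m] complex_Re_le_cmod order_trans by blast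
  then have "2 * Re (ip f (k l * f)) - (nrm f)\<^sup>2 \<le> 2 * (nrm f * nrm (k l * f))"
    by (smt (verit) zero_le_power2)
  then have "(nrm (k l * f))\<^sup>2 \<le> kap l * (2 * (nrm f * nrm (k l * f)))"
    using kernel_times_sarason[OF l f] K(1) by (meson mult_left_mono order_trans less_imp_le)
  then have "nrm (k l * f) \<le> kap l * (2 * nrm f)"
    using nrm_nonneg[OF m] nrm_nonneg[OF f] K(1)
    by (cases "nrm (k l * f) = 0") (auto simp: power2_eq_square)
  also have "\<dots> \<le> 1 / (1 - norm l) * (2 * nrm f)"
    using K(2) nrm_nonneg[OF f] by (intro mult_right_mono) auto
  finally show ?thesis by simp
qed

lemma kernel_multiplier: "l \<in> ball 0 1 \<Longrightarrow> k l \<in> multipliers H"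
  by (simp add: multipliers_def analytic kernel_mem kernel_times_mem)

text \<open>Both \<open>k l\<close> and the second argument of \<open>ip\<close> are
  conjugate-analytic, so the result is analytic in \<open>l\<close>. For \<open>h\<close> =
  \<open>k w\<close> it is explicitly a multiple of \<open>k w l\<close>; all other \<open>h\<close>
  follow from \<open>closed_subspace_UNIV_if_kernels\<close> by locally uniform limits.\<close>

lemma ip_kernel_times_regular:
  assumes f: "f \<in> H" and h: "h \<in> H"
  shows "ball_regular (\<lambda>l. ip h (k l * f))"
proof -
  let ?G = "\<lambda>h l. ip h (k l * f)"
  have m: "k l * f \<in> H" if "l \<in> ball 0 1" for l using kernel_times_mem[OF that f] .
  define M where "M = {h \<in> H. ball_regular (?G h)}"
  have "M = H"
  proof (rule closed_subspace_UNIV_if_kernels)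
    show "k w \<in> M" if w: "w \<in> ball 0 1" for w
    proof -
      have "ball_regular (\<lambda>l. cnj (f w) * k w l)"
        by (intro ball_regular_intros ball_regular_analytic analytic kernel_mem w)
      then have "ball_regular (?G (k w))"
        by (rule ball_regular_cong) (subst ip_kernel_left[OF w m], simp_all add: kernel_cnj[of _ w] w[simplified])
      then show ?thesis using kernel_mem[OF w] by (simp add: M_def)
    qed
    show "closed_lin_subspace H ip M"
      unfolding closed_lin_subspace_def
    proof (intro conjI allI ballI impI)
      show "M \<subseteq> H" by (auto simp: M_def)
      have "ball_regular (?G 0)"
        by (rule ball_regular_cong[OF ball_regular_intros(1)[of 0]]) (simp add: ip_zero_left m)
      then show "0 \<in> M" by (simp add: M_def zero_mem)
      show "g + h \<in> M" if "g \<in> M" "h \<in> M" for g h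
      proof -
        have "ball_regular (\<lambda>l. ?G g l + ?G h l)"
          using that by (intro ball_regular_intros) (auto simp: M_def)
        then have "ball_regular (?G (g + h))"
          by (rule ball_regular_cong) (use that in \<open>auto simp: M_def ip_add m\<close>)
        then show ?thesis using that by (simp add: M_def add_mem)
      qed
      show "(\<lambda>z. c * h z) \<in> M" if "h \<in> M" for c h
      proof -
        have "ball_regular (\<lambda>l. c * ?G h l)"
          using that by (intro ball_regular_intros) (auto simp: M_def)
        then have "ball_regular (?G (\<lambda>z. c * h z))"
          by (rule ball_regular_cong) (use that in \<open>auto simp: M_def ip_scale m\<close>)
        then show ?thesis using that by (simp add: M_def scale_mem)
      qed
      fix F h assume h: "h \<in> H" and "(\<forall>n. F n \<in> M) \<and> (\<lambda>n. nrm (F n - h)) \<longlonglongrightarrow> 0"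
      then have FM: "\<And>n. F n \<in> M" and lim: "(\<lambda>n. nrm (F n - h)) \<longlonglongrightarrow> 0" by auto
      have FH: "F n \<in> H" for n using FM[of n] by (simp add: M_def)
      have "ball_regular (?G h)"
      proof (rule ball_regular_limit)
        show "ball_regular (?G (F n))" for n using FM[of n] by (simp add: M_def)
        fix \<rho> :: real assume \<rho>: "\<rho> < 1"
        define C where "C = 2 * nrm f / (1 - \<rho>)"
        have lim': "(\<lambda>n. nrm (F n - h) * C) \<longlonglongrightarrow> 0" using tendsto_mult_left_zero[OF lim] .
        show "uniform_limit (cball 0 \<rho>) (\<lambda>n. ?G (F n)) (?G h) sequentially"
        proof (rule uniform_limitI)
          fix e :: real assume "e > 0"
          then have "\<forall>\<^sub>F n in sequentially. nrm (F n - h) * C < e"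
            using lim' by (rule order_tendstoD(2)[rotated])
          then show "\<forall>\<^sub>F n in sequentially. \<forall>l\<in>cball 0 \<rho>. dist (?G (F n) l) (?G h l) < e"
          proof (rule eventually_mono, intro ballI)
            fix n and l :: "complex^'d" assume n: "nrm (F n - h) * C < e" and l: "l \<in> cball 0 \<rho>"
            have l1: "l \<in> ball 0 1" using l \<rho> by simp
            have "dist (?G (F n) l) (?G h l) = cmod (ip (F n - h) (k l * f))"
              by (simp add: dist_norm ip_diff[OF FH h m[OF l1]])
            also have "\<dots> \<le> nrm (F n - h) * nrm (k l * f)"
              by (intro cauchy_schwarz diff_mem FH h m l1)
            also have "\<dots> \<le> nrm (F n - h) * C"
            proof (rule mult_left_mono[OF _ nrm_nonneg[OF diff_mem[OF FH h]]])
              have "nrm (k l * f) \<le> 2 * nrm f / (1 - norm l)" by (rule kernel_times_bound[OF l1 f])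
              also have "\<dots> \<le> C"
                unfolding C_def using l \<rho> nrm_nonneg[OF f] by (intro divide_left_mono) auto
              finally show "nrm (k l * f) \<le> C" .
            qed
            finally show "dist (?G (F n) l) (?G h l) < e" using n by simp
          qed
        qed
      qed
      then show "h \<in> M" using h by (simp add: M_def)
    qed
  qed
  then show ?thesis using h by (auto simp: M_def)
qed

end

section \<open>Poisson integrals and maximal functions on the disc\<close>

text \<open>With period 1, normalized arc length is Lebesgue measure on the unit interval, and the
  parametrization agrees with \<open>circlepath 0 1\<close>.\<close>

definition circ :: "real \<Rightarrow> complex" where
  "circ t = exp (2 * of_real pi * \<i> * of_real t)"

text \<open>The Poisson kernel for the point \<open>r\<close> of the real axis. Other points of the
  disc are reached by rotating the function that is integrated.\<close>

definition poisson :: "real \<Rightarrow> real \<Rightarrow> real" where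
  "poisson r t = (1 - r\<^sup>2) / (1 - 2 * r * cos (2 * pi * t) + r\<^sup>2)"

lemma norm_circ [simp]: "cmod (circ t) = 1"
  by (simp add: circ_def)

lemma circ_0 [simp]: "circ 0 = 1"
  by (simp add: circ_def)

lemma circ_add: "circ (s + t) = circ s * circ t"
  by (simp add: circ_def algebra_simps exp_add)

lemma circ_1 [simp]: "circ 1 = 1"
  using exp_two_pi_i by (simp add: circ_def)

lemma circ_periodic: "circ (t + 1) = circ t"
  by (simp add: circ_add)

lemma continuous_circ [continuous_intros]: "continuous_on S f \<Longrightarrow> continuous_on S (\<lambda>x. circ (f x))"
  unfolding circ_def by (intro continuous_intros)

lemma Re_circ: "Re (circ t) = cos (2 * pi * t)"
  by (simp add: circ_def Re_exp)

lemma cos_le_1': "r * cos x \<le> r" if "0 \<le> r" for r x :: real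
  using that by (simp add: mult_left_le)

lemma poisson_denominator_pos:
  assumes "0 \<le> r" "r < 1"
  shows "0 < 1 - 2 * r * cos (2 * pi * t) + r\<^sup>2" "(1 - r)\<^sup>2 \<le> 1 - 2 * r * cos (2 * pi * t) + r\<^sup>2"
    "1 - 2 * r * cos (2 * pi * t) + r\<^sup>2 \<le> (1 + r)\<^sup>2"
proof -
  have "2 * r * cos (2 * pi * t) \<le> 2 * r" using assms by (intro cos_le_1') simp
  then show b: "(1 - r)\<^sup>2 \<le> 1 - 2 * r * cos (2 * pi * t) + r\<^sup>2" by (simp add: power2_diff)
  then show "0 < 1 - 2 * r * cos (2 * pi * t) + r\<^sup>2" using assms
    by (smt (verit) zero_less_power)
  have "2 * r * (- cos (2 * pi * t)) \<le> 2 * r"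
    using assms by (intro mult_left_le) auto
  then show "1 - 2 * r * cos (2 * pi * t) + r\<^sup>2 \<le> (1 + r)\<^sup>2" by (simp add: power2_sum)
qed

lemma poisson_bounds:
  assumes "0 \<le> r" "r < 1"
  shows "(1 - r) / (1 + r) \<le> poisson r t" "poisson r t \<le> (1 + r) / (1 - r)"
    "0 \<le> poisson r t"
proof -
  have e: "1 - r\<^sup>2 = (1 - r) * (1 + r)" by (simp add: power2_eq_square algebra_simps)
  have pos: "0 \<le> (1 - r) * (1 + r)" using assms by simp
  note d = poisson_denominator_pos[OF assms, of t]
  have "(1 - r) * (1 + r) / (1 + r)\<^sup>2 \<le> poisson r t"
    unfolding poisson_def e using d pos assms
    by (intro divide_left_mono mult_pos_pos) auto
  then show "(1 - r) / (1 + r) \<le> poisson r t"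
    using assms by (simp add: power2_eq_square)
  have "poisson r t \<le> (1 - r) * (1 + r) / (1 - r)\<^sup>2"
    unfolding poisson_def e using d pos assms
    by (intro divide_left_mono mult_pos_pos) auto
  then show "poisson r t \<le> (1 + r) / (1 - r)"
    using assms by (simp add: power2_eq_square)
  show "0 \<le> poisson r t"
    unfolding poisson_def e using d pos by (intro divide_nonneg_nonneg) auto
qed

lemma continuous_poisson [continuous_intros]:
  fixes f :: "'a::t2_space \<Rightarrow> real"
  assumes "0 \<le> r" "r < 1" "continuous_on S f"
  shows "continuous_on S (\<lambda>x. poisson r (f x))"
  unfolding poisson_def
  using less_imp_neq[OF poisson_denominator_pos(1)[OF assms(1,2)], symmetric]
  by (intro continuous_intros assms) auto

lemma poisson_minus [simp]: "poisson r (- t) = poisson r t"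
  by (simp add: poisson_def)

lemma poisson_periodic: "poisson r (t + 1) = poisson r t"
  using Re_circ[of "t + 1"] Re_circ[of t] by (simp add: poisson_def circ_periodic)

text \<open>Cauchy's formula at \<open>r\<close> for g(u) (1 - r^2) / (1 - r u), which has the value
  g(r) at \<open>r\<close>. On the unit circle (1 - r u)(u - r)/u is the denominator of the Poisson
  kernel, so the Cauchy kernel turns into the Poisson kernel.\<close>

lemma poisson_formula:
  assumes g: "g holomorphic_on ball 0 R" and R: "1 < R" and r: "0 \<le> r" "r < 1"
  shows "((\<lambda>t. of_real (poisson r t) * g (circ t)) has_integral g (of_real r)) {0..1}"
proof -
  define G where "G u = g u * of_real (1 - r\<^sup>2) / (1 - of_real r * u)" for u
  have nz: "1 - of_real r * u \<noteq> 0" if "u \<in> cball 0 1" for u :: complex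
  proof
    assume "1 - of_real r * u = 0"
    then have "cmod (of_real r * u) = 1" by simp
    moreover have "cmod (of_real r * u) \<le> r * 1"
      using that r unfolding norm_mult by (intro mult_mono) auto
    ultimately show False using r by simp
  qed
  have "g holomorphic_on cball 0 1"
    by (rule holomorphic_on_subset[OF g]) (use R in auto)
  then have G: "G holomorphic_on cball 0 1"
    unfolding G_def using nz by (intro holomorphic_intros) auto
  have nr: "1 - (of_real r :: complex)\<^sup>2 \<noteq> 0"
    using nz[of "of_real r"] r by (simp add: power2_eq_square)
  have Gr: "G (of_real r) = g (of_real r)"
    using nr by (simp add: G_def power2_eq_square)
  have "((\<lambda>u. G u / (u - of_real r)) has_contour_integral (2 * of_real pi * \<i> * G (of_real r))) (circlepath 0 1)"
    by (rule Cauchy_integral_circlepath_simple[OF G]) (use r in auto)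
  then have "((\<lambda>t. G (circ t) / (circ t - of_real r) * (2 * of_real pi * \<i> * circ t)) has_integral
      (2 * of_real pi * \<i> * g (of_real r))) {0..1}"
    unfolding has_contour_integral_def Gr
    by (rule has_integral_cong[THEN iffD1, rotated])
      (simp add: vector_derivative_circlepath01, simp add: circlepath circ_def)
  then have "((\<lambda>t. (G (circ t) / (circ t - of_real r) * (2 * of_real pi * \<i> * circ t)) / (2 * of_real pi * \<i>)) has_integral
      (2 * of_real pi * \<i> * g (of_real r)) / (2 * of_real pi * \<i>)) {0..1}"
    by (rule has_integral_divide)
  then have "((\<lambda>t. G (circ t) / (circ t - of_real r) * circ t) has_integral g (of_real r)) {0..1}"
    by simp
  then show ?thesis
  proof (rule has_integral_cong[THEN iffD1, rotated])
    fix t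
    have c: "circ t * cnj (circ t) = 1" using complex_norm_square[of "circ t"] by simp
    have c0: "circ t \<noteq> 0" by (metis norm_circ norm_zero zero_neq_one)
    have n1: "1 - of_real r * circ t \<noteq> 0" using nz[of "circ t"] by simp
    have n2: "circ t - of_real r \<noteq> 0"
      using r by (metis abs_of_nonneg eq_iff_diff_eq_0 less_irrefl norm_circ norm_of_real)
    have "of_real (1 - 2 * r * cos (2 * pi * t) + r\<^sup>2) * circ t = (1 - of_real r * circ t) * (circ t - of_real r)"
    proof -
      have "of_real (2 * cos (2 * pi * t)) = circ t + cnj (circ t)"
        by (simp add: complex_add_cnj Re_circ)
      then have "of_real (1 - 2 * r * cos (2 * pi * t) + r\<^sup>2) * circ t
        = (1 - of_real r * (circ t + cnj (circ t)) + (of_real r)\<^sup>2) * circ t"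
        by (simp add: mult.assoc mult.left_commute[of r])
      also have "\<dots> = (1 - of_real r * circ t) * (circ t - of_real r)"
        using c by (simp add: algebra_simps power2_eq_square)
      finally show ?thesis .
    qed
    then have e: "(of_real (1 - 2 * r * cos (2 * pi * t) + r\<^sup>2)::complex) = (1 - of_real r * circ t) * (circ t - of_real r) / circ t"
      using c0 by (simp add: field_simps)
    show "G (circ t) / (circ t - of_real r) * circ t = of_real (poisson r t) * g (circ t)"
      unfolding poisson_def of_real_divide e G_def using n1 n2 c0 by (simp add: field_simps)
  qed
qed

text \<open>Folds a full period onto the half period on which the Poisson kernel is
  decreasing.\<close>

lemma has_integral_symmetrize:
  fixes f :: "real \<Rightarrow> 'a::banach"
  assumes c: "continuous_on UNIV f" and per: "\<And>t. f (t + 1) = f t"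
    and I: "(f has_integral I) {0..1}"
  shows "((\<lambda>t. f t + f (- t)) has_integral I) {0..1/2}"
proof -
  have int: "f integrable_on {a..b}" for a b
    by (rule integrable_continuous_real[OF continuous_on_subset[OF c]]) simp
  have "(f has_integral integral {1/2..1} f) {1/2..1}" using int by (rule integrable_integral)
  from has_integral_shift_real_ivl[OF this, of 1]
  have "(f has_integral integral {1/2..1} f) {-1/2..0}" by (simp add: per)
  then have "((\<lambda>t. f (- t)) has_integral integral {1/2..1} f) {0..1/2}"
    by (drule_tac has_integral_reflect_lemma_real) (simp del: has_integral_reflect_real)
  moreover have "(f has_integral integral {0..1/2} f) {0..1/2}" using int by (rule integrable_integral)
  ultimately have "((\<lambda>t. f t + f (- t)) has_integral integral {0..1/2} f + integral {1/2..1} f) {0..1/2}"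
    by (intro has_integral_add)
  moreover have "integral {0..1/2} f + integral {1/2..1} f = integral {0..1} f"
    by (rule Henstock_Kurzweil_Integration.integral_combine) (auto intro: int)
  ultimately show ?thesis using I by (simp add: integral_unique)
qed

lemma poisson_integral: "0 \<le> r \<Longrightarrow> r < 1 \<Longrightarrow> (poisson r has_integral 1) {0..1}"
  using has_integral_linear[OF poisson_formula[of "\<lambda>_. 1" 2 r] bounded_linear_Re]
  by (simp add: o_def)

text \<open>Integration by parts against the even, decreasing Poisson kernel.\<close>

lemma poisson_integral_le_maximal:
  fixes F :: "real \<Rightarrow> real"
  assumes c: "continuous_on UNIV F" and per: "\<And>t. F (t + 1) = F t"
    and r: "0 \<le> r" "r < 1"
    and A: "\<And>h. 0 < h \<Longrightarrow> h \<le> 1/2 \<Longrightarrow> integral {- h..h} F \<le> C * h"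
    and I: "((\<lambda>t. poisson r t * F t) has_integral I) {0..1}"
  shows "I \<le> C / 2"
proof -
  let ?P = "poisson r"
  define f where "f t = F t + F (- t)" for t
  have cF: "continuous_on S F" for S using c by (rule continuous_on_subset) simp
  have cm: "continuous_on S (\<lambda>t. F (- t))" for S
    using continuous_on_compose2[OF c, of S "\<lambda>t. - t"] by (simp add: continuous_on_minus)
  have cf: "continuous_on S f" for S unfolding f_def by (intro continuous_on_add cF cm)
  \<comment> \<open>The primitive of \<open>C - f\<close> that vanishes at 0; the hypothesis on
    symmetric intervals says exactly that it is nonnegative.\<close>
  define B where "B x = C * x - integral {0..x} f" for x
  have intf: "integral {0..x} f = integral {-x..x} F" if "0 \<le> x" for x
  proof -
    have "integral {0..x} f = integral {0..x} F + integral {0..x} (\<lambda>t. F (- t))"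
      unfolding f_def by (rule Henstock_Kurzweil_Integration.integral_add) (intro integrable_continuous_real cF cm)+
    also have "integral {0..x} (\<lambda>t. F (- t)) = integral {-x..0} F"
      using Henstock_Kurzweil_Integration.integral_reflect_real[of 0 "-x" F] by simp
    also have "integral {0..x} F + \<dots> = integral {-x..x} F"
      using Henstock_Kurzweil_Integration.integral_combine[of "-x" 0 x F]
        integrable_continuous_real[OF cF] that by simp
    finally show ?thesis .
  qed
  have B0: "0 \<le> B x" if "x \<in> {0..1/2}" for x
    using A[of x] that intf[of x] by (cases "x = 0") (auto simp: B_def)
  have dB: "(B has_real_derivative (C - f x)) (at x within {0..1/2})" if "x \<in> {0..1/2}" for x
    using DERIV_diff[OF DERIV_cmult[OF DERIV_ident] integral_has_real_derivative[OF cf that]]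
    by (simp add: B_def[abs_def])
  define P' where "P' x = - (1 - r\<^sup>2) * (2 * r * (2 * pi) * sin (2 * pi * x)) / (1 - 2 * r * cos (2 * pi * x) + r\<^sup>2)\<^sup>2" for x
  have dP: "(?P has_real_derivative P' x) (at x within S)" for x S
    unfolding poisson_def P'_def using poisson_denominator_pos(1)[OF r, of x]
    by (auto intro!: derivative_eq_intros simp: power2_eq_square minus_divide_left algebra_simps)
  have P'0: "P' x \<le> 0" if "x \<in> {0..1/2}" for x
  proof -
    have "0 \<le> sin (2 * pi * x)" using that by (intro sin_ge_zero) auto
    moreover have "0 \<le> 1 - r\<^sup>2" using r by (simp add: power_le_one)
    ultimately show ?thesis unfolding P'_def using r
      by (intro divide_nonpos_nonneg mult_nonpos_nonneg) auto
  qed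
  \<comment> \<open>The derivative of the product of \<open>B\<close> and the Poisson kernel. Its
    term with \<open>P'\<close> is at most 0 and is dropped; the final constant is
    \<open>C / 2\<close> because the kernel has mass 1/2 on the half period.\<close>
  have "((\<lambda>x. B x * P' x + (C - f x) * ?P x) has_integral (B (1/2) * ?P (1/2) - B 0 * ?P 0)) {0..1/2}"
  proof (rule fundamental_theorem_of_calculus)
    fix x :: real assume x: "x \<in> {0..1/2}"
    show "((\<lambda>x. B x * ?P x) has_vector_derivative B x * P' x + (C - f x) * ?P x) (at x within {0..1/2})"
      unfolding has_real_derivative_iff_has_vector_derivative[symmetric]
      by (rule derivative_eq_intros dB[OF x] dP refl)+ simp
  qed simp
  moreover have "((\<lambda>x. C * ?P x - f x * ?P x) has_integral (C * (1/2) - I)) {0..1/2}"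
  proof (intro has_integral_diff has_integral_mult_right)
    have "((\<lambda>t. ?P t + ?P (- t)) has_integral 1) {0..1/2}"
      by (intro has_integral_symmetrize continuous_intros r poisson_periodic poisson_integral)
    from has_integral_divide[OF this, of 2] show "(?P has_integral 1/2) {0..1/2}" by simp
    have "((\<lambda>t. ?P t * F t + ?P (- t) * F (- t)) has_integral I) {0..1/2}"
      by (rule has_integral_symmetrize[OF _ _ I])
        (intro continuous_intros r cF, simp add: per poisson_periodic)
    then show "((\<lambda>t. f t * ?P t) has_integral I) {0..1/2}"
      by (simp add: f_def algebra_simps)
  qed
  ultimately have "B (1/2) * ?P (1/2) - B 0 * ?P 0 \<le> C * (1/2) - I"
  proof (rule has_integral_le)
    fix x :: real assume x: "x \<in> {0..1/2}"
    have "B x * P' x \<le> 0" using B0[OF x] P'0[OF x] by (rule mult_nonneg_nonpos)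
    then show "B x * P' x + (C - f x) * ?P x \<le> C * ?P x - f x * ?P x"
      by (simp add: algebra_simps)
  qed
  moreover have "0 \<le> B (1/2) * ?P (1/2)"
    using B0[of "1/2"] poisson_bounds(3)[OF r] by simp
  moreover have "B 0 = 0" by (simp add: B_def)
  ultimately show ?thesis by simp
qed

text \<open>Vitali covering argument. The constant 20 is 10 times 2: an interval of radius 5 h has
  length 10 h, and the disjoint intervals lie in [-1/2, 3/2], which is two periods of
  \<open>F\<close>.\<close>

lemma maximal_weak_type:
  fixes F :: "real \<Rightarrow> real"
  assumes c: "continuous_on UNIV F" and per: "\<And>t. F (t + 1) = F t" and F0: "\<And>t. 0 \<le> F t"
    and C: "C > 0" and E: "E \<in> sets lborel" "E \<subseteq> {0..1}"
    and big: "\<And>a. a \<in> E \<Longrightarrow> \<exists>h. 0 < h \<and> h \<le> 1/2 \<and> C * h < integral {a - h..a + h} F"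
  shows "emeasure lborel E \<le> ennreal (20 / C * integral {0..1} F)"
proof -
  have cF: "continuous_on S F" for S using c by (rule continuous_on_subset) simp
  have int: "F integrable_on {a..b}" for a b by (rule integrable_continuous_real[OF cF])
  have [measurable]: "F \<in> borel_measurable borel" using c by (rule borel_measurable_continuous_onI)
  obtain h where h: "\<And>a. a \<in> E \<Longrightarrow> 0 < h a \<and> h a \<le> 1/2 \<and> C * h a < integral {a - h a..a + h a} F"
    using big by metis
  obtain D where D: "countable D" "D \<subseteq> E"
    "pairwise (\<lambda>i j. disjnt (cball i (h i)) (cball j (h j))) D"
    "E \<subseteq> (\<Union>i\<in>D. cball i (5 * h i))"
  proof (rule Vitali_covering_lemma_cballs[where S = E and K = E and a = "\<lambda>x. x" and r = h and B = "1/2"])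
    show "E \<subseteq> (\<Union>i\<in>E. cball i (h i))" using h by force
  qed (use h in auto)
  define \<nu> where "\<nu> = density lborel (\<lambda>x. ennreal (F x))"
  have \<nu>: "emeasure \<nu> {a..b} = ennreal (integral {a..b} F)" for a b
  proof -
    have "emeasure \<nu> {a..b} = (\<integral>\<^sup>+x. ennreal (F x) * indicator {a..b} x \<partial>lborel)"
      unfolding \<nu>_def by (intro emeasure_density) auto
    also have "\<dots> = (\<integral>\<^sup>+x. ennreal (indicator {a..b} x * F x) \<partial>lborel)"
      by (intro nn_integral_cong) (auto simp: indicator_def)
    also have "\<dots> = ennreal (integral {a..b} F)"
      by (rule nn_integral_has_integral_lebesgue[OF _ integrable_integral[OF int]]) (rule F0)
    finally show ?thesis .
  qed
  \<comment> \<open>The countable family is indexed by natural numbers, with empty sets at the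
    remaining indices, so that countable additivity for sequences applies.\<close>
  define V where "V = to_nat_on D ` D"
  define x where "x n = from_nat_into D n" for n
  have xD: "x n \<in> D" if "n \<in> V" for n
    using that D(1) by (auto simp: V_def x_def)
  have x_surj: "\<exists>n\<in>V. x n = i" if "i \<in> D" for i
    using that D(1) by (auto simp: V_def x_def)
  have x_inj: "m = n" if "m \<in> V" "n \<in> V" "x m = x n" for m n
    using that D(1) by (auto simp: V_def x_def)
  define S where "S n = (if n \<in> V then cball (x n) (h (x n)) else {})" for n
  define T where "T n = (if n \<in> V then cball (x n) (5 * h (x n)) else {})" for n
  have meas: "S n \<in> sets borel" "T n \<in> sets borel" for n by (auto simp: S_def T_def)
  have TS: "emeasure lborel (T n) \<le> ennreal (10 / C) * emeasure \<nu> (S n)" for n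
  proof (cases "n \<in> V")
    case True
    let ?a = "x n"
    have a: "?a \<in> E" using xD[OF True] D(2) by blast
    have "emeasure lborel (T n) = ennreal (10 * h ?a)"
      using True h[OF a] by (simp add: T_def cball_eq_atLeastAtMost)
    also have "\<dots> \<le> ennreal (10 / C * integral {?a - h ?a..?a + h ?a} F)"
      using h[OF a] C by (intro ennreal_leI) (simp add: field_simps)
    also have "\<dots> = ennreal (10 / C) * emeasure \<nu> (S n)"
      using True C by (simp add: S_def cball_eq_atLeastAtMost \<nu> ennreal_mult'')
        (simp add: \<nu> ennreal_mult' flip: ennreal_mult')
    finally show ?thesis .
  qed (simp add: T_def)
  have "E \<subseteq> (\<Union>n. T n)"
  proof
    fix e assume "e \<in> E"
    then obtain i where i: "i \<in> D" "e \<in> cball i (5 * h i)" using D(4) by blast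
    obtain n where "n \<in> V" "x n = i" using x_surj[OF i(1)] by blast
    then show "e \<in> (\<Union>n. T n)" using i(2) by (auto simp: T_def intro!: exI[of _ n])
  qed
  then have "emeasure lborel E \<le> emeasure lborel (\<Union>n. T n)"
    by (rule emeasure_mono) (use meas in auto)
  also have "\<dots> \<le> (\<Sum>n. emeasure lborel (T n))"
    by (rule emeasure_subadditive_countably) (use meas in auto)
  also have "\<dots> \<le> (\<Sum>n. ennreal (10 / C) * emeasure \<nu> (S n))"
    by (intro suminf_le TS) auto
  also have "\<dots> = ennreal (10 / C) * (\<Sum>n. emeasure \<nu> (S n))" by simp
  also have "(\<Sum>n. emeasure \<nu> (S n)) = emeasure \<nu> (\<Union>n. S n)"
  proof (rule suminf_emeasure)
    show "range S \<subseteq> sets \<nu>" using meas by (auto simp: \<nu>_def)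
    show "disjoint_family S"
      unfolding disjoint_family_on_def
    proof (intro ballI impI)
      fix m n :: nat assume mn: "m \<noteq> n"
      show "S m \<inter> S n = {}"
      proof (cases "m \<in> V \<and> n \<in> V")
        case True
        then have "x m \<noteq> x n" using x_inj mn by blast
        then show ?thesis using D(3) xD True by (auto simp: S_def pairwise_def disjnt_def)
      qed (auto simp: S_def)
    qed
  qed
  also have "\<dots> \<le> emeasure \<nu> {-1/2..3/2}"
  proof (rule emeasure_mono)
    have "S n \<subseteq> {-1/2..3/2}" for n
    proof (cases "n \<in> V")
      case True
      have "x n \<in> E" using xD[OF True] D(2) by blast
      then have "0 \<le> x n" "x n \<le> 1" "h (x n) \<le> 1/2" using h E(2) by auto
      then show ?thesis using True by (auto simp: S_def cball_eq_atLeastAtMost)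
    qed (simp add: S_def)
    then show "(\<Union>n. S n) \<subseteq> {-1/2..3/2}" by blast
  qed (simp add: \<nu>_def)
  also have "\<dots> = ennreal (2 * integral {0..1} F)"
  proof -
    have sh: "integral {a - 1..b - 1} F = integral {a..b} F" for a b
      using integral_shift_real_ivl[of a 1 b F] by (simp add: per)
    have "integral {-1/2..3/2} F = integral {-1/2..0} F + (integral {0..1/2} F + (integral {1/2..1} F + integral {1..3/2} F))"
      using int by (simp add: Henstock_Kurzweil_Integration.integral_combine)
    also have "\<dots> = 2 * (integral {0..1/2} F + integral {1/2..1} F)"
      using sh[of "1/2" 1] sh[of 1 "3/2"] by simp
    also have "integral {0..1/2} F + integral {1/2..1} F = integral {0..1} F"
      using int by (simp add: Henstock_Kurzweil_Integration.integral_combine)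
    finally show ?thesis by (simp add: \<nu>)
  qed
  also have "ennreal (10 / C) * ennreal (2 * integral {0..1} F) = ennreal (20 / C * integral {0..1} F)"
    using C integral_nonneg[OF int, of 0 1] F0 by (subst ennreal_mult[symmetric]) auto
  finally show ?thesis by (simp add: mult_left_mono)
qed

section \<open>Positive real parts on the disc: weak type estimate and Harnack's inequality\<close>

lemma disc_dilate:
  assumes g: "g holomorphic_on ball 0 1" and s: "0 < s" "s < 1" and c: "cmod c = 1"
  shows "(\<lambda>u. g (of_real s * c * u)) holomorphic_on ball 0 (1 / s)"
proof -
  have "(\<lambda>u. of_real s * c * u) ` ball 0 (1 / s) \<subseteq> ball 0 1"
    using s c by (auto simp: norm_mult field_simps)
  then show ?thesis
    using holomorphic_on_compose_gen[of "\<lambda>u. of_real s * c * u" "ball 0 (1/s)" g "ball 0 1"] g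
    by (auto simp: o_def intro!: holomorphic_intros)
qed

lemma poisson_dilate:
  assumes g: "g holomorphic_on ball 0 1" and r: "0 \<le> r" "r < s" "s < 1" and c: "cmod c = 1"
  shows "((\<lambda>t. of_real (poisson (r / s) t) * g (of_real s * c * circ t)) has_integral g (of_real r * c)) {0..1}"
proof -
  have s: "0 < s" using r by simp
  show ?thesis
    using poisson_formula[OF disc_dilate[OF g s r(3) c], of "r / s"] r s
    by (simp add: field_simps)
qed

text \<open>The circle of radius \<open>s\<close> stands in for the boundary, where \<open>g\<close>
  need not have values. If all symmetric interval integrals about \<open>a\<close> were at most 2 C
  h, the Poisson integral would be at most C; hence \<open>maximal_weak_type\<close> is used with
  \<open>2 * C\<close>, and 20 becomes 10.\<close>

lemma disc_weak_type:
  assumes g: "g holomorphic_on ball 0 1" and pos: "\<And>u. cmod u < 1 \<Longrightarrow> 0 \<le> Re (g u)"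
    and C: "C > 0" and s: "0 < s" "s < 1" and E: "E \<in> sets lborel" "E \<subseteq> {0..1}"
    and big: "\<And>a. a \<in> E \<Longrightarrow> \<exists>r. 0 \<le> r \<and> r < s \<and> C < Re (g (of_real r * circ a))"
  shows "emeasure lborel E \<le> ennreal (10 / C * Re (g 0))"
proof -
  define F where "F = (\<lambda>t. Re (g (of_real s * circ t)))"
  have cg: "continuous_on UNIV (\<lambda>t. g (of_real s * circ t))"
    by (rule continuous_on_compose2[OF holomorphic_on_imp_continuous_on[OF g]])
      (use s in \<open>auto intro!: continuous_intros simp: norm_mult\<close>)
  have cF: "continuous_on UNIV F" unfolding F_def by (intro continuous_on_Re cg)
  have per: "F (t + 1) = F t" for t by (simp add: F_def circ_periodic)
  have F0: "0 \<le> F t" for t unfolding F_def by (rule pos) (use s in \<open>simp add: norm_mult\<close>)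
  have "\<exists>h. 0 < h \<and> h \<le> 1/2 \<and> (2 * C) * h < integral {a - h..a + h} F" if a: "a \<in> E" for a
  proof (rule ccontr)
    assume no: "\<nexists>h. 0 < h \<and> h \<le> 1/2 \<and> (2 * C) * h < integral {a - h..a + h} F"
    obtain r where r: "0 \<le> r" "r < s" "C < Re (g (of_real r * circ a))" using big[OF a] by blast
    define Fa where "Fa = (\<lambda>t. F (t + a))"
    have cFa: "continuous_on UNIV Fa" unfolding Fa_def
      by (intro continuous_on_compose2[OF cF] continuous_intros) auto
    have "Re (g (of_real r * circ a)) \<le> 2 * C / 2"
    proof (rule poisson_integral_le_maximal[OF cFa])
      show "Fa (t + 1) = Fa t" for t using per[of "t + a"] by (simp add: Fa_def algebra_simps)
      show "0 \<le> r / s" "r / s < 1" using r s by auto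
      show "integral {-h..h} Fa \<le> 2 * C * h" if "0 < h" "h \<le> 1/2" for h
        using no that integral_shift_real_ivl[of "a - h" a "a + h" F] by (auto simp: Fa_def not_less)
      have "((\<lambda>t. Re (of_real (poisson (r / s) t) * g (of_real s * circ a * circ t)))
          has_integral Re (g (of_real r * circ a))) {0..1}"
        using has_integral_linear[OF poisson_dilate[OF g r(1,2) s(2) norm_circ] bounded_linear_Re]
        by (simp add: o_def)
      then show "((\<lambda>t. poisson (r / s) t * Fa t) has_integral Re (g (of_real r * circ a))) {0..1}"
        by (simp add: Fa_def F_def circ_add mult_ac)
    qed
    then show False using r(3) by simp
  qed
  then have "emeasure lborel E \<le> ennreal (20 / (2 * C) * integral {0..1} F)"
    by (intro maximal_weak_type cF per F0 E) (use C in auto)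
  also have "integral {0..1} F = Re (g 0)"
  proof -
    have "poisson 0 t = 1" for t by (simp add: poisson_def)
    then show ?thesis
      using has_integral_linear[OF poisson_dilate[OF g order_refl s, of 1] bounded_linear_Re]
      by (simp add: o_def F_def integral_unique)
  qed
  finally show ?thesis by simp
qed

lemma disc_harnack:
  assumes g: "g holomorphic_on ball 0 1" and pos: "\<And>u. cmod u < 1 \<Longrightarrow> 0 \<le> Re (g u)"
    and u: "cmod u \<le> 1/2"
  shows "Re (g u) \<le> 5 * Re (g 0)"
proof -
  define c where "c = (if u = 0 then 1 else sgn u)"
  have c: "cmod c = 1" "u = of_real (cmod u) * c"
    by (auto simp: c_def norm_divide sgn_eq)
  \<comment> \<open>The circle of radius 3/4 encloses \<open>u\<close>. With \<open>cmod u\<close>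
    at most 1/2 the ratio is at most 2/3, where (1 + r)/(1 - r) equals 5.\<close>
  define r where "r = cmod u / (3/4)"
  have r: "0 \<le> r" "r \<le> 2/3" using u by (auto simp: r_def)
  have i1: "((\<lambda>t. poisson r t * Re (g (of_real (3/4) * c * circ t))) has_integral Re (g u)) {0..1}"
    using has_integral_linear[OF poisson_dilate[OF g, of "cmod u" "3/4" c] bounded_linear_Re] u c
    by (simp add: o_def r_def)
  have i2: "((\<lambda>t. 5 * Re (g (of_real (3/4) * c * circ t))) has_integral 5 * Re (g 0)) {0..1}"
    using has_integral_mult_right[OF has_integral_linear[OF poisson_dilate[OF g, of 0 "3/4" c] bounded_linear_Re], of 5] c
    by (simp add: o_def poisson_def)
  show ?thesis
  proof (rule has_integral_le[OF i1 i2])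
    fix t :: real
    have "poisson r t \<le> (1 + r) / (1 - r)" using r by (intro poisson_bounds) auto
    also have "\<dots> \<le> 5" using r by (simp add: field_simps)
    finally show "poisson r t * Re (g (of_real (3/4) * c * circ t)) \<le> 5 * Re (g (of_real (3/4) * c * circ t))"
      using c by (intro mult_right_mono pos) (auto simp: norm_mult)
  qed
qed

section \<open>Zeros of radial limits\<close>

text \<open>A fixed sequence increasing to 1; the shift by 2 makes its first term 1/2.\<close>

definition radii :: "nat \<Rightarrow> real" where
  "radii n = 1 - 1 / real (n + 2)"

lemma radii: "0 < radii n" "radii n < 1" "radii \<longlonglongrightarrow> 1"
proof -
  show "0 < radii n" "radii n < 1" by (auto simp: radii_def)
  show "radii \<longlonglongrightarrow> 1" unfolding radii_def by real_asymp
qed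

text \<open>Division by Blaschke factors: replacing w - a by 1 - \<open>cnj a\<close> w keeps the
  modulus on the circle and does not decrease it inside. Each induction step removes one zero with
  its full multiplicity. Zeros on the circle may remain.\<close>

lemma zero_removal:
  assumes "g holomorphic_on ball 0 R" "1 < R" "finite {u \<in> ball 0 1. g u = 0}"
  shows "\<exists>h. h holomorphic_on ball 0 R \<and> (\<forall>u\<in>ball 0 1. h u \<noteq> 0) \<and>
    (\<forall>u\<in>sphere 0 1. cmod (h u) = cmod (g u)) \<and> (\<forall>u\<in>ball 0 1. cmod (g u) \<le> cmod (h u))"
  using assms
proof (induction "card {u \<in> ball 0 1. g u = 0}" arbitrary: g rule: less_induct)
  case less
  note g = less.prems(1) and R = less.prems(2) and fin = less.prems(3)
  show ?case
  proof (cases "{u \<in> ball 0 1. g u = 0} = {}")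
    case True
    then show ?thesis using g by (intro exI[of _ g]) auto
  next
    case False
    then obtain a where a: "cmod a < 1" "g a = 0" by auto
    \<comment> \<open>A constant function with a zero would vanish on the whole disc, against the
      finiteness of the zero set.\<close>
    have nonconst: "\<not> g constant_on ball 0 R"
    proof
      assume "g constant_on ball 0 R"
      then have "{u \<in> ball 0 1. g u = 0} = ball 0 1"
        using a R by (auto simp: constant_on_def)
      then show False using fin uncountable_ball[of 1 "0::complex"] countable_finite by auto
    qed
    obtain g0 r n where n: "0 < n" "0 < r" "ball a r \<subseteq> ball 0 R" "g0 holomorphic_on ball a r"
      "\<And>w. w \<in> ball a r \<Longrightarrow> g w = (w - a)^n * g0 w" "\<And>w. w \<in> ball a r \<Longrightarrow> g0 w \<noteq> 0"
      by (rule holomorphic_factor_zero_nonconstant[OF g open_ball connected_ball _ a(2) nonconst])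
        (use a R in auto)
    define g1 where "g1 w = (if w \<in> ball a r then g0 w else g w / (w - a)^n)" for w
    have g1_fact: "g w = (w - a)^n * g1 w" if "w \<in> ball 0 R" for w
      using n that by (auto simp: g1_def)
    have g1_off: "g1 w = g w / (w - a)^n" if "w \<noteq> a" for w
      using n that by (auto simp: g1_def)
    have "g1 holomorphic_on ball a r \<union> (ball 0 R - {a})"
    proof (rule holomorphic_on_Un)
      show "g1 holomorphic_on ball a r"
        by (rule holomorphic_transform[OF n(4)]) (simp add: g1_def)
      have "(\<lambda>w. g w / (w - a)^n) holomorphic_on ball 0 R - {a}"
        by (intro holomorphic_intros holomorphic_on_subset[OF g]) auto
      then show "g1 holomorphic_on ball 0 R - {a}"
        by (rule holomorphic_transform) (simp add: g1_off)
    qed auto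
    moreover have "ball 0 R \<subseteq> ball a r \<union> (ball 0 R - {a})" using n(2) by auto
    ultimately have g1_hol: "g1 holomorphic_on ball 0 R" by (rule holomorphic_on_subset)
    define g2 where "g2 w = (1 - cnj a * w)^n * g1 w" for w
    have g2_hol: "g2 holomorphic_on ball 0 R"
      unfolding g2_def by (intro holomorphic_intros g1_hol)
    have id: "(cmod (1 - cnj a * w))\<^sup>2 - (cmod (w - a))\<^sup>2 = (1 - (cmod a)\<^sup>2) * (1 - (cmod w)\<^sup>2)" for w
      unfolding cmod_power2 by (simp add: algebra_simps power2_eq_square)
    have a1: "0 < 1 - (cmod a)\<^sup>2" using a by (simp add: power_less_one_iff)
    have eq: "cmod (1 - cnj a * w) = cmod (w - a)" if "cmod w = 1" for w
      using id[of w] that by (simp add: power2_eq_iff_nonneg)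
    have le: "cmod (w - a) \<le> cmod (1 - cnj a * w)" if "cmod w < 1" for w
    proof (rule power2_le_imp_le)
      have "0 \<le> (1 - (cmod a)\<^sup>2) * (1 - (cmod w)\<^sup>2)"
        using a1 that by (simp add: power_le_one)
      then show "(cmod (w - a))\<^sup>2 \<le> (cmod (1 - cnj a * w))\<^sup>2" using id[of w] by linarith
    qed simp
    have nz: "1 - cnj a * w \<noteq> 0" if "cmod w < 1" for w
    proof
      assume "1 - cnj a * w = 0"
      then have "cmod (w - a) = 0" using le[OF that] by simp
      then have "0 < (1 - (cmod a)\<^sup>2) * (1 - (cmod w)\<^sup>2)"
        using a1 that by (simp add: power_less_one_iff)
      then show False using id[of w] \<open>1 - cnj a * w = 0\<close> \<open>cmod (w - a) = 0\<close> by simp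
    qed
    have zeros: "{u \<in> ball 0 1. g2 u = 0} \<subset> {u \<in> ball 0 1. g u = 0}"
    proof
      show "{u \<in> ball 0 1. g2 u = 0} \<subseteq> {u \<in> ball 0 1. g u = 0}"
        using nz g1_fact R by (auto simp: g2_def)
      have "g1 a \<noteq> 0" using n(2,6) by (simp add: g1_def)
      then have "g2 a \<noteq> 0" using nz a(1) by (simp add: g2_def)
      then show "{u \<in> ball 0 1. g2 u = 0} \<noteq> {u \<in> ball 0 1. g u = 0}" using a by auto
    qed
    from less.hyps[OF psubset_card_mono[OF fin zeros] g2_hol R finite_subset[OF psubset_imp_subset[OF zeros] fin]]
    obtain h where h: "h holomorphic_on ball 0 R" "\<And>u. u \<in> ball 0 1 \<Longrightarrow> h u \<noteq> 0"
      "\<And>u. u \<in> sphere 0 1 \<Longrightarrow> cmod (h u) = cmod (g2 u)" "\<And>u. u \<in> ball 0 1 \<Longrightarrow> cmod (g2 u) \<le> cmod (h u)"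
      by blast
    have "cmod (g2 u) = cmod (g u)" if "u \<in> sphere 0 1" for u
      using g1_fact[of u] that eq[of u] R by (simp add: g2_def norm_mult norm_power)
    moreover have "cmod (g u) \<le> cmod (g2 u)" if "u \<in> ball 0 1" for u
      using g1_fact[of u] that le[of u] R
      by (simp add: g2_def norm_mult norm_power mult_right_mono power_mono)
    ultimately show ?thesis using h by (intro exI[of _ h]) (metis order_trans)
  qed
qed

text \<open>Used with \<open>p \<rightarrow> 0\<close>, where the right-hand side tends to the harmonic measure of the set on
  which the boundary values do not vanish.\<close>

lemma powr_submean:
  assumes g: "g holomorphic_on ball 0 R" and R: "1 < R" and fin: "finite {u \<in> ball 0 1. g u = 0}"
    and r: "0 \<le> r" "r < 1" and p: "0 < p"
  shows "cmod (g (of_real r)) powr p \<le> integral {0..1} (\<lambda>t. poisson r t * cmod (g (circ t)) powr p)"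
proof -
  obtain h where h: "h holomorphic_on ball 0 R" "\<And>u. u \<in> ball 0 1 \<Longrightarrow> h u \<noteq> 0"
      "\<And>u. u \<in> sphere 0 1 \<Longrightarrow> cmod (h u) = cmod (g u)" "\<And>u. u \<in> ball 0 1 \<Longrightarrow> cmod (g u) \<le> cmod (h u)"
    using zero_removal[OF g R fin] by blast
  have h1: "h holomorphic_on ball 0 1" by (rule holomorphic_on_subset[OF h(1)]) (use R in auto)
  have hc: "continuous_on (cball 0 1) h"
    by (rule continuous_on_subset[OF holomorphic_on_imp_continuous_on[OF h(1)]]) (use R in auto)
  obtain L where L: "L holomorphic_on ball 0 1" "\<And>u. u \<in> ball 0 1 \<Longrightarrow> exp (L u) = h u"
    using holomorphic_logarithm_exists[OF convex_ball open_ball h1, of 0] h(2) by auto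
  \<comment> \<open>A holomorphic branch of the \<open>p\<close>-th power of \<open>h\<close>,
    available because \<open>h\<close> has no zeros in the open disc.\<close>
  define G where "G u = exp (of_real p * L u)" for u
  have G: "G holomorphic_on ball 0 1" unfolding G_def by (intro holomorphic_intros L)
  have cG: "cmod (G u) = cmod (h u) powr p" if "u \<in> ball 0 1" for u
    unfolding L(2)[OF that, symmetric] by (simp add: G_def powr_def)
  \<comment> \<open>Since \<open>h\<close> may still vanish on the unit circle, \<open>G\<close>
    lives on the open disc only. The Poisson formula is applied on circles of radius
    \<open>radii n\<close>, and the limit is taken for the continuous function
    |\<open>h\<close>|^\<open>p\<close>.\<close>
  note s = radii(1,2) and s_lim = radii(3)
  have inb: "of_real (radii n) * u \<in> ball 0 1" if "cmod u \<le> 1" for n and u :: complex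
  proof -
    have "cmod (of_real (radii n) * u) = radii n * cmod u" using s[of n] by (simp add: norm_mult)
    also have "\<dots> \<le> radii n * 1" using s[of n] that by (intro mult_left_mono) auto
    also have "\<dots> < 1" using s[of n] by simp
    finally show ?thesis by simp
  qed
  have cGs: "cmod (G (of_real (radii n) * circ t)) = cmod (h (of_real (radii n) * circ t)) powr p" for n t
    by (intro cG inb) simp
  have lim_h: "(\<lambda>n. cmod (h (of_real (radii n) * u)) powr p) \<longlonglongrightarrow> cmod (h u) powr p" if u: "cmod u \<le> 1" for u
  proof -
    have "(\<lambda>n. of_real (radii n) * u) \<longlonglongrightarrow> of_real 1 * u" by (intro tendsto_intros s_lim)
    then have "(\<lambda>n. h (of_real (radii n) * u)) \<longlonglongrightarrow> h u"
      using continuous_on_tendsto_compose[OF hc, of "\<lambda>n. of_real (radii n) * u" u sequentially] u inb[OF u]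
      by (simp add: less_imp_le)
    then show ?thesis using p by (intro tendsto_powr' tendsto_norm tendsto_const) auto
  qed
  have cont: "continuous_on {0..1} (\<lambda>t. poisson r t * cmod (G (of_real (radii n) * circ t)))" for n
    by (intro continuous_intros r continuous_on_compose2[OF holomorphic_on_imp_continuous_on[OF G]])
      (use inb in auto)
  have le: "cmod (h (of_real (radii n) * of_real r)) powr p \<le> integral {0..1} (\<lambda>t. poisson r t * cmod (h (of_real (radii n) * circ t)) powr p)" for n
  proof -
    have 1: "((\<lambda>t. of_real (poisson r t) * G (of_real (radii n) * circ t)) has_integral G (of_real (radii n) * of_real r)) {0..1}"
      using poisson_dilate[OF G, of "radii n * r" "radii n" 1] s[of n] r by simp
    have "cmod (integral {0..1} (\<lambda>t. of_real (poisson r t) * G (of_real (radii n) * circ t)))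
        \<le> integral {0..1} (\<lambda>t. poisson r t * cmod (G (of_real (radii n) * circ t)))"
    proof (rule integral_norm_bound_integral)
      show "(\<lambda>t. of_real (poisson r t) * G (of_real (radii n) * circ t)) integrable_on {0..1}"
        using 1 by blast
      show "(\<lambda>t. poisson r t * cmod (G (of_real (radii n) * circ t))) integrable_on {0..1}"
        by (rule integrable_continuous_real[OF cont])
    qed (use poisson_bounds(3)[OF r] in \<open>simp add: norm_mult\<close>)
    also have "\<dots> = integral {0..1} (\<lambda>t. poisson r t * cmod (h (of_real (radii n) * circ t)) powr p)"
      by (simp add: cGs)
    finally show ?thesis using integral_unique[OF 1] cG[OF inb, of "of_real r" n] r by simp
  qed
  obtain C where C: "\<And>u. u \<in> cball 0 1 \<Longrightarrow> cmod (h u) \<le> C"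
    using compact_imp_bounded[OF compact_continuous_image[OF hc compact_cball]] unfolding bounded_iff by blast
  have "(\<lambda>n. integral {0..1} (\<lambda>t. poisson r t * cmod (h (of_real (radii n) * circ t)) powr p))
    \<longlonglongrightarrow> integral {0..1} (\<lambda>t. poisson r t * cmod (h (circ t)) powr p)"
  proof (rule dominated_convergence(2))
    show "(\<lambda>t. poisson r t * cmod (h (of_real (radii n) * circ t)) powr p) integrable_on {0..1}" for n
      using integrable_continuous_real[OF cont[of n]] by (simp add: cGs)
    show "(\<lambda>t::real. (1 + r) / (1 - r) * C powr p) integrable_on {0..1}"
      by (intro integrable_continuous_real continuous_on_const)
    show "norm (poisson r t * cmod (h (of_real (radii n) * circ t)) powr p) \<le> (1 + r) / (1 - r) * C powr p" for n t
    proof -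
      have "cmod (h (of_real (radii n) * circ t)) powr p \<le> C powr p"
        using C inb[of "circ t" n] p by (intro powr_mono2) (auto simp: less_imp_le)
      then show ?thesis
        using poisson_bounds[OF r, of t] r
          mult_mono[of "poisson r t" "(1 + r) / (1 - r)" "cmod (h (of_real (radii n) * circ t)) powr p" "C powr p"]
        by (simp add: abs_mult)
    qed
    show "(\<lambda>n. poisson r t * cmod (h (of_real (radii n) * circ t)) powr p) \<longlonglongrightarrow> poisson r t * cmod (h (circ t)) powr p" for t
      by (intro tendsto_mult tendsto_const lim_h) simp
  qed
  from LIMSEQ_le[OF lim_h[of "of_real r"] this] le r
  have "cmod (h (of_real r)) powr p \<le> integral {0..1} (\<lambda>t. poisson r t * cmod (h (circ t)) powr p)"
    by auto
  moreover have "cmod (g (of_real r)) powr p \<le> cmod (h (of_real r)) powr p"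
    using h(4)[of "of_real r"] r p by (intro powr_mono2) auto
  ultimately show ?thesis using h(3) by simp
qed

text \<open>With \<open>c\<close> a lower bound of the Poisson kernels involved,
  \<open>powr_submean\<close> on the circles of radius \<open>s n\<close> bounds \<open>c\<close>
  times the integral over \<open>N\<close> of 1 - |g|^p by 1 - |g(r)|^p. As g tends to 0 on
  \<open>N\<close>, the left-hand side tends to \<open>c\<close> times the measure of
  \<open>N\<close>. Letting p tend to 0 makes the right-hand side 0, since g(r) is nonzero.\<close>

lemma radial_zeros_null:
  assumes g: "g holomorphic_on ball 0 1" and bd: "\<And>u. u \<in> ball 0 1 \<Longrightarrow> cmod (g u) \<le> 1"
    and r: "0 \<le> r" "r < q" and nz: "g (of_real r) \<noteq> 0"
    and s: "\<And>n. q \<le> s n" "\<And>n. s n < 1"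
    and N: "N \<in> sets lborel" "N \<subseteq> {0..1}" "\<And>a. a \<in> N \<Longrightarrow> (\<lambda>n::nat. g (of_real (s n) * circ a)) \<longlonglongrightarrow> 0"
  shows "emeasure lborel N = 0"
proof -
  \<comment> \<open>The minimum of the Poisson kernel for the ratio \<open>r / q\<close>. As
    \<open>s n\<close> is at least \<open>q\<close>, the ratios \<open>r / s n\<close> are no
    larger, so \<open>c\<close> serves all \<open>n\<close>.\<close>
  define c where "c = (1 - r / q) / (1 + r / q)"
  have q: "0 < q" using r by simp
  have "r / q < 1" "0 \<le> r / q" using r q by auto
  then have c: "0 < c" unfolding c_def by (intro divide_pos_pos) auto
  have Nm: "N \<in> lmeasurable"
    using N by (intro fmeasurableI2[of "{0..1}" lebesgue N] lmeasurable_interval) auto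
  have inb: "of_real (s n) * circ t \<in> ball 0 1" for n t
    using s[of n] q by (simp add: norm_mult abs_if)
  have cg: "continuous_on S (\<lambda>t. cmod (g (of_real (s n) * circ t)) powr p)" if "0 < p" for S n p
    by (intro continuous_on_powr' continuous_intros continuous_on_compose2[OF holomorphic_on_imp_continuous_on[OF g]])
      (use inb that in auto)
  have key: "c * measure lebesgue N \<le> 1 - cmod (g (of_real r)) powr p" if p: "0 < p" for p
  proof -
    let ?f = "\<lambda>n t. c * (1 - cmod (g (of_real (s n) * circ t)) powr p)"
    have f01: "0 \<le> 1 - cmod (g (of_real (s n) * circ t)) powr p" "1 - cmod (g (of_real (s n) * circ t)) powr p \<le> 1" for n t
      using bd[OF inb] p powr_mono2[of p "cmod (g (of_real (s n) * circ t))" 1] by auto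
    have intN: "?f n integrable_on N" for n
    proof -
      have "?f n absolutely_integrable_on {0..1}"
        by (rule absolutely_integrable_continuous_real) (intro continuous_intros cg p)
      then have "?f n absolutely_integrable_on N"
        by (rule set_integrable_subset) (use N in auto)
      then show ?thesis by (rule set_lebesgue_integral_eq_integral(1))
    qed
    have "(\<lambda>n. integral N (?f n)) \<longlonglongrightarrow> integral N (\<lambda>t. c * 1)"
    proof (rule dominated_convergence(2))
      show "(\<lambda>t. c) integrable_on N" using Nm by (simp add: integrable_on_const)
      show "norm (?f n t) \<le> c" for n t
        using f01[where n=n and t=t] c by (simp add: abs_mult mult_left_le)
      show "(\<lambda>n. ?f n t) \<longlonglongrightarrow> c * 1" if "t \<in> N" for t
      proof -
        have "(\<lambda>n. cmod (g (of_real (s n) * circ t)) powr p) \<longlonglongrightarrow> 0 powr p"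
          using N(3)[OF that] p by (intro tendsto_powr' tendsto_norm_zero tendsto_const) auto
        then have "(\<lambda>n. ?f n t) \<longlonglongrightarrow> c * (1 - 0 powr p)" by (intro tendsto_mult tendsto_diff tendsto_const)
        then show ?thesis by simp
      qed
    qed (rule intN)
    moreover have "integral N (?f n) \<le> 1 - cmod (g (of_real r)) powr p" for n
    proof -
      have sn: "0 < s n" "s n < 1" "r < s n" using s[of n] q r by (auto intro: less_le_trans)
      define \<rho> where "\<rho> = r / s n"
      have \<rho>: "0 \<le> \<rho>" "\<rho> < 1" "\<rho> \<le> r / q"
        using sn r q s(1)[of n] by (auto simp: \<rho>_def intro: divide_left_mono)
      let ?P = "poisson \<rho>"
      have cP: "c \<le> ?P t" for t
      proof -
        have "c \<le> (1 - \<rho>) / (1 + \<rho>)"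
          unfolding c_def using \<rho> r q by (intro frac_le) auto
        also have "\<dots> \<le> ?P t" by (rule poisson_bounds(1)[OF \<rho>(1,2)])
        finally show ?thesis .
      qed
      have gn: "(\<lambda>u. g (of_real (s n) * u)) holomorphic_on ball 0 (1 / s n)"
        using disc_dilate[OF g sn(1,2), of 1] by simp
      have R: "1 < 1 / s n" using sn by simp
      \<comment> \<open>The dilate is holomorphic beyond the closed disc, so it has finitely many
        zeros there unless it is constant; in the constant case it equals g(r), which is
        nonzero.\<close>
      have fin: "finite {u \<in> ball 0 1. g (of_real (s n) * u) = 0}"
      proof (cases "(\<lambda>u. g (of_real (s n) * u)) constant_on ball 0 (1 / s n)")
        case True
        have "(of_real \<rho> :: complex) \<in> ball 0 (1 / s n)" using \<rho> R by simp
        then have "g (of_real (s n) * u) = g (of_real (s n) * of_real \<rho>)" if "u \<in> ball 0 1" for u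
          using True that R unfolding constant_on_def
          by (metis (no_types, lifting) less_trans mem_ball_0)
        then have "{u \<in> ball 0 1. g (of_real (s n) * u) = 0} = {}"
          using nz sn by (auto simp: \<rho>_def)
        then show ?thesis by (simp only: finite.emptyI)
      next
        case False
        have "finite {u \<in> cball 0 1. g (of_real (s n) * u) = 0}"
          by (rule holomorphic_compact_finite_zeros[OF gn open_ball connected_ball compact_cball _ False])
            (use R in auto)
        then show ?thesis by (rule rev_finite_subset) auto
      qed
      have "cmod (g (of_real r)) powr p \<le> integral {0..1} (\<lambda>t. ?P t * cmod (g (of_real (s n) * circ t)) powr p)"
        using powr_submean[OF gn R fin \<rho>(1,2) p] sn by (simp add: \<rho>_def)
      moreover have "integral N (?f n) \<le> integral {0..1} (?f n)"
        using N f01 c by (intro integral_subset_le intN integrable_continuous_real continuous_intros cg p) auto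
      moreover have "\<dots> \<le> integral {0..1} (\<lambda>t. ?P t - ?P t * cmod (g (of_real (s n) * circ t)) powr p)"
      proof (rule integral_le)
        show "?f n t \<le> ?P t - ?P t * cmod (g (of_real (s n) * circ t)) powr p" for t
          using mult_right_mono[OF cP f01(1)] by (simp add: algebra_simps)
      qed (intro integrable_continuous_real continuous_intros cg p \<rho>)+
      moreover have "\<dots> = 1 - integral {0..1} (\<lambda>t. ?P t * cmod (g (of_real (s n) * circ t)) powr p)"
        by (subst Henstock_Kurzweil_Integration.integral_diff)
          (intro integrable_continuous_real continuous_intros cg p \<rho>
            | simp add: integral_unique[OF poisson_integral[OF \<rho>(1,2)]])+
      ultimately show ?thesis by linarith
    qed
    ultimately have "integral N (\<lambda>t. c * 1) \<le> 1 - cmod (g (of_real r)) powr p"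
      by (intro LIMSEQ_le_const2) auto
    moreover have "integral N (\<lambda>t. c * 1) = c * measure lebesgue N"
      unfolding lmeasure_integral[OF Nm] by (rule Henstock_Kurzweil_Integration.integral_mult_right)
    ultimately show ?thesis by simp
  qed
  have "(\<lambda>n. 1 - cmod (g (of_real r)) powr (1 / real (Suc n))) \<longlonglongrightarrow> 1 - cmod (g (of_real r)) powr 0"
    using nz by (intro tendsto_intros tendsto_powr LIMSEQ_Suc[OF lim_1_over_n]) auto
  then have "c * measure lebesgue N \<le> 1 - cmod (g (of_real r)) powr 0"
    by (rule LIMSEQ_le_const) (use key in auto)
  then have "measure lebesgue N \<le> 0" using c nz by (simp add: mult_le_0_iff)
  then have "measure lebesgue N = 0" using measure_nonneg[of lebesgue N] by linarith
  then have "emeasure lebesgue N = 0"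
    using Nm by (simp add: emeasure_eq_measure2)
  then show ?thesis using N by simp
qed

section \<open>Rotation invariant measures on the sphere\<close>

text \<open>The complex inner product of C^d, whose real part is the inner product of the
  type.\<close>

definition herm :: "complex^'d \<Rightarrow> complex^'d \<Rightarrow> complex" where
  "herm z w = (\<Sum>i\<in>UNIV. z $ i * cnj (w $ i))"

lemma herm_linear [simp]:
  "herm (x + y) w = herm x w + herm y w" "herm (c *s x) w = c * herm x w"
  "herm w (x + y) = herm w x + herm w y" "herm w (c *s x) = cnj c * herm w x"
  "herm (x - y) w = herm x w - herm y w" "herm w (x - y) = herm w x - herm w y"
  by (simp_all add: herm_def sum.distrib sum_distrib_left sum_subtractf algebra_simps)

lemma herm_cnj: "herm y x = cnj (herm x y)"
  by (simp add: herm_def mult.commute)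

lemma herm_self: "herm x x = of_real ((norm x)\<^sup>2)"
proof -
  have "herm x x = of_real (\<Sum>i\<in>UNIV. (cmod (x $ i))\<^sup>2)"
    by (simp add: herm_def complex_norm_square del: of_real_power)
  also have "(\<Sum>i\<in>UNIV. (cmod (x $ i))\<^sup>2) = (norm x)\<^sup>2"
    by (simp add: norm_vec_def L2_set_def sum_nonneg)
  finally show ?thesis .
qed

lemma continuous_on_herm [continuous_intros]:
  "continuous_on S f \<Longrightarrow> continuous_on S g \<Longrightarrow> continuous_on S (\<lambda>x. herm (f x) (g x))"
  unfolding herm_def by (intro continuous_intros)

text \<open>For a unit vector \<open>v\<close> and |c| = 1 this is the unitary map that multiplies
  the component along \<open>v\<close> by \<open>c\<close> and fixes the orthogonal complement. It
  is affine in \<open>c\<close>, so along it a function becomes a holomorphic function of one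
  variable.\<close>

definition rotation :: "complex \<Rightarrow> complex^'d \<Rightarrow> complex^'d \<Rightarrow> complex^'d" where
  "rotation c v z = z + ((c - 1) * herm z v) *s v"

lemma norm_rotation:
  assumes "cmod c = 1" "norm v = 1"
  shows "norm (rotation c v z) = norm z"
proof -
  let ?h = "herm z v"
  have vv: "herm v v = 1" using assms by (simp add: herm_self)
  have "cnj c * c = 1" using complex_norm_square[of c] assms by (simp add: mult.commute)
  then have c: "cnj (c - 1) + (c - 1) + (c - 1) * cnj (c - 1) = 0" by (simp add: algebra_simps)
  have "herm (rotation c v z) (rotation c v z)
    = herm z z + (cnj (c - 1) + (c - 1) + (c - 1) * cnj (c - 1)) * (?h * cnj ?h)"
    unfolding rotation_def using herm_cnj[of v z] by (simp add: vv algebra_simps)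
  then have "herm (rotation c v z) (rotation c v z) = herm z z"
    unfolding c by simp
  then have "(norm (rotation c v z))\<^sup>2 = (norm z)\<^sup>2"
    unfolding herm_self using of_real_eq_iff by blast
  then show ?thesis by simp
qed

lemma scaleR_vector_scalar_mult: "r *\<^sub>R x = of_real r *s x" for x :: "complex^'d"
  by (simp add: vec_eq_iff scaleR_conv_of_real[where 'a = complex])

lemma orthogonal_rotation:
  assumes "cmod c = 1" "norm v = 1"
  shows "orthogonal_transformation (rotation c v)"
  unfolding orthogonal_transformation
proof
  show "linear (rotation c v)"
    by (rule linearI)
      (simp_all add: rotation_def scaleR_vector_scalar_mult vec_eq_iff algebra_simps)
qed (use norm_rotation[OF assms] in simp)

lemma orthogonal_scalar_mult:
  assumes "cmod c = 1"
  shows "orthogonal_transformation (\<lambda>z::complex^'d. c *s z)"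
  unfolding orthogonal_transformation
proof
  show "linear (\<lambda>z::complex^'d. c *s z)"
    by (rule linearI) (simp_all add: vec_eq_iff algebra_simps)
qed (use assms in simp)

text \<open>A complex Householder map along \<open>w - z\<close>. When \<open>herm z w\<close> is
  real the factor is -1; in general -1 does not suffice, and \<open>c\<close> below is the
  unimodular number that solves (c - 1) b = |w - z|^2.\<close>

lemma rotation_transitive:
  assumes z: "norm z = 1" and w: "norm w = 1"
  obtains c v where "cmod c = 1" "norm v = 1" "rotation c v z = w"
proof (cases "z = w")
  case True
  show ?thesis by (rule that[of 1 z]) (use z True in \<open>auto simp: rotation_def\<close>)
next
  case False
  define n where "n = norm (w - z)"
  have n: "n > 0" using False by (simp add: n_def)
  define b where "b = herm z w - 1"
  have zz: "herm z z = 1" "herm w w = 1" using z w by (auto simp: herm_self)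
  have "of_real (n\<^sup>2) = herm (w - z) (w - z)" by (simp add: n_def herm_self)
  also have "\<dots> = - (b + cnj b)" using zz herm_cnj[of w z] by (simp add: b_def algebra_simps)
  finally have nb: "of_real (n\<^sup>2) = - (b + cnj b)" .
  have b0: "b \<noteq> 0" using nb n by auto
  define c where "c = - cnj b / b"
  define v where "v = of_real (1 / n) *s (w - z)"
  have "norm c = 1" using b0 by (simp add: c_def norm_divide)
  moreover have "norm v = 1"
    unfolding v_def norm_vector_scalar_mult using n by (simp add: n_def norm_divide)
  moreover have "rotation c v z = w"
  proof -
    have hv: "herm z v = of_real (1 / n) * b" by (simp add: v_def zz b_def diff_divide_distrib)
    have "(c - 1) * b = - cnj b - b" using b0 by (simp add: c_def algebra_simps)
    then have "(c - 1) * b = of_real (n\<^sup>2)" using nb by simp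
    then have "(c - 1) * herm z v * of_real (1 / n) = 1"
      using n by (simp add: hv field_simps power2_eq_square)
    then show ?thesis unfolding rotation_def
      by (subst v_def) (simp add: vec_eq_iff)
  qed
  ultimately show ?thesis by (rule that)
qed

section \<open>Slices and Harnack's inequality in the ball\<close>

lemma ball_regular_slice:
  assumes "ball_regular V" "norm z = 1"
  shows "(\<lambda>u. V (u *s z)) holomorphic_on ball 0 1"
proof -
  have "(\<lambda>u. V (0 + u *s z)) holomorphic_on {u. 0 + u *s z \<in> ball 0 1}"
    using assms(1) unfolding ball_regular_def by blast
  moreover have "{u. 0 + u *s z \<in> ball 0 1} = ball 0 1" using assms(2) by auto
  ultimately show ?thesis by simp
qed

text \<open>The disc inequality on the complex line x + u w with w = 2 (y - x): the point
  \<open>y\<close> sits at u = 1/2, and \<open>w\<close> is short enough for the whole disc to stay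
  in the ball.\<close>

lemma harnack_step:
  assumes V: "ball_regular V" and pos: "\<And>z. z \<in> ball 0 1 \<Longrightarrow> 0 \<le> Re (V z)"
    and x: "norm x < 1" and y: "norm (y - x) \<le> (1 - norm x) / 2"
  shows "Re (V y) \<le> 5 * Re (V x)"
proof -
  define w where "w = 2 *s (y - x)"
  have nw: "norm w \<le> 1 - norm x" unfolding w_def norm_vector_scalar_mult using y by simp
  have inb: "x + u *s w \<in> ball 0 1" if "cmod u < 1" for u
  proof -
    have "norm (x + u *s w) \<le> norm x + cmod u * norm w" using norm_triangle_ineq[of x "u *s w"] by simp
    also have "\<dots> < 1"
    proof (cases "w = 0")
      case False
      then have "cmod u * norm w < 1 * norm w" using that by (intro mult_strict_right_mono) auto
      then show ?thesis using nw by simp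
    qed (use x in simp)
    finally show ?thesis by simp
  qed
  have "(\<lambda>u. V (x + u *s w)) holomorphic_on {u. x + u *s w \<in> ball 0 1}"
    using V unfolding ball_regular_def by blast
  then have g: "(\<lambda>u. V (x + u *s w)) holomorphic_on ball 0 1"
    by (rule holomorphic_on_subset) (use inb in auto)
  have e: "x + (1/2) *s w = y" by (simp add: w_def vec_eq_iff)
  have "Re (V (x + (1/2) *s w)) \<le> 5 * Re (V (x + 0 *s w))"
    by (rule disc_harnack[OF g]) (use inb pos in auto)
  then show ?thesis by (simp add: e)
qed

text \<open>The segment from \<open>x\<close> to \<open>y\<close> stays in the ball of radius 1 -
  \<open>\<delta>\<close>, so each of its \<open>N\<close> equal pieces is short enough for
  \<open>harnack_step\<close>.\<close>

lemma harnack_chain: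
  assumes V: "ball_regular V" and pos: "\<And>z. z \<in> ball 0 1 \<Longrightarrow> 0 \<le> Re (V z)"
    and d: "0 < \<delta>" "norm x \<le> 1 - \<delta>" "norm y \<le> 1 - \<delta>" and N: "0 < N" "norm (y - x) \<le> real N * (\<delta> / 2)"
  shows "Re (V y) \<le> 5 ^ N * Re (V x)"
proof -
  define p where "p j = x + (real j / real N) *\<^sub>R (y - x)" for j
  have p_norm: "norm (p j) \<le> 1 - \<delta>" if "j \<le> N" for j
  proof -
    let ?t = "real j / real N"
    have t: "0 \<le> ?t" "?t \<le> 1" using that N by auto
    have "p j = (1 - ?t) *\<^sub>R x + ?t *\<^sub>R y" by (simp add: p_def algebra_simps)
    then have "norm (p j) \<le> (1 - ?t) * norm x + ?t * norm y"
      using norm_triangle_ineq[of "(1 - ?t) *\<^sub>R x" "?t *\<^sub>R y"] t by simp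
    also have "\<dots> \<le> (1 - ?t) * (1 - \<delta>) + ?t * (1 - \<delta>)"
      using t d by (intro add_mono mult_left_mono) auto
    finally show ?thesis by (simp add: algebra_simps)
  qed
  have "Re (V (p j)) \<le> 5 ^ j * Re (V x)" if "j \<le> N" for j
    using that
  proof (induction j)
    case 0
    then show ?case by (simp add: p_def)
  next
    case (Suc j)
    have "p (Suc j) - p j = (1 / real N) *\<^sub>R (y - x)"
      unfolding p_def by (simp add: algebra_simps add_divide_distrib)
    then have "norm (p (Suc j) - p j) = norm (y - x) / real N" by simp
    also have "\<dots> \<le> \<delta> / 2" using N by (simp add: field_simps)
    also have "\<dots> \<le> (1 - norm (p j)) / 2" using p_norm[of j] Suc by simp
    finally have "Re (V (p (Suc j))) \<le> 5 * Re (V (p j))"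
      using p_norm[of j] Suc d by (intro harnack_step[OF V pos]) auto
    with Suc show ?case by simp
  qed
  from this[of N] N show ?thesis by (simp add: p_def)
qed

text \<open>The distance from \<open>l\<close> to the point of equal norm on the radius of
  \<open>z\<close> is at most (a + 1)(1 - \<open>norm l\<close>). Steps of half the distance to the
  boundary cover it in a number that depends on \<open>a\<close> alone, uniformly in
  \<open>V\<close>, \<open>z\<close> and \<open>l\<close>.\<close>

lemma nontangential_harnack:
  assumes a: "0 < a"
  obtains N :: nat where "\<And>V z l. ball_regular V \<Longrightarrow> (\<And>z. z \<in> ball 0 1 \<Longrightarrow> 0 \<le> Re (V z)) \<Longrightarrow>
    norm z = 1 \<Longrightarrow> norm l < 1 \<Longrightarrow> dist l z < a * (1 - norm l) \<Longrightarrow>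
    Re (V l) \<le> 5 ^ N * Re (V (of_real (norm l) *s (z :: complex^'d)))"
proof -
  obtain N :: nat where N: "2 * (a + 1) < real N" using reals_Archimedean2 by blast
  show thesis
  proof (rule that[of N])
    fix V :: "complex^'d \<Rightarrow> complex" and z l :: "complex^'d"
    assume V: "ball_regular V" and pos: "\<And>z. z \<in> ball 0 1 \<Longrightarrow> 0 \<le> Re (V z)"
      and z: "norm z = 1" and l: "norm l < 1" and dist: "dist l z < a * (1 - norm l)"
    let ?x = "of_real (norm l) *s z"
    have "norm (z - ?x) = 1 - norm l"
    proof -
      have "z - ?x = of_real (1 - norm l) *s z" by (simp add: vec_eq_iff algebra_simps)
      then have "norm (z - ?x) = \<bar>1 - norm l\<bar> * norm z"
        by (simp only: norm_vector_scalar_mult norm_of_real)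
      then show ?thesis using z l by simp
    qed
    then have "norm (l - ?x) \<le> (a + 1) * (1 - norm l)"
      using norm_triangle_ineq[of "l - z" "z - ?x"] dist by (simp add: dist_norm algebra_simps)
    also have "\<dots> \<le> (real N / 2) * (1 - norm l)" using N l by (intro mult_right_mono) auto
    finally show "Re (V l) \<le> 5 ^ N * Re (V ?x)"
      using N a z l by (intro harnack_chain[OF V pos, of "1 - norm l"]) auto
  qed
qed

section \<open>Integration against a rotation invariant measure\<close>

lemma orthogonal_measurable:
  "orthogonal_transformation U \<Longrightarrow> U \<in> measurable borel borel" for U :: "complex^'d \<Rightarrow> complex^'d"
  by (intro borel_measurable_continuous_onI linear_continuous_on)
    (simp add: orthogonal_transformation_def linear_conv_bounded_linear[symmetric])

text \<open>The measure lives on the Borel sets of the whole space and is concentrated on the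
  sphere. Functions and sets can thus be treated as Borel objects of C^d, and the sphere enters as
  an almost everywhere condition.\<close>

locale sphere_measure =
  fixes \<tau> :: "(complex^'d) measure"
  assumes prob: "prob_space \<tau>" and sets_tau [measurable_cong]: "sets \<tau> = sets borel"
    and sphere: "AE z in \<tau>. norm z = 1"
    and invariant: "\<And>U. orthogonal_transformation U \<Longrightarrow> distr \<tau> borel U = \<tau>"
begin

sublocale prob_space \<tau> by (rule prob)

lemma space_tau [simp]: "space \<tau> = UNIV"
  using sets_eq_imp_space_eq[OF sets_tau] by simp

lemma nn_integral_rotate:
  assumes U: "orthogonal_transformation U" and [measurable]: "f \<in> borel_measurable borel"
  shows "(\<integral>\<^sup>+z. f (U z) \<partial>\<tau>) = (\<integral>\<^sup>+z. f z \<partial>\<tau>)"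
proof -
  have [measurable]: "U \<in> measurable borel borel" by (rule orthogonal_measurable[OF U])
  have "(\<integral>\<^sup>+z. f z \<partial>distr \<tau> borel U) = (\<integral>\<^sup>+z. f (U z) \<partial>\<tau>)"
    by (rule nn_integral_distr) auto
  then show ?thesis by (simp add: invariant[OF U])
qed

text \<open>By invariance every rotation gives the same integral, so any probability weight
  \<open>p\<close> over the parameter may be inserted; Fubini then leaves an inner integral over one
  orbit, accessible to one-variable theory. Both a uniform weight and the Poisson kernel are
  used.\<close>

lemma nn_integral_rotate_average:
  assumes U: "\<And>t. orthogonal_transformation (U t)"
    and U_cont: "continuous_on UNIV (\<lambda>(t, z). U t z)"
    and f[measurable]: "f \<in> borel_measurable borel" and p[measurable]: "p \<in> borel_measurable borel"
    and p1: "(\<integral>\<^sup>+t. p t \<partial>lborel) = 1"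
  shows "(\<integral>\<^sup>+z. f z \<partial>\<tau>) = (\<integral>\<^sup>+z. (\<integral>\<^sup>+t. p t * f (U t z) \<partial>lborel) \<partial>\<tau>)"
proof -
  interpret P: pair_sigma_finite lborel \<tau> ..
  have [measurable]: "(\<lambda>(t, z). U t z) \<in> borel_measurable (borel \<Otimes>\<^sub>M borel)"
    using borel_measurable_continuous_onI[OF U_cont] by (simp add: borel_prod)
  have [measurable]: "U t \<in> borel_measurable borel" for t by (rule orthogonal_measurable[OF U])
  have "(\<integral>\<^sup>+z. f z \<partial>\<tau>) = (\<integral>\<^sup>+t. p t \<partial>lborel) * (\<integral>\<^sup>+z. f z \<partial>\<tau>)" by (simp add: p1)
  also have "\<dots> = (\<integral>\<^sup>+t. p t * (\<integral>\<^sup>+z. f (U t z) \<partial>\<tau>) \<partial>lborel)"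
    by (simp add: nn_integral_rotate[OF U f] nn_integral_multc)
  also have "\<dots> = (\<integral>\<^sup>+t. (\<integral>\<^sup>+z. p t * f (U t z) \<partial>\<tau>) \<partial>lborel)"
    by (intro nn_integral_cong nn_integral_cmult[symmetric]) measurable
  also have "\<dots> = (\<integral>\<^sup>+z. (\<integral>\<^sup>+t. p t * f (U t z) \<partial>lborel) \<partial>\<tau>)"
    by (rule P.Fubini'[symmetric]) measurable
  finally show ?thesis .
qed

lemma emeasure_rotate_average:
  fixes U :: "real \<Rightarrow> complex^'d \<Rightarrow> complex^'d"
  assumes U: "\<And>t. orthogonal_transformation (U t)"
    and U_cont: "continuous_on UNIV (\<lambda>(t, z). U t z)"
    and A[measurable]: "A \<in> sets borel"
  shows "emeasure \<tau> A = (\<integral>\<^sup>+z. emeasure lborel {t \<in> {0..1}. U t z \<in> A} \<partial>\<tau>)"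
proof -
  have m: "{t \<in> {0..1}. U t z \<in> A} \<in> sets borel" for z
  proof -
    have "continuous_on UNIV (\<lambda>t. U t z)"
      using continuous_on_compose2[OF U_cont, of UNIV "\<lambda>t. (t, z)"]
      by (simp add: continuous_on_Pair continuous_on_id)
    then have "(\<lambda>t. U t z) -` A \<inter> space borel \<in> sets borel"
      by (intro measurable_sets[OF borel_measurable_continuous_onI A])
    then have "{0..1} \<inter> ((\<lambda>t. U t z) -` A) \<in> sets borel"
      by (intro sets.Int) auto
    then show ?thesis by (simp add: vimage_def Int_def)
  qed
  have "emeasure \<tau> A = (\<integral>\<^sup>+z. indicator A z \<partial>\<tau>)" by (simp add: sets_tau A)
  also have "\<dots> = (\<integral>\<^sup>+z. (\<integral>\<^sup>+t. indicator {0..1} t * indicator A (U t z) \<partial>lborel) \<partial>\<tau>)"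
    by (rule nn_integral_rotate_average[OF U U_cont]) auto
  also have "\<dots> = (\<integral>\<^sup>+z. (\<integral>\<^sup>+t. indicator {t \<in> {0..1}. U t z \<in> A} t \<partial>lborel) \<partial>\<tau>)"
    by (intro nn_integral_cong) (simp add: indicator_def)
  also have "\<dots> = (\<integral>\<^sup>+z. emeasure lborel {t \<in> {0..1}. U t z \<in> A} \<partial>\<tau>)"
    using m by (intro nn_integral_cong nn_integral_indicator) simp
  finally show ?thesis .
qed

lemma emeasure_le_if_rotations_le:
  fixes U :: "real \<Rightarrow> complex^'d \<Rightarrow> complex^'d"
  assumes U: "\<And>t. orthogonal_transformation (U t)"
    and U_cont: "continuous_on UNIV (\<lambda>(t, z). U t z)"
    and A: "A \<in> sets borel"
    and le: "AE z in \<tau>. emeasure lborel {t \<in> {0..1}. U t z \<in> A} \<le> b"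
  shows "emeasure \<tau> A \<le> b"
proof -
  have "emeasure \<tau> A \<le> (\<integral>\<^sup>+z. b \<partial>\<tau>)"
    unfolding emeasure_rotate_average[OF U U_cont A] using le by (rule nn_integral_mono_AE)
  then show ?thesis using emeasure_space_1 by simp
qed

lemma circ_orthogonal: "orthogonal_transformation (\<lambda>z::complex^'d. circ t *s z)"
  by (rule orthogonal_scalar_mult) simp

lemma circ_mult_continuous: "continuous_on UNIV (\<lambda>(t, z::complex^'d). circ t *s z)"
  unfolding case_prod_beta by (intro continuous_intros)

lemma circ_mult_preimage_sets: "A \<in> sets borel \<Longrightarrow> {t \<in> {0..1}. circ t *s (z::complex^'d) \<in> A} \<in> sets borel"
proof -
  assume A: "A \<in> sets borel"
  have "(\<lambda>t. circ t *s z) -` A \<inter> space borel \<in> sets borel"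
    by (intro measurable_sets[OF borel_measurable_continuous_onI A] continuous_intros)
  then have "{0..1} \<inter> ((\<lambda>t. circ t *s z) -` A) \<in> sets borel"
      by (intro sets.Int) auto
  then show ?thesis by (simp add: vimage_def Int_def)
qed

lemma weak_type_dilate:
  assumes V: "ball_regular V" and pos: "\<And>z. z \<in> ball 0 1 \<Longrightarrow> 0 \<le> Re (V z)"
    and C: "C > 0" and s: "0 < s" "s < 1"
  defines "E \<equiv> {z. norm z = 1 \<and> (\<exists>r. 0 \<le> r \<and> r < s \<and> C < Re (V (of_real r *s z)))}"
  shows "E \<in> sets borel" "emeasure \<tau> E \<le> ennreal (10 / C * Re (V 0))"
proof -
  have cV: "continuous_on (ball 0 1) V" using V by (simp add: ball_regular_def)
  \<comment> \<open>The union over \<open>r\<close> is uncountable, so measurability of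
    \<open>E\<close> rests on openness. The ball of radius \<open>1 / s\<close> is an open
    neighbourhood of the sphere on which the dilates with \<open>r < s\<close> are still
    defined.\<close>
  define W where "W r = {z \<in> ball 0 (1 / s). C < Re (V (of_real r *s z))}" for r
  have openW: "open (W r)" if r: "0 \<le> r" "r < s" for r
  proof -
    have "continuous_on (ball 0 (1 / s)) (\<lambda>z. Re (V (of_real r *s z)))"
    proof (intro continuous_on_Re continuous_on_compose2[OF cV] continuous_intros)
      have "r * norm z < 1" if "norm z < 1 / s" for z :: "complex^'d"
      proof -
        have "r * norm z \<le> s * norm z" using r by (intro mult_right_mono) auto
        also have "\<dots> < 1" using that s by (simp add: field_simps)
        finally show ?thesis .
      qed
      then show "(\<lambda>z::complex^'d. of_real r *s z) ` ball 0 (1 / s) \<subseteq> ball 0 1"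
        using r by auto
    qed
    from continuous_open_preimage[OF this open_ball open_greaterThan, of C]
    have "open (ball 0 (1 / s) \<inter> (\<lambda>z. Re (V (of_real r *s z))) -` {C<..})" .
    moreover have "ball 0 (1 / s) \<inter> (\<lambda>z. Re (V (of_real r *s z))) -` {C<..} = W r"
      by (auto simp: W_def)
    ultimately show ?thesis by simp
  qed
  have "E = sphere 0 1 \<inter> (\<Union>r\<in>{0..<s}. W r)"
    using s by (auto simp: E_def W_def)
  moreover have "open (\<Union>r\<in>{0..<s}. W r)" using openW by auto
  ultimately show Em: "E \<in> sets borel" by simp
  have "emeasure lborel {t \<in> {0..1}. circ t *s z \<in> E} \<le> ennreal (10 / C * Re (V 0))" if z: "norm z = 1" for z
  proof -
    have "emeasure lborel {t \<in> {0..1}. circ t *s z \<in> E} \<le> ennreal (10 / C * Re (V (0 *s z)))"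
    proof (rule disc_weak_type[OF ball_regular_slice[OF V z] _ C s])
      show "0 \<le> Re (V (u *s z))" if "cmod u < 1" for u using that z by (intro pos) simp
      show "{t \<in> {0..1}. circ t *s z \<in> E} \<in> sets lborel" using circ_mult_preimage_sets[OF Em] by simp
      fix a assume "a \<in> {t \<in> {0..1}. circ t *s z \<in> E}"
      then show "\<exists>r\<ge>0. r < s \<and> C < Re (V ((of_real r * circ a) *s z))"
        by (auto simp: E_def vector_smult_assoc)
    qed auto
    then show ?thesis by simp
  qed
  then show "emeasure \<tau> E \<le> ennreal (10 / C * Re (V 0))"
    using sphere by (intro emeasure_le_if_rotations_le[OF circ_orthogonal circ_mult_continuous Em]) auto
qed

lemma radial_weak_type:
  assumes V: "ball_regular V" and pos: "\<And>z. z \<in> ball 0 1 \<Longrightarrow> 0 \<le> Re (V z)" and C: "C > 0"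
  defines "E \<equiv> {z. norm z = 1 \<and> (\<exists>r. 0 \<le> r \<and> r < 1 \<and> C < Re (V (of_real r *s z)))}"
  shows "E \<in> sets borel" "emeasure \<tau> E \<le> ennreal (10 / C * Re (V 0))"
proof -
  note s = radii(1,2) and s_lim = radii(3)
  define F where "F n = {z. norm z = 1 \<and> (\<exists>r. 0 \<le> r \<and> r < radii n \<and> C < Re (V (of_real r *s z)))}" for n
  note F = weak_type_dilate[OF V pos C s, folded F_def]
  have E: "E = (\<Union>n. F n)"
  proof -
    have "\<exists>n. r < radii n" if "r < 1" for r
      using order_tendstoD(1)[OF s_lim that] by (auto simp: eventually_sequentially)
    then have "E \<subseteq> (\<Union>n. F n)" unfolding E_def F_def by blast
    moreover have "F n \<subseteq> E" for n
      unfolding E_def F_def using s(2)[of n] by (auto intro: less_trans)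
    ultimately show ?thesis by blast
  qed
  show "E \<in> sets borel" unfolding E using F(1) by auto
  have "incseq F"
  proof (rule incseq_SucI)
    fix n
    have "radii n \<le> radii (Suc n)" by (simp add: radii_def frac_le)
    then show "F n \<le> F (Suc n)" unfolding F_def by (auto intro: less_le_trans)
  qed
  then have "emeasure \<tau> E = (SUP n. emeasure \<tau> (F n))"
    unfolding E using F(1) by (intro SUP_emeasure_incseq[symmetric]) (auto simp: sets_tau)
  also have "\<dots> \<le> ennreal (10 / C * Re (V 0))" by (rule SUP_least) (rule F(2))
  finally show "emeasure \<tau> E \<le> ennreal (10 / C * Re (V 0))" .
qed

text \<open>The Poisson kernel is a probability weight with mean V(r z) on the circle of radius
  \<open>s\<close>; the claim is that the variance is nonnegative.\<close>

lemma slice_jensen: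
  assumes V: "ball_regular V" and z: "norm z = 1" and r: "0 \<le> r" "r < s" "s < 1"
  shows "ennreal ((cmod (V (of_real r *s z)))\<^sup>2)
    \<le> (\<integral>\<^sup>+t. ennreal (indicator {0..1} t * poisson (r / s) t)
        * ennreal ((cmod (V (of_real s *s (circ t *s z))))\<^sup>2) \<partial>lborel)"
proof -
  let ?P = "poisson (r / s)" and ?F = "\<lambda>t. V (of_real s *s (circ t *s z))"
  define m where "m = V (of_real r *s z)"
  have rs: "0 \<le> r / s" "r / s < 1" using r by auto
  have cV: "continuous_on (ball 0 1) V" using V by (simp add: ball_regular_def)
  have cF: "continuous_on S ?F" for S
    by (intro continuous_on_compose2[OF cV] continuous_intros) (use r z in \<open>auto simp: norm_mult\<close>)
  have F: "((\<lambda>t. of_real (?P t) * ?F t) has_integral m) {0..1}"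
    using poisson_dilate[OF ball_regular_slice[OF V z] r, of 1]
    by (simp add: m_def vector_smult_assoc)
  have "((\<lambda>t. Re (cnj m * (of_real (?P t) * ?F t))) has_integral Re (cnj m * m)) {0..1}"
    using has_integral_linear[OF has_integral_mult_right[OF F, of "cnj m"] bounded_linear_Re] by (simp add: o_def)
  from has_integral_mult_right[OF this, of 2]
  have "((\<lambda>t. 2 * Re (cnj m * (of_real (?P t) * ?F t))) has_integral 2 * Re (cnj m * m)) {0..1}" .
  moreover have "Re (cnj m * m) = (cmod m)\<^sup>2" unfolding cmod_power2 by (simp add: power2_eq_square)
  ultimately have "((\<lambda>t. 2 * Re (cnj m * (of_real (?P t) * ?F t))) has_integral 2 * (cmod m)\<^sup>2) {0..1}"
    by (simp only:)
  then have I1: "((\<lambda>t. ?P t * (2 * Re (cnj m * ?F t))) has_integral 2 * (cmod m)\<^sup>2) {0..1}"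
    by (rule has_integral_eq[rotated]) (simp add: algebra_simps)
  have I2: "((\<lambda>t. ?P t * (cmod m)\<^sup>2) has_integral (cmod m)\<^sup>2) {0..1}"
    using has_integral_mult_left[OF poisson_integral[OF rs], of "(cmod m)\<^sup>2"] by simp
  have I3: "((\<lambda>t. ?P t * (cmod (?F t))\<^sup>2) has_integral integral {0..1} (\<lambda>t. ?P t * (cmod (?F t))\<^sup>2)) {0..1}"
    by (intro integrable_integral integrable_continuous_real continuous_intros rs cF)
  have "2 * (cmod m)\<^sup>2 - (cmod m)\<^sup>2 \<le> integral {0..1} (\<lambda>t. ?P t * (cmod (?F t))\<^sup>2)"
  proof (rule has_integral_le[OF has_integral_diff[OF I1 I2] I3])
    fix t :: real
    have "0 \<le> (cmod (?F t - m))\<^sup>2" by simp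
    also have "\<dots> = (cmod (?F t))\<^sup>2 - 2 * Re (cnj m * ?F t) + (cmod m)\<^sup>2"
      unfolding cmod_power2 by (simp add: algebra_simps power2_eq_square)
    finally have "?P t * (2 * Re (cnj m * ?F t) - (cmod m)\<^sup>2) \<le> ?P t * (cmod (?F t))\<^sup>2"
      using poisson_bounds(3)[OF rs] by (intro mult_left_mono) auto
    then show "?P t * (2 * Re (cnj m * ?F t)) - ?P t * (cmod m)\<^sup>2 \<le> ?P t * (cmod (?F t))\<^sup>2"
      by (simp only: right_diff_distrib)
  qed
  then have "ennreal ((cmod m)\<^sup>2) \<le> ennreal (integral {0..1} (\<lambda>t. ?P t * (cmod (?F t))\<^sup>2))"
    by (intro ennreal_leI) simp
  also have "\<dots> = (\<integral>\<^sup>+t. ennreal (indicator {0..1} t * (?P t * (cmod (?F t))\<^sup>2)) \<partial>lborel)"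
    by (rule nn_integral_has_integral_lebesgue[OF _ I3, symmetric])
      (simp add: poisson_bounds(3)[OF rs])
  also have "\<dots> = (\<integral>\<^sup>+t. ennreal (indicator {0..1} t * ?P t) * ennreal ((cmod (?F t))\<^sup>2) \<partial>lborel)"
    by (intro nn_integral_cong, subst ennreal_mult[symmetric])
      (auto simp: poisson_bounds(3)[OF rs] mult.assoc)
  finally show ?thesis by (simp add: m_def)
qed

text \<open>\<open>slice_jensen\<close> integrated over the sphere; averaging over rotations with
  the Poisson kernel as weight removes the inner integral.\<close>

lemma square_means_mono:
  assumes V: "ball_regular V" and [measurable]: "V \<in> borel_measurable borel"
    and r: "0 \<le> r" "r < s" "s < 1"
  shows "(\<integral>\<^sup>+z. ennreal ((cmod (V (of_real r *s z)))\<^sup>2) \<partial>\<tau>)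
    \<le> (\<integral>\<^sup>+z. ennreal ((cmod (V (of_real s *s z)))\<^sup>2) \<partial>\<tau>)"
proof -
  let ?P = "poisson (r / s)"
  have rs: "0 \<le> r / s" "r / s < 1" using r by auto
  have [measurable]: "(\<lambda>z::complex^'d. c *s z) \<in> borel_measurable borel" for c
    by (intro borel_measurable_continuous_onI continuous_intros)
  have [measurable]: "?P \<in> borel_measurable borel"
    by (intro borel_measurable_continuous_onI continuous_intros rs)
  have "(\<integral>\<^sup>+z. ennreal ((cmod (V (of_real r *s z)))\<^sup>2) \<partial>\<tau>)
    \<le> (\<integral>\<^sup>+z. (\<integral>\<^sup>+t. ennreal (indicator {0..1} t * ?P t)
        * ennreal ((cmod (V (of_real s *s (circ t *s z))))\<^sup>2) \<partial>lborel) \<partial>\<tau>)"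
    by (rule nn_integral_mono_AE, use sphere in eventually_elim) (rule slice_jensen[OF V _ r])
  also have "\<dots> = (\<integral>\<^sup>+z. ennreal ((cmod (V (of_real s *s z)))\<^sup>2) \<partial>\<tau>)"
  proof (rule nn_integral_rotate_average[symmetric, OF circ_orthogonal circ_mult_continuous])
    show "(\<integral>\<^sup>+t. ennreal (indicator {0..1} t * ?P t) \<partial>lborel) = 1"
      using nn_integral_has_integral_lebesgue[OF _ poisson_integral[OF rs]]
        poisson_bounds(3)[OF rs] by simp
  qed measurable
  finally show ?thesis .
qed

section \<open>Zero sets of dilates and of boundary values\<close>

lemma circ_fibre_finite: "finite {t \<in> {0..1}. circ t = u}"
proof (cases "\<exists>t0. circ t0 = u")
  case True
  then obtain t0 where t0: "circ t0 = u" by blast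
  have "{t \<in> {0..1}. circ t = u} \<subseteq> (\<lambda>n. t0 + of_int n) ` {\<lfloor>- t0\<rfloor>..\<lceil>1 - t0\<rceil>}"
  proof
    fix t assume "t \<in> {t \<in> {0..1}. circ t = u}"
    then have t: "0 \<le> t" "t \<le> 1" "circ t = circ t0" using t0 by auto
    from t(3) obtain n :: int where "2 * of_real pi * \<i> * of_real t = 2 * of_real pi * \<i> * of_real t0 + of_real (of_int (2 * n) * pi) * \<i>"
      unfolding circ_def exp_eq by blast
    then have "(2 * of_real pi * \<i>) * (of_real t :: complex) = (2 * of_real pi * \<i>) * of_real (t0 + of_int n)"
      by (simp add: algebra_simps)
    then have "t = t0 + of_int n" by (simp only: mult_cancel_left of_real_eq_iff) auto
    moreover have "\<lfloor>- t0\<rfloor> \<le> n" "n \<le> \<lceil>1 - t0\<rceil>" using t calculation by linarith+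
    ultimately show "t \<in> (\<lambda>n. t0 + of_int n) ` {\<lfloor>- t0\<rfloor>..\<lceil>1 - t0\<rceil>}" by auto
  qed
  then show ?thesis by (rule finite_subset) simp
next
  case False
  then have "{t \<in> {0..1}. circ t = u} = {}" by auto
  then show ?thesis by (simp only: finite.emptyI)
qed

text \<open>Since \<open>rotation\<close> is affine in its first argument, the orbit extends to a
  complex line, on which \<open>V\<close> is holomorphic near the closed unit disc. Being nonzero at
  \<open>c\<close>, it has finitely many zeros there.\<close>

lemma rotated_zeros_null:
  assumes V: "ball_regular V" and v: "norm v = 1" and z: "norm z = 1" and r: "0 \<le> r" "r < 1"
    and c: "cmod c = 1" "V (of_real r *s rotation c v z) \<noteq> 0"
  shows "emeasure lborel {t \<in> {0..1}. V (of_real r *s rotation (circ t) v z) = 0} = 0"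
proof -
  define x where "x = of_real r *s (z - herm z v *s v)"
  define y where "y = (of_real r * herm z v) *s v"
  have xy: "of_real r *s rotation u v z = x + u *s y" for u
    by (simp add: rotation_def x_def y_def vec_eq_iff algebra_simps)
  define S where "S = {u. x + u *s y \<in> ball 0 1}"
  define g where "g u = V (x + u *s y)" for u
  have g: "g holomorphic_on S" using V unfolding ball_regular_def g_def S_def by blast
  have openS: "open S" unfolding S_def by (rule open_line_ball)
  have "linear (\<lambda>u. u *s y)"
    by (rule linearI) (simp_all add: vec_eq_iff algebra_simps)
  moreover have "S = (\<lambda>u. u *s y) -` ((\<lambda>w. w - x) ` ball 0 1)"
    unfolding S_def by (auto simp: image_iff algebra_simps)
  ultimately have convS: "convex S"
    using convex_linear_vimage convex_translation_subtract[OF convex_ball] by metis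
  have sph: "u \<in> S" if "cmod u = 1" for u
    unfolding S_def mem_Collect_eq xy[symmetric]
    using norm_rotation[OF that v] r z by (simp only: mem_ball_0 norm_vector_scalar_mult) simp
  \<comment> \<open>\<open>S\<close> is convex and contains the unit circle; a point of the disc is
    a convex combination of two antipodal points of the circle.\<close>
  have ball: "cball 0 1 \<subseteq> S"
  proof
    fix u :: complex assume u: "u \<in> cball 0 1"
    define e where "e = (if u = 0 then 1 else sgn u)"
    have e: "cmod e = 1" "u = of_real (cmod u) * e" by (auto simp: e_def norm_divide sgn_eq)
    have "((1 + cmod u) / 2) *\<^sub>R e + ((1 - cmod u) / 2) *\<^sub>R (- e) \<in> S"
      using u e(1) by (intro convexD[OF convS sph sph]) (auto simp: field_simps)
    moreover have "((1 + cmod u) / 2) *\<^sub>R e + ((1 - cmod u) / 2) *\<^sub>R (- e) = of_real (cmod u) * e"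
      by (simp add: scaleR_conv_of_real field_simps)
    ultimately show "u \<in> S" using e(2) by simp
  qed
  have "finite {u \<in> cball 0 1. g u = 0}"
  proof (cases "g constant_on S")
    case True
    have "c \<in> S" using ball c(1) by auto
    then have "g u = g c" if "u \<in> cball 0 1" for u
      using True ball that unfolding constant_on_def by (metis subsetD)
    moreover have "g c \<noteq> 0" using c(2) by (simp add: xy g_def)
    ultimately have "{u \<in> cball 0 1. g u = 0} = {}" by auto
    then show ?thesis by (simp only: finite.emptyI)
  next
    case False
    show ?thesis
      by (rule holomorphic_compact_finite_zeros[OF g openS convex_connected[OF convS] compact_cball ball False])
  qed
  then have "finite (\<Union>u\<in>{u \<in> cball 0 1. g u = 0}. {t \<in> {0..1}. circ t = u})"
    using circ_fibre_finite by blast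
  then have "finite {t \<in> {0..1}. V (of_real r *s rotation (circ t) v z) = 0}"
    by (rule rev_finite_subset) (auto simp: xy g_def)
  then show ?thesis by (rule null_setsD1[OF finite_imp_null_set_lborel])
qed

text \<open>The zero set \<open>A\<close> agrees, up to null sets, with the set of points whose whole orbit under the
  rotations about a fixed axis \<open>v\<close> lies in \<open>A\<close>. For a countable dense set of axes these orbits fill the sphere.\<close>

lemma dilated_zeros_null:
  assumes V: "ball_regular V" and r: "0 \<le> r" "r < 1" and w: "norm w = 1" "V (of_real r *s w) \<noteq> 0"
  shows "AE z in \<tau>. V (of_real r *s z) \<noteq> 0"
proof -
  define A where "A = {z \<in> sphere 0 1. V (of_real r *s z) = 0}"
  have cV: "continuous_on (ball 0 1) V" using V by (simp add: ball_regular_def)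
  have "continuous_on (sphere 0 1) (\<lambda>z. V (of_real r *s z))"
    by (rule continuous_on_compose2[OF cV]) (use r in \<open>auto intro!: continuous_intros\<close>)
  then have closedA: "closed A"
    unfolding A_def using continuous_closed_preimage_constant[of "sphere 0 1" _ 0] closed_sphere by blast
  define R where "R v = {z. \<forall>c\<in>sphere 0 1. rotation c v z \<in> A}" for v
  have contR: "continuous_on S (\<lambda>z. rotation c v z)" for c v and S :: "(complex^'d) set"
    unfolding rotation_def by (intro continuous_intros)
  have closedR: "closed (R v)" for v
  proof -
    have "R v = (\<Inter>c\<in>sphere 0 1. (\<lambda>z. rotation c v z) -` A)" by (auto simp: R_def)
    moreover have "closed ((\<lambda>z. rotation c v z) -` A)" for c
      using closed_vimage[OF closedA contR] by simp
    ultimately show ?thesis by auto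
  qed
  have RA: "R v \<subseteq> A" for v unfolding R_def by (auto dest: bspec[of _ _ 1] simp: rotation_def)
  have null: "emeasure \<tau> (A - R v) = 0" if v: "norm v = 1" for v
  proof -
    have Am: "A \<in> sets \<tau>" "R v \<in> sets \<tau>" using closedA closedR by (auto simp: sets_tau)
    have U_cont: "continuous_on UNIV (\<lambda>(t, z). rotation (circ t) v z)"
      unfolding case_prod_beta rotation_def by (intro continuous_intros)
    have "emeasure \<tau> A = (\<integral>\<^sup>+z. emeasure lborel {t \<in> {0..1}. rotation (circ t) v z \<in> A} \<partial>\<tau>)"
      using v closedA by (intro emeasure_rotate_average orthogonal_rotation U_cont) auto
    \<comment> \<open>An alternative of zero or full measure: by \<open>rotated_zeros_null\<close>
      the orbit of \<open>z\<close> spends no time in \<open>A\<close> unless it lies in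
      \<open>A\<close> entirely.\<close>
    also have "\<dots> \<le> (\<integral>\<^sup>+z. indicator (R v) z \<partial>\<tau>)"
    proof (rule nn_integral_mono_AE, use sphere in eventually_elim)
      fix z :: "complex^'d" assume z: "norm z = 1"
      show "emeasure lborel {t \<in> {0..1}. rotation (circ t) v z \<in> A} \<le> indicator (R v) z"
      proof (cases "z \<in> R v")
        case True
        have "emeasure lborel {t \<in> {0..1}. rotation (circ t) v z \<in> A} \<le> emeasure lborel {0..1::real}"
          by (intro emeasure_mono) auto
        then show ?thesis using True by simp
      next
        case False
        then obtain c where c: "cmod c = 1" "rotation c v z \<notin> A" by (auto simp: R_def)
        have n: "norm (rotation c v z) = 1" if "cmod c = 1" for c
          using norm_rotation[OF that v] z by simp
        have "{t \<in> {0..1}. rotation (circ t) v z \<in> A}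
          = {t \<in> {0..1}. V (of_real r *s rotation (circ t) v z) = 0}"
          using n by (auto simp: A_def)
        moreover have "V (of_real r *s rotation c v z) \<noteq> 0" using c n by (auto simp: A_def)
        ultimately show ?thesis using rotated_zeros_null[OF V v z r c(1)] by simp
      qed
    qed
    also have "\<dots> = emeasure \<tau> (R v)" using Am by simp
    finally have "emeasure \<tau> A \<le> emeasure \<tau> (R v)" .
    then show ?thesis using emeasure_Diff[OF _ Am RA] emeasure_finite[of A]
      by (simp add: diff_eq_0_iff_ennreal less_top[symmetric])
  qed
  obtain D where D: "countable D" "D \<subseteq> sphere 0 1" "sphere 0 (1::real) \<subseteq> closure (D :: (complex^'d) set)"
    using separable[of "sphere 0 1"] by metis
  have "(\<Union>v\<in>D. A - R v) \<in> null_sets \<tau>"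
  proof (rule null_sets_UN'[OF D(1)])
    fix v assume "v \<in> D"
    then show "A - R v \<in> null_sets \<tau>"
      using null[of v] D(2) closedA closedR by (auto simp: null_sets_def sets_tau)
  qed
  moreover have "A \<subseteq> (\<Union>v\<in>D. A - R v)"
  proof (rule ccontr)
    assume "\<not> A \<subseteq> (\<Union>v\<in>D. A - R v)"
    then obtain z where z: "z \<in> A" "\<And>v. v \<in> D \<Longrightarrow> z \<in> R v" by auto
    obtain c v where cv: "cmod c = 1" "norm v = 1" "rotation c v z = w"
      using rotation_transitive[of z w] z(1) w(1) by (auto simp: A_def)
    \<comment> \<open>The axis \<open>v\<close> carrying \<open>z\<close> to \<open>w\<close> need
      not belong to \<open>D\<close>. With \<open>c\<close> fixed, the condition is closed in
      \<open>v\<close>, so it passes from \<open>D\<close> to the whole sphere and would make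
      \<open>V\<close> vanish at \<open>r\<close> times \<open>w\<close>.\<close>
    have "closed ((\<lambda>v. rotation c v z) -` A)"
      by (rule closed_vimage[OF closedA]) (unfold rotation_def, intro continuous_intros)
    moreover have "D \<subseteq> (\<lambda>v. rotation c v z) -` A" using z(2) cv(1) by (auto simp: R_def)
    ultimately have "closure D \<subseteq> (\<lambda>v. rotation c v z) -` A" by (rule closure_minimal[rotated])
    then have "w \<in> A" using D(3) cv by auto
    then show False using w by (simp add: A_def)
  qed
  moreover have "A \<in> sets \<tau>" using closedA by (simp add: sets_tau)
  ultimately have "A \<in> null_sets \<tau>" using null_sets_subset by blast
  then have "AE z in \<tau>. z \<notin> A" by (rule AE_not_in)
  then show ?thesis using sphere by eventually_elim (auto simp: A_def)
qed

text \<open>A radius at which \<open>V\<close> does not vanish identically exists because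
  \<open>V\<close> is nonzero at \<open>z0\<close>. By \<open>dilated_zeros_null\<close> almost
  every slice is nonzero at that radius, and there \<open>radial_zeros_null\<close> excludes zero
  limits in almost all directions.\<close>

lemma boundary_values_nonzero:
  assumes V: "ball_regular V" and V_meas: "V \<in> borel_measurable borel"
    and bd: "\<And>z. z \<in> ball 0 1 \<Longrightarrow> cmod (V z) \<le> 1"
    and nz: "z0 \<in> ball 0 1" "V z0 \<noteq> 0"
    and s: "\<And>n. s n < 1" "s \<longlonglongrightarrow> 1"
  shows "AE z in \<tau>. \<not> (\<lambda>n::nat. V (of_real (s n) *s z)) \<longlonglongrightarrow> 0"
proof -
  obtain w r where w: "norm w = 1" and r: "0 \<le> r" "r < 1" and rw: "V (of_real r *s w) \<noteq> 0"
  proof (cases "z0 = 0")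
    case True
    obtain w :: "complex^'d" where "norm w = 1" using vector_choose_size[of 1] by auto
    then show ?thesis using that[of w 0] True nz by simp
  next
    case False
    define w where "w = of_real (1 / norm z0) *s z0"
    have "norm w = 1" unfolding w_def norm_vector_scalar_mult using False by (simp add: norm_divide)
    moreover have "of_real (norm z0) *s w = z0" using False by (simp add: w_def vec_eq_iff)
    ultimately show ?thesis using that[of w "norm z0"] nz by simp
  qed
  \<comment> \<open>\<open>radial_zeros_null\<close> needs radii bounded away from \<open>r\<close>;
    the midpoint of \<open>r\<close> and 1 is taken as the bound, and the sequence is shifted by
    \<open>n0\<close>.\<close>
  obtain n0 where n0: "\<And>n. n \<ge> n0 \<Longrightarrow> (r + 1) / 2 < s n"
    using order_tendstoD(1)[OF s(2), of "(r + 1) / 2"] r by (auto simp: eventually_sequentially)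
  define A where "A = {z. (\<lambda>n. V (of_real (s n) *s z)) \<longlonglongrightarrow> 0}"
  have [measurable]: "(\<lambda>z. V (of_real (s n) *s z)) \<in> borel_measurable borel" for n
    by (rule measurable_compose[OF _ V_meas])
      (intro borel_measurable_continuous_onI continuous_intros)
  \<comment> \<open>Countable quantifiers make the set measurable.\<close>
  have A_eq: "A = {z. \<forall>m::nat. \<exists>N::nat. \<forall>n\<ge>N. cmod (V (of_real (s n) *s z)) < 1 / real (Suc m)}" (is "_ = ?B")
  proof (intro equalityI subsetI)
    fix z assume "z \<in> A"
    then show "z \<in> ?B"
      using LIMSEQ_D[of "\<lambda>n. V (of_real (s n) *s z)" 0] by (simp add: A_def)
  next
    fix z assume z: "z \<in> ?B"
    have "\<exists>N. \<forall>n\<ge>N. cmod (V (of_real (s n) *s z) - 0) < e" if e: "0 < e" for e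
    proof -
      obtain m where m: "1 / real (Suc m) < e" using nat_approx_posE[OF e] by blast
      obtain N where "\<forall>n\<ge>N. cmod (V (of_real (s n) *s z)) < 1 / real (Suc m)" using z by blast
      then show ?thesis using m by (intro exI[of _ N]) (auto intro: less_trans)
    qed
    then show "z \<in> A" unfolding A_def mem_Collect_eq by (rule LIMSEQ_I)
  qed
  have Am: "A \<in> sets borel" unfolding A_eq by measurable
  have "AE z in \<tau>. emeasure lborel {t \<in> {0..1}. circ t *s z \<in> A} \<le> 0"
    using sphere dilated_zeros_null[OF V r w rw]
  proof eventually_elim
    fix z :: "complex^'d" assume z: "norm z = 1" and rz: "V (of_real r *s z) \<noteq> 0"
    have "emeasure lborel {t \<in> {0..1}. circ t *s z \<in> A} = 0"
    proof (rule radial_zeros_null[OF ball_regular_slice[OF V z], of r "(r + 1) / 2" "\<lambda>n. s (n + n0)"])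
      show "cmod (V (u *s z)) \<le> 1" if "u \<in> ball 0 1" for u using that z by (intro bd) simp
      show "{t \<in> {0..1}. circ t *s z \<in> A} \<in> sets lborel" using circ_mult_preimage_sets[OF Am] by simp
      show "(\<lambda>n. V ((of_real (s (n + n0)) * circ a) *s z)) \<longlonglongrightarrow> 0"
        if "a \<in> {t \<in> {0..1}. circ t *s z \<in> A}" for a
      proof -
        have "(\<lambda>n. V (of_real (s n) *s (circ a *s z))) \<longlonglongrightarrow> 0" using that by (simp add: A_def)
        then have "(\<lambda>n. V (of_real (s (n + n0)) *s (circ a *s z))) \<longlonglongrightarrow> 0" by (rule LIMSEQ_ignore_initial_segment)
        then show ?thesis by (simp add: vector_smult_assoc)
      qed
    qed (use r rz s n0 in \<open>auto simp: less_imp_le\<close>)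
    then show "emeasure lborel {t \<in> {0..1}. circ t *s z \<in> A} \<le> 0" by simp
  qed
  then have "emeasure \<tau> A \<le> 0"
    by (rule emeasure_le_if_rotations_le[OF circ_orthogonal circ_mult_continuous Am])
  then have "A \<in> null_sets \<tau>" using Am by (simp add: null_sets_def sets_tau)
  from AE_not_in[OF this] show ?thesis by (simp add: A_def)
qed

end

section \<open>Nontangential limits\<close>

definition stolz :: "real \<Rightarrow> complex^'d \<Rightarrow> (complex^'d) set" where
  "stolz a z = {l \<in> ball 0 1. dist l z < a * (1 - norm l)}"

lemma radial_in_stolz:
  assumes a: "1 < a" and z: "norm z = 1"
  shows "filterlim (\<lambda>n. of_real (radii n) *s z) (at z within stolz a z) sequentially"
proof -
  have dist: "dist (of_real (radii n) *s z) z = 1 - radii n" for n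
  proof -
    have "of_real (radii n) *s z - z = of_real (radii n - 1) *s z" by (simp add: vec_eq_iff algebra_simps)
    then have "norm (of_real (radii n) *s z - z) = \<bar>radii n - 1\<bar> * norm z"
      by (simp only: norm_vector_scalar_mult norm_of_real)
    then show ?thesis using radii(2)[of n] z by (simp add: dist_norm)
  qed
  have "(\<lambda>n. dist (of_real (radii n) *s z) z) \<longlonglongrightarrow> 0"
    unfolding dist using tendsto_diff[OF tendsto_const[of 1] radii(3)] by simp
  then have "(\<lambda>n. of_real (radii n) *s z) \<longlonglongrightarrow> z" by (rule tendsto_dist_iff[THEN iffD2])
  moreover have "of_real (radii n) *s z \<in> stolz a z" for n
    using radii(1,2)[of n] z a dist[of n] by (simp add: stolz_def)
  moreover have "of_real (radii n) *s z \<noteq> z" for n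
    using dist[of n] radii(2)[of n] by auto
  ultimately show ?thesis by (simp add: filterlim_at)
qed

lemma at_stolz_nontrivial: "1 < a \<Longrightarrow> norm z = 1 \<Longrightarrow> at z within stolz a z \<noteq> bot"
  using radial_in_stolz[of a z] unfolding filterlim_def
  by (metis bot.extremum_uniqueI filtermap_bot_iff sequentially_bot)

section \<open>Boundary behaviour of multiplication on normalized kernels\<close>

locale np_rkhs_sphere = np_rkhs H ip k + sphere_measure \<tau>
  for H :: "(complex^'d \<Rightarrow> complex) set" and ip k and \<tau> :: "(complex^'d) measure"
begin

lemma mem_regular: "f \<in> H \<Longrightarrow> ball_regular f"
  by (intro ball_regular_analytic analytic)

lemma mem_measurable: "f \<in> H \<Longrightarrow> f \<in> borel_measurable borel"
proof -
  assume f: "f \<in> H"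
  have "continuous_on (ball 0 1) f" using mem_regular[OF f] by (simp add: ball_regular_def)
  then have "(\<lambda>x. indicator (ball 0 1) x *\<^sub>R f x) \<in> borel_measurable borel"
    by (intro borel_measurable_continuous_on_indicator) auto
  moreover have "(\<lambda>x. indicator (ball 0 1) x *\<^sub>R f x) = f"
    using off_ball[OF f] by (auto simp: fun_eq_iff indicator_def)
  ultimately show ?thesis by simp
qed

lemma nrm_kernel_pos: "l \<in> ball 0 1 \<Longrightarrow> 0 < nrm (k l)"
  using kap_pos[of l] nrm_nonneg[OF kernel_mem, of l] by (auto simp: kap_def less_le)

text \<open>A positive pluriharmonic majorant of \<open>\<parallel>k\<^sub>l f\<parallel>\<^sup>2 / \<parallel>k\<^sub>l\<parallel>\<^sup>2\<close> with value \<open>\<parallel>f\<parallel>\<^sup>2\<close> at the origin.\<close>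

definition sarason :: "(complex^'d \<Rightarrow> complex) \<Rightarrow> complex^'d \<Rightarrow> complex" where
  "sarason f l = 2 * ip f (k l * f) + (- of_real ((nrm f)\<^sup>2))"

lemma sarason_regular: "f \<in> H \<Longrightarrow> ball_regular (sarason f)"
  unfolding sarason_def by (intro ball_regular_intros ip_kernel_times_regular)

lemma sarason_majorant:
  assumes "f \<in> H" "l \<in> ball 0 1"
  shows "(nrm (k l * f) / nrm (k l))\<^sup>2 \<le> Re (sarason f l)"
  using kernel_times_sarason[OF assms(2,1)] kap_pos[OF assms(2)]
  by (simp add: sarason_def kap_def power_divide field_simps)

lemma sarason_nonneg: "f \<in> H \<Longrightarrow> l \<in> ball 0 1 \<Longrightarrow> 0 \<le> Re (sarason f l)"
  using sarason_majorant order_trans zero_le_power2 by blast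

lemma sarason_0:
  assumes f: "f \<in> H"
  shows "Re (sarason f 0) = (nrm f)\<^sup>2"
proof -
  have "k 0 * f = f" using kernel_0 off_ball[OF f] by (fastforce simp: fun_eq_iff)
  then show ?thesis by (simp add: sarason_def nrm_sq[OF f])
qed

text \<open>Upgrades convergence of norms to convergence of vectors. In the expanded square the
  reproducing property turns the cross term into 2 Re(\<open>cnj (p z)\<close> p(l)), so by
  continuity the three terms tend to |p(z)|^2, -2 |p(z)|^2 and |p(z)|^2.\<close>

lemma continuous_multiplier_limit:
  assumes pc: "continuous_on (cball 0 1) p" and pH: "on_ball p \<in> H" and z: "norm z = 1"
    and lim: "((\<lambda>l. nrm (p * k l) / nrm (k l)) \<longlongrightarrow> cmod (p z)) (at z within ball 0 1)"
  shows "((\<lambda>l. nrm (k l * on_ball p - p z \<odot> k l) / nrm (k l)) \<longlongrightarrow> 0) (at z within ball 0 1)"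
proof -
  have eq: "(nrm (k l * on_ball p - p z \<odot> k l) / nrm (k l))\<^sup>2
      = (nrm (p * k l) / nrm (k l))\<^sup>2 - 2 * Re (cnj (p z) * p l) + (cmod (p z))\<^sup>2" if l: "l \<in> ball 0 1" for l
  proof -
    have pk: "p * k l = k l * on_ball p"
      using off_ball[OF kernel_mem[OF l]] by (auto simp: fun_eq_iff on_ball_def)
    note m = kernel_times_mem[OF l pH] and kH = kernel_mem[OF l]
    have n: "(nrm (k l))\<^sup>2 > 0" using nrm_kernel_pos[OF l] by simp
    have "ip (k l * on_ball p) (k l) = of_real ((nrm (k l))\<^sup>2) * p l"
      using reproducing[OF m l] l kernel_diag[OF l] by (simp add: on_ball_def)
    then have "Re (ip (k l * on_ball p) (p z \<odot> k l)) = (nrm (k l))\<^sup>2 * Re (cnj (p z) * p l)"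
      using ip_smult_right[OF kH m, of "p z"] Re_of_real_mult[of "(nrm (k l))\<^sup>2" "cnj (p z) * p l"]
      by (simp only: mult_ac)
    then have "(nrm (k l * on_ball p - p z \<odot> k l))\<^sup>2
      = (nrm (p * k l))\<^sup>2 - 2 * ((nrm (k l))\<^sup>2 * Re (cnj (p z) * p l)) + (cmod (p z))\<^sup>2 * (nrm (k l))\<^sup>2"
      unfolding pk by (simp only: nrm_diff_sq[OF m smult_mem[OF kH]] nrm_smult[OF kH] power_mult_distrib)
    then show ?thesis using n by (simp only: power_divide) (simp add: field_simps)
  qed
  have "(p \<longlongrightarrow> p z) (at z within ball 0 1)"
  proof (rule tendsto_within_subset)
    show "(p \<longlongrightarrow> p z) (at z within cball 0 1)" using pc z by (simp add: continuous_on_def)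
  qed auto
  then have "((\<lambda>l. (nrm (p * k l) / nrm (k l))\<^sup>2 - 2 * Re (cnj (p z) * p l) + (cmod (p z))\<^sup>2) \<longlongrightarrow>
      (cmod (p z))\<^sup>2 - 2 * Re (cnj (p z) * p z) + (cmod (p z))\<^sup>2) (at z within ball 0 1)"
    by (intro tendsto_intros lim)
  moreover have "(cmod (p z))\<^sup>2 - 2 * Re (cnj (p z) * p z) + (cmod (p z))\<^sup>2 = 0"
    unfolding cmod_power2 by (simp add: power2_eq_square)
  ultimately have "((\<lambda>l. (nrm (p * k l) / nrm (k l))\<^sup>2 - 2 * Re (cnj (p z) * p l) + (cmod (p z))\<^sup>2) \<longlongrightarrow> 0)
      (at z within ball 0 1)" by simp
  then have "((\<lambda>l. (nrm (k l * on_ball p - p z \<odot> k l) / nrm (k l))\<^sup>2) \<longlongrightarrow> 0) (at z within ball 0 1)"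
    by (rule Lim_transform_within[where d = 1]) (auto simp: eq)
  then have "((\<lambda>l. sqrt ((nrm (k l * on_ball p - p z \<odot> k l) / nrm (k l))\<^sup>2)) \<longlongrightarrow> sqrt 0) (at z within ball 0 1)"
    by (rule tendsto_real_sqrt)
  then show ?thesis
    unfolding real_sqrt_abs real_sqrt_zero by (rule tendsto_rabs_zero_cancel)
qed

text \<open>Measures how far multiplication by \<open>f\<close> is from the scalar \<open>w\<close>
  on the normalized kernel. Its smallness forces f(l) to be near \<open>w\<close>, but as a
  statement about vectors it also yields elements of an invariant subspace close to
  \<open>k l\<close>.\<close>

definition defect :: "(complex^'d \<Rightarrow> complex) \<Rightarrow> complex \<Rightarrow> complex^'d \<Rightarrow> real" where
  "defect f w l = nrm (k l * f - w \<odot> k l) / nrm (k l)"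

lemma defect_triangle:
  assumes f: "f \<in> H" and g: "g \<in> H" and l: "l \<in> ball 0 1"
  shows "defect f w l \<le> nrm (k l * (f - g)) / nrm (k l) + defect g w l"
proof -
  note m = kernel_times_mem[OF l] and w = smult_mem[OF kernel_mem[OF l], of w]
  have eq: "k l * f - w \<odot> k l = k l * (f - g) + (k l * g - w \<odot> k l)"
    by (simp add: fun_eq_iff algebra_simps)
  have "nrm (k l * f - w \<odot> k l) \<le> nrm (k l * (f - g)) + nrm (k l * g - w \<odot> k l)"
    unfolding eq by (rule nrm_triangle[OF m[OF diff_mem[OF f g]] diff_mem[OF m[OF g] w]])
  then show ?thesis
    using nrm_kernel_pos[OF l] by (simp add: defect_def add_divide_distrib[symmetric] divide_right_mono)
qed

lemma defect_values:
  assumes f: "f \<in> H" and l: "l \<in> ball 0 1"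
  shows "cmod (v - w) \<le> defect f v l + defect f w l"
    "defect f w l \<le> defect f v l + cmod (v - w)"
    "cmod (f l - w) \<le> defect f w l"
    "0 \<le> defect f w l"
proof -
  note m = kernel_times_mem[OF l f] and kH = kernel_mem[OF l]
  note w = smult_mem[OF kH]
  let ?D = "\<lambda>w. k l * f - w \<odot> k l"
  have D: "?D w \<in> H" for w by (intro diff_mem m w)
  have n: "0 < nrm (k l)" by (rule nrm_kernel_pos[OF l])
  have "(v - w) \<odot> k l = ?D w - ?D v" by (simp add: fun_eq_iff algebra_simps)
  then have "cmod (v - w) * nrm (k l) = nrm (?D w - ?D v)" using nrm_smult[OF kH, of "v - w"] by simp
  also have "\<dots> \<le> nrm (?D w) + nrm (?D v)"
    using nrm_triangle[OF D smult_mem[OF D], of w "-1" v] nrm_smult[OF D, of "-1" v]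
    by (simp add: diff_eq_add_smult[of "?D w"])
  finally show "cmod (v - w) \<le> defect f v l + defect f w l"
    using n by (simp add: defect_def field_simps)
  have eq: "?D w = ?D v + (v - w) \<odot> k l" by (simp add: fun_eq_iff algebra_simps)
  have "nrm (?D w) \<le> nrm (?D v) + cmod (v - w) * nrm (k l)"
    unfolding eq nrm_smult[OF kH, symmetric] by (rule nrm_triangle[OF D w])
  then show "defect f w l \<le> defect f v l + cmod (v - w)"
    using n by (simp add: defect_def field_simps)
  have "ip (?D w) (k l) = ?D w l" using reproducing[OF D l] by simp
  also have "\<dots> = of_real ((nrm (k l))\<^sup>2) * (f l - w)"
    using kernel_diag[OF l] by (simp add: algebra_simps)
  finally have "(nrm (k l))\<^sup>2 * cmod (f l - w) = cmod (ip (?D w) (k l))"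
    by (simp add: norm_mult norm_power)
  also have "\<dots> \<le> nrm (?D w) * nrm (k l)" by (rule cauchy_schwarz[OF D kH])
  finally have "nrm (k l) * cmod (f l - w) \<le> nrm (?D w)"
    using n by (simp add: power2_eq_square mult.assoc)
  then show "cmod (f l - w) \<le> defect f w l"
    using n by (simp add: defect_def field_simps)
  show "0 \<le> defect f w l" using n nrm_nonneg[OF D] by (simp add: defect_def)
qed

text \<open>Approximants p_j in \<open>P\<close> with errors below 2^-j have small defects near
  \<open>z\<close> by continuity. Borel-Cantelli for the maximal functions controls the error terms
  for almost every \<open>z\<close>, and the limit of the numbers p_j(z) is the boundary
  value.\<close>

lemma nontangential_multiplier_limit:
  assumes P_cont: "\<And>p. p \<in> P \<Longrightarrow> continuous_on (cball 0 1) p" and P_mem: "\<And>p. p \<in> P \<Longrightarrow> on_ball p \<in> H"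
    and dense: "\<And>f e. f \<in> H \<Longrightarrow> 0 < e \<Longrightarrow> \<exists>p\<in>P. nrm (f - on_ball p) < e"
    and lim: "\<And>p z. p \<in> P \<Longrightarrow> norm z = 1 \<Longrightarrow>
      ((\<lambda>l. nrm (p * k l) / nrm (k l)) \<longlongrightarrow> cmod (p z)) (at z within ball 0 1)"
    and f: "f \<in> H"
  shows "AE z in \<tau>. \<exists>w. \<forall>a>1. (defect f w \<longlongrightarrow> 0) (at z within stolz a z)"
proof -
  have "\<exists>p\<in>P. nrm (f - on_ball p) < (1/2)^j" for j by (rule dense[OF f]) simp
  then obtain p where pP: "\<And>j::nat. p j \<in> P" and pd: "\<And>j. nrm (f - on_ball (p j)) < (1/2)^j" by metis
  have pH: "on_ball (p j) \<in> H" for j by (rule P_mem[OF pP])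
  have dH: "f - on_ball (p j) \<in> H" for j by (rule diff_mem[OF f pH])
  define V where "V j = sarason (f - on_ball (p j))" for j
  have V: "ball_regular (V j)" "\<And>z. z \<in> ball 0 1 \<Longrightarrow> 0 \<le> Re (V j z)" for j
    using sarason_regular[OF dH] sarason_nonneg[OF dH] by (auto simp: V_def)
  \<comment> \<open>The majorant is at most 4^-j at the origin. With threshold 2^-j the weak type
    bound is 10 times 2^-j: summable, while the threshold itself tends to 0.\<close>
  define E where "E j = {z. norm z = 1 \<and> (\<exists>r. 0 \<le> r \<and> r < 1 \<and> (1/2)^j < Re (V j (of_real r *s z)))}" for j
  have E: "E j \<in> sets borel" "emeasure \<tau> (E j) \<le> ennreal (10 / (1/2)^j * Re (V j 0))" for j
    unfolding E_def by (rule radial_weak_type[OF V]; simp)+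
  have E_le: "measure \<tau> (E j) \<le> 10 * (1/2)^j" for j
  proof -
    have "(nrm (f - on_ball (p j)))\<^sup>2 \<le> ((1/2)^j)\<^sup>2"
      using pd[of j] nrm_nonneg[OF dH[of j]] by (intro power_mono) auto
    then have "10 / (1/2)^j * Re (V j 0) \<le> 10 / (1/2)^j * ((1/2)^j)\<^sup>2"
      unfolding V_def sarason_0[OF dH] by (intro mult_left_mono) auto
    also have "\<dots> = 10 * (1/2)^j" by (simp add: power2_eq_square)
    finally have "emeasure \<tau> (E j) \<le> ennreal (10 * (1/2)^j)" using E(2)[of j] ennreal_leI order_trans by blast
    then show ?thesis by (simp add: emeasure_eq_measure)
  qed
  have "AE z in \<tau>. eventually (\<lambda>j. z \<in> space \<tau> - E j) sequentially"
  proof (rule borel_cantelli_AE1)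
    show "E j \<in> sets \<tau>" for j using E(1) by (simp add: sets_tau)
    show "emeasure \<tau> (E j) < \<infinity>" for j using emeasure_finite[of "E j"] by (simp add: less_top[symmetric])
    show "summable (\<lambda>j. measure \<tau> (E j))"
      by (rule summable_comparison_test'[OF summable_mult[OF summable_geometric[of "1/2::real"], of 10], of 0])
        (use E_le in auto)
  qed
  then show ?thesis using sphere
  proof eventually_elim
    fix z :: "complex^'d" assume ev: "eventually (\<lambda>j. z \<in> space \<tau> - E j) sequentially" and z: "norm z = 1"
    obtain J where J0: "\<And>j. j \<ge> J \<Longrightarrow> z \<notin> E j"
      using ev by (auto simp: eventually_sequentially)
    have J: "Re (V j (of_real r *s z)) \<le> (1/2)^j" if "j \<ge> J" "0 \<le> r" "r < 1" for j r
    proof (rule ccontr)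
      assume "\<not> Re (V j (of_real r *s z)) \<le> (1/2)^j"
      then have "z \<in> E j" unfolding E_def mem_Collect_eq using that z by (intro conjI exI[of _ r]) auto
      then show False using J0[OF that(1)] by simp
    qed
    \<comment> \<open>\<open>J\<close> and the numbers \<open>p j z\<close> serve every aperture;
      only the rate \<open>B\<close> depends on \<open>a\<close>, through the Harnack constant. The
      factor 2 in the witness adds the approximation error to the defect of the approximant.\<close>
    have approx: "\<exists>B. B \<longlonglongrightarrow> 0 \<and> (\<forall>j\<ge>J. \<forall>\<^sub>F l in at z within stolz a z. defect f (p j z) l < B j)"
      if a: "1 < a" for a
    proof -
      have "0 < a" using a by simp
      then obtain N :: nat where N: "\<And>V z l. ball_regular V \<Longrightarrow> (\<And>z. z \<in> ball 0 1 \<Longrightarrow> 0 \<le> Re (V z)) \<Longrightarrow>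
          norm z = 1 \<Longrightarrow> norm l < 1 \<Longrightarrow> dist l z < a * (1 - norm l) \<Longrightarrow>
          Re (V l) \<le> 5 ^ N * Re (V (of_real (norm l) *s (z :: complex^'d)))"
        by (rule nontangential_harnack) blast
      define B where "B j = sqrt (5 ^ N * (1/2)^j)" for j
      have "(\<lambda>j. 5 ^ N * (1/2::real)^j) \<longlonglongrightarrow> 5 ^ N * 0"
        by (intro tendsto_intros LIMSEQ_power_zero) simp
      from tendsto_real_sqrt[OF this] have "B \<longlonglongrightarrow> 0" by (simp add: B_def[abs_def])
      then have "(\<lambda>j. 2 * B j) \<longlonglongrightarrow> 2 * 0" by (intro tendsto_intros)
      moreover have "\<forall>\<^sub>F l in at z within stolz a z. defect f (p j z) l < 2 * B j" if j: "j \<ge> J" for j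
      proof -
        have Bpos: "0 < B j" by (simp add: B_def)
        have "(defect (on_ball (p j)) (p j z) \<longlongrightarrow> 0) (at z within ball 0 1)"
          unfolding defect_def by (rule continuous_multiplier_limit[OF P_cont[OF pP] pH z lim[OF pP z]])
        then have "(defect (on_ball (p j)) (p j z) \<longlongrightarrow> 0) (at z within stolz a z)"
          by (rule tendsto_within_subset) (auto simp: stolz_def)
        from order_tendstoD(2)[OF this Bpos]
        have "\<forall>\<^sub>F l in at z within stolz a z. defect (on_ball (p j)) (p j z) l < B j" .
        moreover have "\<forall>\<^sub>F l in at z within stolz a z. l \<in> stolz a z" by (simp add: eventually_at_filter)
        ultimately show ?thesis
        proof eventually_elim
          fix l assume d: "defect (on_ball (p j)) (p j z) l < B j" and "l \<in> stolz a z"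
          then have l: "l \<in> ball 0 1" "dist l z < a * (1 - norm l)" by (auto simp: stolz_def)
          have "(nrm (k l * (f - on_ball (p j))) / nrm (k l))\<^sup>2 \<le> Re (V j l)"
            unfolding V_def by (rule sarason_majorant[OF dH l(1)])
          also have "\<dots> \<le> 5 ^ N * Re (V j (of_real (norm l) *s z))"
            using l by (intro N V z) auto
          also have "\<dots> \<le> 5 ^ N * (1/2)^j"
            using J[OF j, of "norm l"] l by (intro mult_left_mono) auto
          finally have "nrm (k l * (f - on_ball (p j))) / nrm (k l) \<le> B j"
            unfolding B_def by (rule real_le_rsqrt)
          then show "defect f (p j z) l < 2 * B j"
            using defect_triangle[OF f pH l(1), of "p j z" j] d by linarith
        qed
      qed
      ultimately show ?thesis by (intro exI[of _ "\<lambda>j. 2 * B j"]) simp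
    qed
    obtain B2 where B2: "B2 \<longlonglongrightarrow> 0" "\<And>j. j \<ge> J \<Longrightarrow> \<forall>\<^sub>F l in at z within stolz 2 z. defect f (p j z) l < B2 j"
      using approx[of 2] by auto
    have close: "cmod (p i z - p j z) \<le> B2 i + B2 j" if ij: "i \<ge> J" "j \<ge> J" for i j
    proof -
      have "\<forall>\<^sub>F l in at z within stolz 2 z. l \<in> stolz 2 z" by (simp add: eventually_at_filter)
      with B2(2)[OF ij(1)] B2(2)[OF ij(2)]
      have "\<forall>\<^sub>F l in at z within stolz 2 z. defect f (p i z) l < B2 i \<and> defect f (p j z) l < B2 j \<and> l \<in> ball 0 1"
        by eventually_elim (simp add: stolz_def)
      then obtain l where "defect f (p i z) l < B2 i" "defect f (p j z) l < B2 j" "l \<in> ball 0 1"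
        using eventually_happens'[OF at_stolz_nontrivial[of 2 z]] z by auto
      then show ?thesis using defect_values(1)[OF f, of l "p i z" "p j z"] by linarith
    qed
    have "Cauchy (\<lambda>j. p j z)"
    proof (rule metric_CauchyI)
      fix e :: real assume e: "0 < e"
      obtain K where K: "\<And>j. j \<ge> K \<Longrightarrow> B2 j < e / 2"
        using order_tendstoD(2)[OF B2(1), of "e / 2"] e by (auto simp: eventually_sequentially)
      show "\<exists>M. \<forall>m\<ge>M. \<forall>n\<ge>M. dist (p m z) (p n z) < e"
      proof (intro exI[of _ "max J K"] allI impI)
        fix m n assume "max J K \<le> m" "max J K \<le> n"
        then show "dist (p m z) (p n z) < e"
          using close[of m n] K[of m] K[of n] by (simp add: dist_norm)
      qed
    qed
    then obtain w where w: "(\<lambda>j. p j z) \<longlonglongrightarrow> w" using Cauchy_convergent_iff convergent_def by blast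
    show "\<exists>w. \<forall>a>1. (defect f w \<longlongrightarrow> 0) (at z within stolz a z)"
    proof (intro exI[of _ w] allI impI)
      fix a :: real assume a: "1 < a"
      obtain B where B: "B \<longlonglongrightarrow> 0" "\<And>j. j \<ge> J \<Longrightarrow> \<forall>\<^sub>F l in at z within stolz a z. defect f (p j z) l < B j"
        using approx[OF a] by auto
      have "\<forall>\<^sub>F l in at z within stolz a z. dist (defect f w l) 0 < e" if e: "0 < e" for e
      proof -
        have "\<forall>\<^sub>F j in sequentially. B j < e / 2 \<and> dist (p j z) w < e / 2 \<and> j \<ge> J"
          using order_tendstoD(2)[OF B(1), of "e / 2"] tendstoD[OF w, of "e / 2"] e eventually_ge_at_top[of J]
          by (simp add: eventually_conj_iff)
        then obtain j where j: "B j < e / 2" "dist (p j z) w < e / 2" "j \<ge> J"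
          using eventually_happens'[OF sequentially_bot] by blast
        have "\<forall>\<^sub>F l in at z within stolz a z. l \<in> stolz a z" by (simp add: eventually_at_filter)
        with B(2)[OF j(3)] show ?thesis
        proof eventually_elim
          fix l assume d: "defect f (p j z) l < B j" and "l \<in> stolz a z"
          then have l: "l \<in> ball 0 1" by (simp add: stolz_def)
          show "dist (defect f w l) 0 < e"
            using defect_values(2)[OF f l, where w = w and v = "p j z"]
              defect_values(4)[OF f l, where w = w] d j by (simp add: dist_norm)
        qed
      qed
      then show "(defect f w \<longlongrightarrow> 0) (at z within stolz a z)" by (rule tendstoI)
    qed
  qed
qed

lemma multiplier_limit_imp_nt_limit:
  assumes f: "f \<in> H" and lim: "\<And>a. 1 < a \<Longrightarrow> (defect f w \<longlongrightarrow> 0) (at z within stolz a z)"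
  shows "has_nt_limit f z w"
  unfolding has_nt_limit_def
proof (intro allI impI)
  fix a :: real assume a: "1 < a"
  have "\<forall>\<^sub>F l in at z within stolz a z. l \<in> stolz a z" by (simp add: eventually_at_filter)
  then have "\<forall>\<^sub>F l in at z within stolz a z. norm (f l - w) \<le> defect f w l"
    by eventually_elim (use defect_values(3)[OF f] in \<open>simp add: stolz_def\<close>)
  then have "((\<lambda>l. f l - w) \<longlongrightarrow> 0) (at z within stolz a z)"
    using lim[OF a] by (rule Lim_null_comparison)
  then show "(f \<longlongrightarrow> w) (at z within {l \<in> ball 0 1. dist l z < a * (1 - norm l)})"
    unfolding stolz_def by (simp add: Lim_null[symmetric])
qed

lemma nt_limit_radial:
  assumes "has_nt_limit f z w" "norm z = 1"
  shows "(\<lambda>n. f (of_real (radii n) *s z)) \<longlonglongrightarrow> w"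
proof -
  have "(f \<longlongrightarrow> w) (at z within stolz 2 z)" using assms(1)[unfolded has_nt_limit_def, rule_format, of 2] by (simp only: stolz_def)
  then show ?thesis by (rule filterlim_compose[OF _ radial_in_stolz[OF _ assms(2)]]) simp
qed

section \<open>The projection onto the invariant subspace, evaluated on kernels\<close>

lemma adjoint_kernel:
  assumes \<phi>: "\<phi> \<in> multipliers H" and l: "l \<in> ball 0 1"
  shows "hilbert_adjoint H ip (mult_op \<phi>) (k l) = cnj (\<phi> l) \<odot> k l"
proof -
  note kH = kernel_mem[OF l]
  have \<phi>H: "\<phi> * f \<in> H" if "f \<in> H" for f using \<phi> that by (simp add: multipliers_def)
  have e: "ip (mult_op \<phi> f) (k l) = ip f (cnj (\<phi> l) \<odot> k l)" if f: "f \<in> H" for f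
    using reproducing[OF \<phi>H[OF f] l] reproducing[OF f l] ip_smult_right[OF kH f]
    by (simp add: mult_op_def)
  show ?thesis unfolding hilbert_adjoint_def
  proof (rule the_equality)
    show "cnj (\<phi> l) \<odot> k l \<in> H \<and> (\<forall>f\<in>H. ip (mult_op \<phi> f) (k l) = ip f (cnj (\<phi> l) \<odot> k l))"
      using e smult_mem[OF kH] by blast
    fix h assume "h \<in> H \<and> (\<forall>f\<in>H. ip (mult_op \<phi> f) (k l) = ip f h)"
    then show "h = cnj (\<phi> l) \<odot> k l"
      using e smult_mem[OF kH] by (intro ip_ext) auto
  qed
qed

text \<open>The operator identity is applied to \<open>k l\<close> and evaluated at
  \<open>l\<close>. Its left-hand side is the squared norm of \<open>k l\<close> times the sum of
  |phi_n(l)|^2, its right-hand side the squared norm of the projection of \<open>k l\<close>.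
  Pythagoras then relates 1 - \<open>S\<close> to the distance from \<open>M\<close>.\<close>

lemma projection_norm_on_kernel:
  assumes M: "closed_lin_subspace H ip M" and l: "l \<in> ball 0 1"
    and \<phi>: "\<And>n. n \<in> I \<Longrightarrow> \<phi> n \<in> multipliers H \<inter> M"
    and lim: "(\<lambda>N. nrm ((\<Sum>n\<in>I \<inter> {..<N}. mult_op (\<phi> n) (hilbert_adjoint H ip (mult_op (\<phi> n)) (k l)))
        - hilbert_proj ip M (k l))) \<longlonglongrightarrow> 0"
  obtains S where "(\<lambda>n. if n \<in> I then (cmod (\<phi> n l))\<^sup>2 else 0) sums S" "S \<le> 1"
    "\<And>h. h \<in> M \<Longrightarrow> 1 - S \<le> (nrm (k l - h) / nrm (k l))\<^sup>2"
proof -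
  note MD = closed_lin_subspaceD[OF M] and kH = kernel_mem[OF l]
  define g where "g = hilbert_proj ip M (k l)"
  have g: "g \<in> M" "\<And>h. h \<in> M \<Longrightarrow> ip (k l - g) h = 0"
    using hilbert_proj[OF M kH] by (auto simp: g_def)
  have gH: "g \<in> H" using g MD(1) by blast
  have n: "0 < (nrm (k l))\<^sup>2" using nrm_kernel_pos[OF l] by simp
  define F where "F N = (\<Sum>n\<in>I \<inter> {..<N}. mult_op (\<phi> n) (hilbert_adjoint H ip (mult_op (\<phi> n)) (k l)))" for N
  have F_eq: "F N = (\<Sum>n\<in>I \<inter> {..<N}. \<phi> n * (cnj (\<phi> n l) \<odot> k l))" for N
    unfolding F_def using \<phi> by (intro sum.cong) (auto simp: adjoint_kernel[OF _ l] mult_op_def)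
  have FH: "F N \<in> H" for N
    unfolding F_eq using \<phi> smult_mem[OF kH] by (intro sum_mem) (auto simp: multipliers_def)
  have "(\<lambda>N. F N l) \<longlonglongrightarrow> g l"
    by (rule eval_tendsto[OF FH gH]) (use lim in \<open>simp add: F_def g_def\<close>)
  moreover have "F N l = of_real ((nrm (k l))\<^sup>2 * (\<Sum>n\<in>I \<inter> {..<N}. (cmod (\<phi> n l))\<^sup>2))" for N
    unfolding F_eq sum_fun_apply of_real_mult of_real_sum sum_distrib_left complex_norm_square
    using kernel_diag[OF l] by (intro sum.cong) (simp_all add: mult_ac complex_norm_square)
  moreover have "g l = of_real ((nrm g)\<^sup>2)"
  proof -
    have "ip g (k l) = ip g g"
      using g(2)[OF g(1)] ip_diff[OF kH gH gH] ip_cnj[OF kH gH] ip_cnj[OF gH gH] by simp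
    then show ?thesis using reproducing[OF gH l] ip_self[OF gH] by simp
  qed
  ultimately have "(\<lambda>N. (nrm (k l))\<^sup>2 * (\<Sum>n\<in>I \<inter> {..<N}. (cmod (\<phi> n l))\<^sup>2)) \<longlonglongrightarrow> (nrm g)\<^sup>2"
    by (simp only: tendsto_of_real_iff)
  then have "(\<lambda>N. (nrm (k l))\<^sup>2 * (\<Sum>n\<in>I \<inter> {..<N}. (cmod (\<phi> n l))\<^sup>2) / (nrm (k l))\<^sup>2) \<longlonglongrightarrow> (nrm g)\<^sup>2 / (nrm (k l))\<^sup>2"
    using n by (intro tendsto_divide tendsto_const) auto
  moreover have "(\<Sum>n<N. if n \<in> I then (cmod (\<phi> n l))\<^sup>2 else 0) = (\<Sum>n\<in>I \<inter> {..<N}. (cmod (\<phi> n l))\<^sup>2)" for N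
    by (simp add: sum.inter_restrict[symmetric] Int_commute)
  ultimately have sums: "(\<lambda>n. if n \<in> I then (cmod (\<phi> n l))\<^sup>2 else 0) sums ((nrm g)\<^sup>2 / (nrm (k l))\<^sup>2)"
    using n by (simp add: sums_def)
  \<comment> \<open>Pythagoras is used for \<open>h\<close> and for 0; subtracting the two
    eliminates the distance from \<open>k l\<close> to its projection.\<close>
  have pyth: "(nrm (k l - h))\<^sup>2 = (nrm (k l))\<^sup>2 - (nrm g)\<^sup>2 + (nrm (g - h))\<^sup>2" if h: "h \<in> M" for h
  proof -
    have hH: "h \<in> H" using h MD(1) by blast
    have *: "(nrm (k l - h'))\<^sup>2 = (nrm (k l - g))\<^sup>2 + (nrm (g - h'))\<^sup>2" if h': "h' \<in> M" for h'
    proof -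
      have h'H: "h' \<in> H" using h' MD(1) by blast
      have "g - h' \<in> M" unfolding diff_eq_add_smult using g(1) h' MD(3,4) by blast
      then have "ip (k l - g) (g - h') = 0" by (rule g(2))
      moreover have "k l - h' = (k l - g) + (g - h')" by simp
      ultimately show ?thesis
        using nrm_add_sq[OF diff_mem[OF kH gH] diff_mem[OF gH h'H]] by simp
    qed
    from *[OF h] *[OF MD(2)] show ?thesis by simp
  qed
  show thesis
  proof (rule that[OF sums])
    have "0 \<le> (nrm (k l))\<^sup>2 - (nrm g)\<^sup>2" using pyth[OF g(1)] zero_le_power2[of "nrm (k l - g)"] nrm_zero by simp
    then show "(nrm g)\<^sup>2 / (nrm (k l))\<^sup>2 \<le> 1" using n by simp
    fix h assume "h \<in> M"
    from pyth[OF this] have "(nrm (k l))\<^sup>2 - (nrm g)\<^sup>2 \<le> (nrm (k l - h))\<^sup>2" by simp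
    then have "((nrm (k l))\<^sup>2 - (nrm g)\<^sup>2) / (nrm (k l))\<^sup>2 \<le> (nrm (k l - h))\<^sup>2 / (nrm (k l))\<^sup>2"
      using n by (intro divide_right_mono) auto
    then show "1 - (nrm g)\<^sup>2 / (nrm (k l))\<^sup>2 \<le> (nrm (k l - h) / nrm (k l))\<^sup>2"
      using n by (simp add: diff_divide_distrib power_divide)
  qed
qed

lemma multiplier_sequence_inner:
  fixes \<phi> :: "nat \<Rightarrow> complex^'d \<Rightarrow> complex"
  assumes P_cont: "\<And>p. p \<in> P \<Longrightarrow> continuous_on (cball 0 1) p" and P_mem: "\<And>p. p \<in> P \<Longrightarrow> on_ball p \<in> H"
    and dense: "\<And>f e. f \<in> H \<Longrightarrow> 0 < e \<Longrightarrow> \<exists>p\<in>P. nrm (f - on_ball p) < e"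
    and P_lim: "\<And>p z. p \<in> P \<Longrightarrow> norm z = 1 \<Longrightarrow>
      ((\<lambda>l. nrm (p * k l) / nrm (k l)) \<longlongrightarrow> cmod (p z)) (at z within ball 0 1)"
    and M: "multiplier_invariant_subspace H ip M" "M \<noteq> {0}"
    and \<phi>: "\<And>n. n \<in> I \<Longrightarrow> \<phi> n \<in> multipliers H \<inter> M"
    and lim: "\<And>f. f \<in> H \<Longrightarrow> (\<lambda>N. nrm ((\<Sum>n\<in>I \<inter> {..<N}. mult_op (\<phi> n) (hilbert_adjoint H ip (mult_op (\<phi> n)) f))
        - hilbert_proj ip M f)) \<longlonglongrightarrow> 0"
  shows "inner_sequence \<tau> I \<phi>"
proof -
  let ?x = "\<lambda>j z. of_real (radii j) *s (z :: complex^'d)"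
  have tau_UNIV: "emeasure \<tau> UNIV = 1" using emeasure_space_1 by simp
  have cM: "closed_lin_subspace H ip M" using M(1) by (simp add: multiplier_invariant_subspace_def)
  note MD = closed_lin_subspaceD[OF cM]
  have \<phi>H: "\<phi> n \<in> H" if "n \<in> I" for n using \<phi>[OF that] MD(1) by blast
  define a where "a n l = (if n \<in> I then (cmod (\<phi> n l))\<^sup>2 else 0)" for n l
  have a0: "0 \<le> a n l" for n l by (simp add: a_def)
  define S where "S l = (\<Sum>n. a n l)" for l
  have S: "(\<lambda>n. a n l) sums S l" "S l \<le> 1" "\<And>h. h \<in> M \<Longrightarrow> 1 - S l \<le> (nrm (k l - h) / nrm (k l))\<^sup>2"
    if l: "l \<in> ball 0 1" for l
  proof -
    obtain T where T: "(\<lambda>n. if n \<in> I then (cmod (\<phi> n l))\<^sup>2 else 0) sums T" "T \<le> 1"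
      "\<And>h. h \<in> M \<Longrightarrow> 1 - T \<le> (nrm (k l - h) / nrm (k l))\<^sup>2"
    proof (rule projection_norm_on_kernel[OF cM l, of I \<phi>])
      show "\<phi> n \<in> multipliers H \<inter> M" if "n \<in> I" for n using that by (rule \<phi>)
      show "(\<lambda>N. nrm ((\<Sum>n\<in>I \<inter> {..<N}. mult_op (\<phi> n) (hilbert_adjoint H ip (mult_op (\<phi> n)) (k l)))
        - hilbert_proj ip M (k l))) \<longlonglongrightarrow> 0" by (rule lim[OF kernel_mem[OF l]])
    next
      fix T assume "(\<lambda>n. if n \<in> I then (cmod (\<phi> n l))\<^sup>2 else 0) sums T" "T \<le> 1"
        "\<And>h. h \<in> M \<Longrightarrow> 1 - T \<le> (nrm (k l - h) / nrm (k l))\<^sup>2"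
      then show thesis by (rule that)
    qed
    have "S l = T" unfolding S_def a_def by (rule sums_unique[OF T(1), symmetric])
    then show "(\<lambda>n. a n l) sums S l" "S l \<le> 1" "\<And>h. h \<in> M \<Longrightarrow> 1 - S l \<le> (nrm (k l - h) / nrm (k l))\<^sup>2"
      using T by (simp_all add: a_def)
  qed
  have S0: "0 \<le> S l" if l: "l \<in> ball 0 1" for l
    using S(1)[OF l] a0 by (simp add: S_def suminf_nonneg sums_summable)
  have a_le: "a n l \<le> 1" if l: "l \<in> ball 0 1" for n l
  proof -
    have "a n l \<le> S l"
      using sum_le_suminf[OF sums_summable[OF S(1)[OF l]], of "{n}"] a0 by (simp add: S_def)
    then show ?thesis using S(2)[OF l] by simp
  qed
  have \<phi>_le: "cmod (\<phi> n l) \<le> 1" if "n \<in> I" "l \<in> ball 0 1" for n l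
    using a_le[of l n] that by (simp add: a_def abs_square_le_1)
  have radial_ball: "?x j z \<in> ball 0 1" if "norm z = 1" for z :: "complex^'d" and j
    using radii(1,2)[of j] that by simp
  \<comment> \<open>Otherwise the sum of operators, hence the projection, would be 0 and
    \<open>M\<close> trivial.\<close>
  have "\<exists>m\<in>I. \<phi> m \<noteq> 0"
  proof (rule ccontr)
    assume "\<not> (\<exists>m\<in>I. \<phi> m \<noteq> 0)"
    then have zero: "\<phi> n = 0" if "n \<in> I" for n using that by blast
    have "f = 0" if f: "f \<in> M" for f
    proof -
      have fH: "f \<in> H" using f MD(1) by blast
      have p: "hilbert_proj ip M f \<in> M" "hilbert_proj ip M f \<in> H"
        using hilbert_proj(1)[OF cM fH] MD(1) by auto
      have "(\<Sum>n\<in>I \<inter> {..<N}. mult_op (\<phi> n) (hilbert_adjoint H ip (mult_op (\<phi> n)) f)) = 0" for N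
        using zero by (intro sum.neutral) (auto simp: mult_op_def)
      then have "nrm (0 - hilbert_proj ip M f) = 0"
        using lim[OF fH] by (simp add: LIMSEQ_const_iff)
      then have "hilbert_proj ip M f = 0"
        using nrm_eq_0[OF p(2)] nrm_minus_commute[OF zero_mem p(2)] by simp
      then have "ip f f = 0" using hilbert_proj(2)[OF cM fH f] by simp
      then show ?thesis using ip_self[OF fH] nrm_eq_0[OF fH] by simp
    qed
    then show False using M(2) MD(2) by blast
  qed
  then obtain m where m: "m \<in> I" "\<phi> m \<noteq> 0" by blast
  obtain z0 where z0: "z0 \<in> ball 0 1" "\<phi> m z0 \<noteq> 0"
    using m(2) off_ball[OF \<phi>H[OF m(1)]] by (auto simp: fun_eq_iff)
  have nonzero: "AE z in \<tau>. \<not> (\<lambda>j. \<phi> m (?x j z)) \<longlonglongrightarrow> 0"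
    by (rule boundary_values_nonzero[OF mem_regular[OF \<phi>H[OF m(1)]] mem_measurable[OF \<phi>H[OF m(1)]]
        \<phi>_le[OF m(1)] z0 radii(2,3)])
  have "AE z in \<tau>. \<forall>n\<in>I. \<exists>w. \<forall>a>1. (defect (\<phi> n) w \<longlongrightarrow> 0) (at z within stolz a z)"
    by (rule AE_ball_countable'[OF _ countableI_type])
      (rule nontangential_multiplier_limit[OF P_cont P_mem dense P_lim \<phi>H])
  then have lims: "AE z in \<tau>. \<exists>w. (\<forall>n\<in>I. has_nt_limit (\<phi> n) z (w n)) \<and>
      (\<forall>n\<in>I. (\<lambda>j. \<phi> n (?x j z)) \<longlonglongrightarrow> w n) \<and>
      (\<lambda>j. S (?x j z)) \<longlonglongrightarrow> 1 \<and> norm z = 1"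
    using nonzero sphere
  proof eventually_elim
    fix z :: "complex^'d"
    assume "\<forall>n\<in>I. \<exists>w. \<forall>a>1. (defect (\<phi> n) w \<longlongrightarrow> 0) (at z within stolz a z)"
      and nz: "\<not> (\<lambda>j. \<phi> m (?x j z)) \<longlonglongrightarrow> 0" and z: "norm z = 1"
    then obtain w where w: "\<And>n a. n \<in> I \<Longrightarrow> 1 < a \<Longrightarrow> (defect (\<phi> n) (w n) \<longlongrightarrow> 0) (at z within stolz a z)"
      by metis
    have nt: "has_nt_limit (\<phi> n) z (w n)" if "n \<in> I" for n
      by (rule multiplier_limit_imp_nt_limit[OF \<phi>H[OF that] w[OF that]])
    have radial: "(\<lambda>j. \<phi> n (?x j z)) \<longlonglongrightarrow> w n" if "n \<in> I" for n
      by (rule nt_limit_radial[OF nt[OF that] z])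
    have wm: "w m \<noteq> 0" using nz radial[OF m(1)] by auto
    let ?l = "\<lambda>j. ?x j z"
    have d0: "(\<lambda>j. defect (\<phi> m) (w m) (?l j)) \<longlonglongrightarrow> 0"
      by (rule filterlim_compose[OF w[OF m(1)] radial_in_stolz[OF _ z], of 2]) auto
    \<comment> \<open>Invariance of \<open>M\<close> under the multiplier \<open>k l\<close> makes
      the product of \<open>k l\<close> and \<open>\<phi> m\<close> an element of \<open>M\<close>;
      divided by \<open>w m\<close> it is the comparison vector.\<close>
    have bound: "1 - S (?l j) \<le> (defect (\<phi> m) (w m) (?l j) / cmod (w m))\<^sup>2" for j
    proof -
      let ?k = "k (?l j)"
      have l: "?l j \<in> ball 0 1" by (rule radial_ball[OF z])
      note kH = kernel_mem[OF l]
      have kM: "?k * \<phi> m \<in> M"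
        using M(1) kernel_multiplier[OF l] \<phi>[OF m(1)]
        unfolding multiplier_invariant_subspace_def mult_op_def by blast
      define h where "h = (1 / w m) \<odot> (?k * \<phi> m)"
      have "h \<in> M" unfolding h_def by (rule MD(4)[OF kM])
      have kmH: "?k * \<phi> m \<in> H" using kM MD(1) by blast
      have "?k - h = (- 1 / w m) \<odot> (?k * \<phi> m - w m \<odot> ?k)"
        using wm by (simp add: h_def fun_eq_iff field_simps)
      then have "nrm (?k - h) = cmod (- 1 / w m) * nrm (?k * \<phi> m - w m \<odot> ?k)"
        using nrm_smult[OF diff_mem[OF kmH smult_mem[OF kH]]] by simp
      then have "nrm (?k - h) / nrm ?k = defect (\<phi> m) (w m) (?l j) / cmod (w m)"
        by (simp add: defect_def norm_divide field_simps)
      then show ?thesis using S(3)[OF l \<open>h \<in> M\<close>] by simp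
    qed
    have "(\<lambda>j. (defect (\<phi> m) (w m) (?l j) / cmod (w m))\<^sup>2) \<longlonglongrightarrow> (0 / cmod (w m))\<^sup>2"
      using wm by (intro tendsto_intros d0) auto
    then have lim0: "(\<lambda>j. (defect (\<phi> m) (w m) (?l j) / cmod (w m))\<^sup>2) \<longlonglongrightarrow> 0" by simp
    have "(\<lambda>j. 1 - S (?l j)) \<longlonglongrightarrow> 0"
    proof (rule tendsto_sandwich[OF _ _ tendsto_const lim0]; rule always_eventually, rule allI)
      show "0 \<le> 1 - S (?l j)" for j using S(2)[OF radial_ball[OF z]] by simp
    qed (rule bound)
    from tendsto_diff[OF tendsto_const[of 1] this] have "(\<lambda>j. S (?l j)) \<longlonglongrightarrow> 1" by simp
    then show "\<exists>w. (\<forall>n\<in>I. has_nt_limit (\<phi> n) z (w n)) \<and>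
      (\<forall>n\<in>I. (\<lambda>j. \<phi> n (?x j z)) \<longlonglongrightarrow> w n) \<and>
      (\<lambda>j. S (?x j z)) \<longlonglongrightarrow> 1 \<and> norm z = 1"
      using nt radial z by blast
  qed
  have [measurable]: "(\<lambda>z::complex^'d. c *s z) \<in> borel_measurable borel" for c
    by (intro borel_measurable_continuous_onI continuous_intros)
  have a_meas [measurable]: "a n \<in> borel_measurable borel" for n
  proof (cases "n \<in> I")
    case True
    have [measurable]: "\<phi> n \<in> borel_measurable borel" by (rule mem_measurable[OF \<phi>H[OF True]])
    have "(\<lambda>l. (cmod (\<phi> n l))\<^sup>2) \<in> borel_measurable borel" by measurable
    then show ?thesis using True by (simp add: a_def[abs_def])
  qed (simp add: a_def[abs_def])
  \<comment> \<open>The lower limit is defined and measurable everywhere; almost everywhere it is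
    the squared modulus of the boundary value.\<close>
  define u where "u n z = liminf (\<lambda>j. ennreal (a n (?x j z)))" for n z
  have [measurable]: "u n \<in> borel_measurable borel" for n unfolding u_def[abs_def] by measurable
  have u_lim: "AE z in \<tau>. (\<lambda>j. ennreal (a n (?x j z))) \<longlonglongrightarrow> u n z" for n
    using lims
  proof eventually_elim
    case (elim z)
    then obtain w where w: "\<forall>n\<in>I. (\<lambda>j. \<phi> n (?x j z)) \<longlonglongrightarrow> w n" by blast
    have "(\<lambda>j. ennreal (a n (?x j z))) \<longlonglongrightarrow> ennreal (if n \<in> I then (cmod (w n))\<^sup>2 else 0)"
      unfolding a_def using w by (cases "n \<in> I") (auto intro!: tendsto_intros)
    then show ?case unfolding u_def using lim_imp_Liminf[OF sequentially_bot] by metis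
  qed
  have u_all: "AE z in \<tau>. \<forall>n. (\<lambda>j. ennreal (a n (?x j z))) \<longlonglongrightarrow> u n z"
    unfolding AE_all_countable using u_lim by blast
  \<comment> \<open>The spherical means of |phi_n|^2 increase with the radius and, being dominated
    by 1, converge to the mean of the boundary function.\<close>
  have step: "(\<integral>\<^sup>+z. ennreal (a n (?x i z)) \<partial>\<tau>) \<le> (\<integral>\<^sup>+z. u n z \<partial>\<tau>)" for n i
  proof (cases "n \<in> I")
    case True
    have "(\<lambda>j. \<integral>\<^sup>+z. ennreal (a n (?x j z)) \<partial>\<tau>) \<longlonglongrightarrow> (\<integral>\<^sup>+z. u n z \<partial>\<tau>)"
    proof (rule nn_integral_dominated_convergence[where w = "\<lambda>_. 1"])
      show "AE z in \<tau>. ennreal (a n (?x j z)) \<le> 1" for j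
        using sphere by eventually_elim (use a_le[OF radial_ball] in \<open>simp add: ennreal_le_1\<close>)
      show "(\<integral>\<^sup>+z. 1 \<partial>\<tau>) < \<infinity>" by (simp add: tau_UNIV)
    qed (use u_lim in auto)
    moreover have "(\<integral>\<^sup>+z. ennreal (a n (?x i z)) \<partial>\<tau>) \<le> (\<integral>\<^sup>+z. ennreal (a n (?x j z)) \<partial>\<tau>)"
      if "j > i" for j
    proof -
      have "radii i < radii j" using that by (simp add: radii_def frac_less2)
      then show ?thesis
        using square_means_mono[OF mem_regular[OF \<phi>H[OF True]] mem_measurable[OF \<phi>H[OF True]], of "radii i" "radii j"]
          radii(1)[of i] radii(2)[of j] True by (simp add: a_def)
    qed
    ultimately show ?thesis by (intro LIMSEQ_le_const) (auto intro!: exI[of _ "Suc i"])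
  qed (simp add: a_def)
  have S_sum: "(\<Sum>n. ennreal (a n l)) = ennreal (S l)" if "l \<in> ball 0 1" for l
    using suminf_ennreal_eq[OF a0 S(1)[OF that]] .
  \<comment> \<open>The bound of each mean by its boundary mean is summed over \<open>n\<close> at a
    fixed radius; only afterwards does the radius tend to 1. In this order no mass is lost, and the
    boundary sum has mean at least 1.\<close>
  have "(\<integral>\<^sup>+z. (\<Sum>n. ennreal (a n (?x j z))) \<partial>\<tau>) \<le> (\<integral>\<^sup>+z. (\<Sum>n. u n z) \<partial>\<tau>)" for j
    by (simp add: nn_integral_suminf) (intro suminf_le step; simp)
  moreover have "(\<lambda>j. \<integral>\<^sup>+z. (\<Sum>n. ennreal (a n (?x j z))) \<partial>\<tau>) \<longlonglongrightarrow> (\<integral>\<^sup>+z. 1 \<partial>\<tau>)"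
  proof (rule nn_integral_dominated_convergence[where w = "\<lambda>_. 1"])
    show "AE z in \<tau>. (\<Sum>n. ennreal (a n (?x j z))) \<le> 1" for j
      using sphere by eventually_elim (use S(2)[OF radial_ball] S_sum[OF radial_ball] in \<open>simp add: ennreal_le_1\<close>)
    show "AE z in \<tau>. (\<lambda>j. \<Sum>n. ennreal (a n (?x j z))) \<longlonglongrightarrow> 1"
      using lims
    proof eventually_elim
      case (elim z)
      then have z: "norm z = 1" and "(\<lambda>j. S (?x j z)) \<longlonglongrightarrow> 1" by auto
      then have "(\<lambda>j. ennreal (S (?x j z))) \<longlonglongrightarrow> ennreal 1" by (intro tendsto_ennrealI)
      then show ?case by (simp only: S_sum[OF radial_ball[OF z]] ennreal_1)
    qed
    show "(\<integral>\<^sup>+z. 1 \<partial>\<tau>) < \<infinity>" by (simp add: tau_UNIV)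
  qed auto
  ultimately have ge: "1 \<le> (\<integral>\<^sup>+z. (\<Sum>n. u n z) \<partial>\<tau>)"
    using LIMSEQ_le_const2[of _ "\<integral>\<^sup>+z. 1 \<partial>\<tau>"] by (auto simp: tau_UNIV)
  \<comment> \<open>The opposite bound is pointwise: finite partial sums are at most 1 inside the
    ball, and the limit is harmless for finitely many terms.\<close>
  have le: "AE z in \<tau>. (\<Sum>n. u n z) \<le> 1"
    using u_all sphere
  proof eventually_elim
    case (elim z)
    have "(\<Sum>n<N. u n z) \<le> 1" for N
    proof (rule LIMSEQ_le_const2)
      show "(\<lambda>j. \<Sum>n<N. ennreal (a n (?x j z))) \<longlonglongrightarrow> (\<Sum>n<N. u n z)"
        using elim(1) by (intro tendsto_sum) auto
      have "(\<Sum>n<N. ennreal (a n (?x j z))) \<le> 1" for j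
      proof -
        have "(\<Sum>n<N. ennreal (a n (?x j z))) \<le> (\<Sum>n. ennreal (a n (?x j z)))"
          by (intro sum_le_suminf) auto
        also have "\<dots> \<le> 1"
          using S(2)[OF radial_ball[OF elim(2)]] S_sum[OF radial_ball[OF elim(2)]] by (simp add: ennreal_le_1)
        finally show ?thesis .
      qed
      then show "\<exists>N'. \<forall>j\<ge>N'. (\<Sum>n<N. ennreal (a n (?x j z))) \<le> 1" by blast
    qed
    then show ?case by (intro suminf_le_const) auto
  qed
  \<comment> \<open>A function bounded by 1 with mean at least 1 under a probability measure equals
    1 almost everywhere.\<close>
  have "(\<integral>\<^sup>+z. 1 - (\<Sum>n. u n z) \<partial>\<tau>) = (\<integral>\<^sup>+z. 1 \<partial>\<tau>) - (\<integral>\<^sup>+z. (\<Sum>n. u n z) \<partial>\<tau>)"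
  proof (rule nn_integral_diff)
    have "(\<integral>\<^sup>+z. (\<Sum>n. u n z) \<partial>\<tau>) \<le> (\<integral>\<^sup>+z. 1 \<partial>\<tau>)" using le by (rule nn_integral_mono_AE)
    then show "(\<integral>\<^sup>+z. (\<Sum>n. u n z) \<partial>\<tau>) \<noteq> \<infinity>" by (auto simp: tau_UNIV top_unique)
  qed (use le in auto)
  also have "\<dots> = 0" using ge by (simp add: tau_UNIV diff_eq_0_iff_ennreal)
  finally have "AE z in \<tau>. 1 - (\<Sum>n. u n z) = 0" by (subst (asm) nn_integral_0_iff_AE) auto
  then have one: "AE z in \<tau>. (\<Sum>n. u n z) = 1"
    using le by eventually_elim (auto simp: diff_eq_0_iff_ennreal intro: antisym)
  show ?thesis
    unfolding inner_sequence_def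
    using lims one u_all
  proof eventually_elim
    case (elim z)
    then obtain w where w: "\<forall>n\<in>I. has_nt_limit (\<phi> n) z (w n)"
      "\<forall>n\<in>I. (\<lambda>j. \<phi> n (?x j z)) \<longlonglongrightarrow> w n" by blast
    let ?b = "\<lambda>n. if n \<in> I then (cmod (w n))\<^sup>2 else 0"
    have "(\<lambda>j. ennreal (a n (?x j z))) \<longlonglongrightarrow> ennreal (?b n)" for n
      unfolding a_def using w by (cases "n \<in> I") (auto intro!: tendsto_intros)
    then have "u n z = ennreal (?b n)" for n using elim(3) LIMSEQ_unique by blast
    then have b1: "(\<Sum>n. ennreal (?b n)) = 1" using elim(2) by simp
    have sm: "summable ?b" by (rule summable_suminf_not_top) (auto simp: b1)
    have "ennreal (suminf ?b) = ennreal 1"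
      using b1 suminf_ennreal2[OF _ sm] by simp
    then have "suminf ?b = 1" using suminf_nonneg[OF sm] by (subst (asm) ennreal_inj) auto
    then have "?b sums 1" using summable_sums[OF sm] by simp
    then show ?case using w(1) by blast
  qed
qed

end

section \<open>Transport of the measure from the sphere to the whole space\<close>

lemma orthogonal_measurable_sphere:
  assumes "orthogonal_transformation (U :: complex^'d \<Rightarrow> complex^'d)"
    and "sets \<sigma> = sets (restrict_space borel (sphere 0 1))"
  shows "U \<in> measurable \<sigma> \<sigma>"
proof -
  have "U \<in> borel_measurable borel" by (rule orthogonal_measurable[OF assms(1)])
  then have "U \<in> measurable (restrict_space borel (sphere 0 1)) (restrict_space borel (sphere 0 1))"
    using assms(1) by (intro measurable_restrict_space3) (auto simp: orthogonal_transformation)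
  then show ?thesis using measurable_cong_sets[OF assms(2) assms(2)] by simp
qed

text \<open>The inclusion of the sphere pushes the given measure forward to a Borel measure on C^d;
  it commutes with orthogonal maps, so invariance is preserved. Almost everywhere statements are
  pulled back along it at the end.\<close>

lemma sphere_measure_distr:
  assumes \<sigma>: "rotation_invariant_prob (\<sigma> :: (complex^'d) measure)"
  shows "sphere_measure (distr \<sigma> borel (\<lambda>z. z))" "(\<lambda>z. z) \<in> measurable \<sigma> borel"
proof -
  have s: "prob_space \<sigma>" "sets \<sigma> = sets (restrict_space borel (sphere 0 1))"
    "\<And>U. orthogonal_transformation U \<Longrightarrow> distr \<sigma> \<sigma> U = \<sigma>"
    using \<sigma> by (auto simp: rotation_invariant_prob_def)
  have id: "(\<lambda>z. z) \<in> measurable (restrict_space borel (sphere 0 (1::real))) (borel :: (complex^'d) measure)"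
    by (intro measurable_restrict_space1) simp
  then show m: "(\<lambda>z. z) \<in> measurable \<sigma> borel"
    using measurable_cong_sets[OF s(2) refl] by blast
  show "sphere_measure (distr \<sigma> borel (\<lambda>z. z))"
  proof (rule sphere_measure.intro)
    interpret prob_space \<sigma> by (rule s(1))
    show "prob_space (distr \<sigma> borel (\<lambda>z. z))" by (rule prob_space_distr[OF m])
    have "space \<sigma> = sphere 0 1"
      using sets_eq_imp_space_eq[OF s(2)] by (simp add: space_restrict_space)
    then show "AE z in distr \<sigma> borel (\<lambda>z. z). norm z = 1"
      by (subst AE_distr_iff[OF m]) auto
    fix U :: "complex^'d \<Rightarrow> complex^'d" assume U: "orthogonal_transformation U"
    have Um: "U \<in> borel_measurable borel" by (rule orthogonal_measurable[OF U])
    have U\<sigma>: "U \<in> measurable \<sigma> \<sigma>" by (rule orthogonal_measurable_sphere[OF U s(2)])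
    have "distr (distr \<sigma> borel (\<lambda>z. z)) borel U = distr \<sigma> borel U"
      by (subst distr_distr[OF Um m]) (simp add: o_def)
    also have "\<dots> = distr (distr \<sigma> \<sigma> U) borel (\<lambda>z. z)"
      by (subst distr_distr[OF m U\<sigma>]) (simp add: o_def)
    finally show "distr (distr \<sigma> borel (\<lambda>z. z)) borel U = distr \<sigma> borel (\<lambda>z. z)" by (simp add: s(3)[OF U])
  qed simp
qed

theorem theorem1p2:
  fixes H :: "(complex^'d \<Rightarrow> complex) set"
    and ip :: "(complex^'d \<Rightarrow> complex) \<Rightarrow> (complex^'d \<Rightarrow> complex) \<Rightarrow> complex"
    and k :: "complex^'d \<Rightarrow> complex^'d \<Rightarrow> complex"
    and P M :: "(complex^'d \<Rightarrow> complex) set"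
    and I :: "nat set"
    and \<phi> :: "nat \<Rightarrow> complex^'d \<Rightarrow> complex"
    and \<sigma> :: "(complex^'d) measure"
  assumes "rkhs H ip k"
    and "complete_NP_kernel k"
    and "\<forall>p\<in>P. continuous_on (cball 0 1) p \<and> on_ball p \<in> H"
    and "\<forall>f\<in>H. \<forall>e>0. \<exists>p\<in>P. hnorm ip (f - on_ball p) < e"
    and "\<forall>p\<in>P. \<forall>z\<in>sphere 0 1.
           ((\<lambda>l. hnorm ip (p * k l) / hnorm ip (k l)) \<longlongrightarrow> cmod (p z)) (at z within ball 0 1)"
    and "multiplier_invariant_subspace H ip M"
    and "M \<noteq> {0}"
    and "seq_index I"
    and "\<forall>n\<in>I. \<phi> n \<in> multipliers H \<inter> M"
    and "\<forall>f\<in>H. (\<lambda>N. hnorm ip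
           ((\<Sum>n\<in>I \<inter> {..<N}. mult_op (\<phi> n) (hilbert_adjoint H ip (mult_op (\<phi> n)) f))
             - hilbert_proj ip M f)) \<longlonglongrightarrow> 0"
    and "rotation_invariant_prob \<sigma>"
  shows "inner_sequence \<sigma> I \<phi>"
proof -
  interpret np_rkhs_sphere H ip k "distr \<sigma> borel (\<lambda>z. z)"
    using assms(1,2) sphere_measure_distr(1)[OF assms(11)]
    by (intro np_rkhs_sphere.intro np_rkhs.intro np_rkhs_axioms.intro)
  have "inner_sequence (distr \<sigma> borel (\<lambda>z. z)) I \<phi>"
    by (rule multiplier_sequence_inner[of P M]) (use assms(3-10) in auto)
  then show ?thesis
    unfolding inner_sequence_def by (rule AE_distrD[OF sphere_measure_distr(2)[OF assms(11)]])
qed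

end
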